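(* Let $C$ be a compact convex subset of $\mathbb{R}^n$. Let $f:C\to\mathbb{R}$ be a function, $m\in\mathbb{N}$ with $m\geq n+3$, and let $\{P^{m}_{y}\}_{y\in C}$ be a family of polynomials on $\mathbb{R}^n$ of degree less than or equal to $m$ such that $P^{m}_y(y)=f(y)$ for every $y\in C$. Assume that $\{P^{m}_{y}\}_{y\in C}$ satisfies $(W^{m})$ and $(CW^{m})$ on $C$. Then $f$ has a convex extension $F\in C^{m-n-1}(\mathbb{R}^n)$ such that $J^{m-n-1}_{y}F=P^{m-n-1}_{y}$ for every $y\in C$.
   Context: $\mathbb{S}^{n-1}$ is the Euclidean unit sphere of $\mathbb{R}^n$. $D^jP(y)$ denotes the $j$-th derivative of $P$ at $y$ as a symmetric $j$-linear form, with $\|A\|=\sup_{u_i\in\mathbb{S}^{n-1}}|A(u_1,\ldots,u_j)|$; $D^{k}P(y)(w^{k-2},v^2)$ means this form evaluated with $w$ repeated $k-2$ times and $v$ repeated twice. $J^k_yF$ is the Taylor polynomial of order $k$ of $F$ at $y$. For $k\le m$, $P^k_y:=J^k_yP^m_y$ is the Taylor polynomial of order $k$ at $y$ of $P^m_y$. Condition $(W^m)$ on $C$ (Whitney): for each compact $K\subset C$, $\lim_{\delta\to0^+}\rho_m(K,\delta)=0$, where $$\rho_m(K,\delta)=\sup\left\{\frac{\|D^jP^m_y(z)-D^jP^m_z(z)\|}{|y-z|^{m-j}}: j=0,\ldots,m,\ y,z\in K,\ 0<|y-z|\le\delta\right\}$$ (supremum over the empty set being $0$). Condition $(CW^m)$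 on $C$ ($m\ge2$): for every $\varepsilon>0$ there exists $t_\varepsilon>0$ such that $$D^2P^{m}_{y}(y)(v^2)+ t\, D^3P^{m}_{y}(y)(w,v^2)+ \cdots + \frac{t^{m-2}}{(m-2)!} D^{m}P^{m}_{y}(y)(w^{m-2},v^2) \geq -\varepsilon t^{m-2}$$ for all $y\in C$, $v,w\in\mathbb{S}^{n-1}$, $0<t\le t_\varepsilon$. *)

theory Defs
  imports "HOL-Analysis.Analysis"
begin

definition poly_deg_le :: "nat \<Rightarrow> (real^'n \<Rightarrow> real) \<Rightarrow> bool" where
  "poly_deg_le m p \<longleftrightarrow>
     (\<exists>c :: ('n \<Rightarrow> nat) \<Rightarrow> real.
        \<forall>x. p x = (\<Sum>\<alpha> | (\<Sum>i\<in>UNIV. \<alpha> i) \<le> m. c \<alpha> * (\<Prod>i\<in>UNIV. (x $ i) ^ \<alpha> i)))"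

(* The index set of the sum above is finite, so that sum is not a silent 0. *)
lemma finite_multi_indices:
  "finite {\<alpha> :: 'n::finite \<Rightarrow> nat. (\<Sum>i\<in>UNIV. \<alpha> i) \<le> m}"
proof (rule finite_subset)
  show "{\<alpha> :: 'n \<Rightarrow> nat. (\<Sum>i\<in>UNIV. \<alpha> i) \<le> m} \<subseteq> PiE UNIV (\<lambda>_. {..m})"
  proof
    fix \<alpha> :: "'n \<Rightarrow> nat"
    assume "\<alpha> \<in> {\<alpha>. (\<Sum>i\<in>UNIV. \<alpha> i) \<le> m}"
    moreover have "\<alpha> i \<le> (\<Sum>i\<in>UNIV. \<alpha> i)" for i
      by (rule member_le_sum) simp_all
    ultimately have "\<alpha> i \<le> m" for i
      using le_trans by blast
    then show "\<alpha> \<in> PiE UNIV (\<lambda>_. {..m})"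
      by (simp add: PiE_def Pi_def)
  qed
  show "finite (PiE (UNIV :: 'n set) (\<lambda>_. {..m}))"
    by (rule finite_PiE) simp_all
qed

(* higher_deriv f x [u1, ..., uj] is D^j f(x)(u1, ..., uj); the order j is the length of the list. *)
primrec higher_deriv ::
    "('a::real_normed_vector \<Rightarrow> real) \<Rightarrow> 'a \<Rightarrow> 'a list \<Rightarrow> real" where
  "higher_deriv f x [] = f x"
| "higher_deriv f x (u # us) = frechet_derivative (\<lambda>z. higher_deriv f z us) (at x) u"

(* A j-linear form is represented by its values on argument lists of length j. *)
definition form_norm :: "nat \<Rightarrow> ('a::real_normed_vector list \<Rightarrow> real) \<Rightarrow> real" where
  "form_norm j A = (SUP us \<in> {us. length us = j \<and> set us \<subseteq> sphere 0 1}. \<bar>A us\<bar>)"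

(* F is of class C^k on the whole space; in finite dimension it is enough to ask
   that all directional evaluations of the derivative are of class C^(k-1). *)
primrec C_k :: "nat \<Rightarrow> ('a::euclidean_space \<Rightarrow> real) \<Rightarrow> bool" where
  "C_k 0 F \<longleftrightarrow> continuous_on UNIV F"
| "C_k (Suc k) F \<longleftrightarrow>
     (\<forall>x. F differentiable (at x)) \<and> (\<forall>u. C_k k (\<lambda>x. frechet_derivative F (at x) u))"

definition taylor_poly ::
    "nat \<Rightarrow> 'a::real_normed_vector \<Rightarrow> ('a \<Rightarrow> real) \<Rightarrow> 'a \<Rightarrow> real" where
  "taylor_poly k y F = (\<lambda>x. \<Sum>j\<le>k. higher_deriv F y (replicate j (x - y)) / fact j)"

(* Extended values: the supremum may be infinite, and over the empty set it is 0. *)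
definition whitney_rho ::
    "nat \<Rightarrow> (real^'n \<Rightarrow> real^'n \<Rightarrow> real) \<Rightarrow> (real^'n) set \<Rightarrow> real \<Rightarrow> ennreal" where
  "whitney_rho m P K \<delta> =
     (SUP (j, y, z) \<in> {(j, y, z). j \<le> m \<and> y \<in> K \<and> z \<in> K \<and> 0 < norm (y - z) \<and> norm (y - z) \<le> \<delta>}.
        ennreal (form_norm j (\<lambda>us. higher_deriv (P y) z us - higher_deriv (P z) z us)
                 / norm (y - z) ^ (m - j)))"

definition cond_W :: "nat \<Rightarrow> (real^'n) set \<Rightarrow> (real^'n \<Rightarrow> real^'n \<Rightarrow> real) \<Rightarrow> bool" where
  "cond_W m C P \<longleftrightarrow>
     (\<forall>K. compact K \<and> K \<subseteq> C \<longrightarrow> ((\<lambda>\<delta>. whitney_rho m P K \<delta>) \<longlongrightarrow> 0) (at_right 0))"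

(* Meant for m >= 2. *)
definition cond_CW :: "nat \<Rightarrow> (real^'n) set \<Rightarrow> (real^'n \<Rightarrow> real^'n \<Rightarrow> real) \<Rightarrow> bool" where
  "cond_CW m C P \<longleftrightarrow>
     (\<forall>\<epsilon>>0. \<exists>t\<^sub>\<epsilon>>0. \<forall>y\<in>C. \<forall>v\<in>sphere 0 1. \<forall>w\<in>sphere 0 1. \<forall>t. 0 < t \<and> t \<le> t\<^sub>\<epsilon> \<longrightarrow>
        (\<Sum>k = 2..m. t ^ (k - 2) / fact (k - 2) * higher_deriv (P y) y (replicate (k - 2) w @ [v, v]))
          \<ge> - \<epsilon> * t ^ (m - 2))"

end

theory Submission
  imports Defs
begin

text \<open>The extension is a sum \<open>F = E + \<phi>\<close>. The function \<open>E\<close> is smooth and has the prescribed jets on \<open>C\<close>,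
but it need not be convex. The function \<open>\<phi>\<close> is convex, all its derivatives up to order
\<open>q = m - n - 1\<close> vanish on \<open>C\<close>, and away from \<open>C\<close> its Hessian is large enough to make up for the
negative part of the Hessian of \<open>E\<close>.

\<^bold>\<open>The smooth part\<close> (called \<open>extension\<close> below). At scale \<open>2^-k\<close> a lattice partition of unity
glues the polynomials \<open>P y\<close>, where \<open>y\<close> runs over the points of \<open>C\<close> closest to the lattice nodes
near \<open>C\<close>, to a function \<open>approx k\<close>. With cutoffs that equal 1 close to \<open>C\<close>, the function \<open>E\<close> is the telescoping series that passes from
each \<open>approx k\<close> to \<open>approx (k + 1)\<close>, but only near \<open>C\<close>. Whitney's condition says that neighbouring
polynomials differ, together with their derivatives of order \<open>j\<close>, by \<open>o(2^(-k(m-j)))\<close>; so the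
derivatives of the \<open>k\<close>-th summand have that size, and for \<open>j < m\<close> the differentiated series converge
uniformly. Hence \<open>E\<close> is of class \<open>C^q\<close> and takes the right jets (\<open>extension_jet\<close>), and at distance \<open>d\<close>
from \<open>C\<close> its second derivatives differ by \<open>o(d^(m-2))\<close> from those of \<open>P y\<close>, where \<open>y\<close> is the nearest
point of \<open>C\<close> (\<open>extension_near\<close>). A polynomial is its own Taylor polynomial, so the condition
\<open>(CW^m)\<close> is exactly the lower bound \<open>- o(d^(m-2))\<close> for the Hessian of \<open>P y\<close> at distance \<open>d\<close> from
\<open>y\<close>. Thus the Hessian of \<open>E\<close> is at least \<open>- \<Omega>(d) d^(m-2)\<close> for a modulus \<open>\<Omega>\<close>
(\<open>hessian_defect_modulus\<close>).

\<^bold>\<open>The convex part\<close> (called \<open>Phi\<close> below). With \<open>h\<close> the support function of \<open>C\<close>, let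
\<open>\<phi>(x)\<close> be the integral of \<open>g(x \<bullet> w - h(w))\<close> over all \<open>w\<close> in a cube, where \<open>g\<close> is a convex function of class \<open>C^q\<close> that vanishes
on the negative axis and whose second derivative dominates \<open>t^(q-2)\<close> times a modulus. If \<open>x\<close> lies in
\<open>C\<close>, then \<open>x \<bullet> w \<le> h(w)\<close> for all \<open>w\<close>, so all derivatives vanish there. If \<open>x\<close> is at a small
distance \<open>d\<close> from \<open>C\<close> and \<open>e\<close> is the outward unit direction, then \<open>x \<bullet> w - h(w) \<ge> d/4\<close> in a tube of radius of order \<open>d\<close>
around the segment \<open>[1/2, 3/4] e\<close>. For a unit vector \<open>v\<close>, a fixed proportion of this tube, of volume
of order \<open>d^(n-1)\<close>, satisfies \<open>(v \<bullet> w)^2 \<ge> c d^2\<close>. So the Hessian of \<open>\<phi>\<close> is at least a constant times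
\<open>g''(d/4) d^(n+1)\<close> (\<open>Phi_hessian_lower\<close>): the \<open>n + 1\<close> lost derivatives are the price of this
averaging, since \<open>(q - 2) + (n + 1) = m - 2\<close>.\<close>

section \<open>Directional derivatives and the classes of k times differentiable functions\<close>

definition dir_deriv :: "'a::real_normed_vector \<Rightarrow> ('a \<Rightarrow> real) \<Rightarrow> 'a \<Rightarrow> real" where
  "dir_deriv u f = (\<lambda>x. frechet_derivative f (at x) u)"

text \<open>The recursion of \<open>higher_deriv\<close> peels off the outermost derivative, that of \<open>C_k\<close> the innermost one.
This identity moves between the two, and lets inductions on the order of smoothness reach all higher
derivatives.\<close>

lemma higher_deriv_snoc:
  "higher_deriv f x (us @ [u]) = higher_deriv (dir_deriv u f) x us"
proof (induction us arbitrary: x)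
  case (Cons v us)
  then have "(\<lambda>z. higher_deriv f z (us @ [u])) = (\<lambda>z. higher_deriv (dir_deriv u f) z us)"
    by blast
  then show ?case by simp
qed (simp add: dir_deriv_def)

lemma C_k_Suc_iff:
  "C_k (Suc k) f \<longleftrightarrow> (\<forall>x. f differentiable (at x)) \<and> (\<forall>u. C_k k (dir_deriv u f))"
  by (simp add: dir_deriv_def)

text \<open>From here on \<open>C_k\<close> is unfolded by \<open>C_k_Suc_iff\<close>, which keeps the simplifier from exposing the Frechet
derivatives behind \<open>dir_deriv\<close>.\<close>

declare C_k.simps(2) [simp del]

lemma C_k_imp_continuous: "C_k k f \<Longrightarrow> continuous_on UNIV f"
  by (cases k) (auto intro: differentiable_imp_continuous_on differentiable_on_subset
      simp: differentiable_on_def differentiable_at_withinI C_k.simps(2))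

lemma C_k_Suc_imp: "C_k (Suc k) f \<Longrightarrow> C_k k f"
proof (induction k arbitrary: f)
  case 0
  then show ?case using C_k_imp_continuous by (metis C_k.simps(1))
next
  case (Suc k)
  then show ?case by (simp only: C_k_Suc_iff) blast
qed

lemma C_k_antimono: "C_k l f \<Longrightarrow> k \<le> l \<Longrightarrow> C_k k f"
  by (induction l) (auto simp: le_Suc_eq dest: C_k_Suc_imp)

lemma C_k_higher_deriv: "C_k (k + length us) f \<Longrightarrow> C_k k (\<lambda>x. higher_deriv f x us)"
proof (induction us arbitrary: f rule: rev_induct)
  case (snoc u us)
  then show ?case by (simp add: higher_deriv_snoc C_k_Suc_iff)
qed simp

lemma higher_deriv_differentiable:
  "C_k k f \<Longrightarrow> length us < k \<Longrightarrow> (\<lambda>x. higher_deriv f x us) differentiable (at x)"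
  using C_k_higher_deriv[of 1 us f] C_k_antimono[of k f "1 + length us"] by (simp add: C_k_Suc_iff)

lemma has_derivative_higher_deriv:
  assumes "C_k k f" "length us < k"
  shows "((\<lambda>x. higher_deriv f x us) has_derivative (\<lambda>u. higher_deriv f x (u # us))) (at x)"
  using higher_deriv_differentiable[OF assms] by (simp add: frechet_derivative_works)

lemma has_derivative_dir_deriv:
  "f differentiable (at x) \<Longrightarrow> (f has_derivative (\<lambda>u. dir_deriv u f x)) (at x)"
  by (simp add: frechet_derivative_works dir_deriv_def)

lemma dir_derivI: "(f has_derivative f') (at x) \<Longrightarrow> dir_deriv u f x = f' u"
  by (simp add: dir_deriv_def frechet_derivative_at[symmetric])

text \<open>The Whitney extension is built from sums that simplify locally, because terms vanish or telescope near
a given point; this lemma allows one to differentiate the simpler local expression.\<close>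

lemma higher_deriv_cong_open:
  assumes "open U" "x \<in> U" "\<And>z. z \<in> U \<Longrightarrow> f z = g z"
  shows "higher_deriv f x us = higher_deriv g x us"
  using assms(2)
proof (induction us arbitrary: x)
  case (Cons u us)
  have "((\<lambda>z. higher_deriv f z us) has_derivative D) (at x) \<longleftrightarrow>
        ((\<lambda>z. higher_deriv g z us) has_derivative D) (at x)" for D
    using Cons assms(1)
    by (auto intro: has_derivative_transform_within_open simp: Cons.IH)
  then show ?case by (simp add: frechet_derivative_def)
qed (use assms in simp)

lemma dir_deriv_const [simp]: "dir_deriv u (\<lambda>x. c) = (\<lambda>x. 0)"
  by (rule ext) (rule dir_derivI[where f'="\<lambda>_. 0"], simp)

lemma C_k_const [simp]: "C_k k (\<lambda>x. c)"
proof (induction k arbitrary: c)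
  case (Suc k)
  then show ?case by (simp add: C_k_Suc_iff)
qed simp

lemma dir_deriv_add:
  assumes "f differentiable (at x)" "g differentiable (at x)"
  shows "dir_deriv u (\<lambda>x. f x + g x) x = dir_deriv u f x + dir_deriv u g x"
  using assms by (intro dir_derivI) (intro has_derivative_add has_derivative_dir_deriv)

lemma dir_deriv_mult:
  assumes "f differentiable (at x)" "g differentiable (at x)"
  shows "dir_deriv u (\<lambda>x. f x * g x) x = f x * dir_deriv u g x + dir_deriv u f x * g x"
  using assms by (intro dir_derivI) (intro has_derivative_mult has_derivative_dir_deriv)

lemma C_k_add: "C_k k f \<Longrightarrow> C_k k g \<Longrightarrow> C_k k (\<lambda>x. f x + g x)"
proof (induction k arbitrary: f g)
  case (Suc k)
  then have "dir_deriv u (\<lambda>x. f x + g x) = (\<lambda>x. dir_deriv u f x + dir_deriv u g x)" for u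
    by (auto simp: dir_deriv_add C_k_Suc_iff)
  with Suc show ?case by (auto simp: C_k_Suc_iff)
qed (auto intro: continuous_intros)

lemma C_k_mult: "C_k k f \<Longrightarrow> C_k k g \<Longrightarrow> C_k k (\<lambda>x. f x * g x)"
proof (induction k arbitrary: f g)
  case (Suc k)
  then have "dir_deriv u (\<lambda>x. f x * g x) = (\<lambda>x. f x * dir_deriv u g x + dir_deriv u f x * g x)" for u
    by (auto simp: dir_deriv_mult C_k_Suc_iff)
  with Suc C_k_Suc_imp[of k f] C_k_Suc_imp[of k g] show ?case
    by (auto simp: C_k_Suc_iff intro!: C_k_add)
qed (auto intro: continuous_intros)

lemma C_k_cmult: "C_k k f \<Longrightarrow> C_k k (\<lambda>x. c * f x)"
  by (intro C_k_mult C_k_const)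

lemma C_k_diff: "C_k k f \<Longrightarrow> C_k k g \<Longrightarrow> C_k k (\<lambda>x. f x - g x)"
  using C_k_add[of k f "\<lambda>x. -1 * g x"] C_k_cmult[of k g "-1"] by simp

lemma C_k_sum: "(\<And>i. i \<in> I \<Longrightarrow> C_k k (f i)) \<Longrightarrow> C_k k (\<lambda>x. \<Sum>i\<in>I. f i x)"
  by (induction I rule: infinite_finite_induct) (auto intro!: C_k_add)

lemma higher_deriv_add:
  assumes "C_k k f" "C_k k g" "length us \<le> k"
  shows "higher_deriv (\<lambda>x. f x + g x) x us = higher_deriv f x us + higher_deriv g x us"
  using assms(3)
proof (induction us arbitrary: x)
  case (Cons u us)
  then have "(\<lambda>z. higher_deriv (\<lambda>x. f x + g x) z us) = (\<lambda>z. higher_deriv f z us + higher_deriv g z us)"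
    by auto
  then show ?case
    using Cons.prems dir_deriv_add[of "\<lambda>z. higher_deriv f z us" x "\<lambda>z. higher_deriv g z us" u]
      higher_deriv_differentiable[OF assms(1)] higher_deriv_differentiable[OF assms(2)]
    by (simp add: dir_deriv_def)
qed simp

lemma higher_deriv_0 [simp]: "higher_deriv (\<lambda>x. 0) x us = 0"
proof (induction us arbitrary: x)
  case (Cons u us)
  then show ?case using dir_deriv_const[of u 0] by (simp add: dir_deriv_def fun_eq_iff)
qed simp

lemma higher_deriv_cmult:
  assumes "C_k k f" "length us \<le> k"
  shows "higher_deriv (\<lambda>x. c * f x) x us = c * higher_deriv f x us"
  using assms(2)
proof (induction us arbitrary: x)
  case (Cons u us)
  then have "(\<lambda>z. higher_deriv (\<lambda>x. c * f x) z us) = (\<lambda>z. c * higher_deriv f z us)"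
    by auto
  then show ?case
    using Cons.prems dir_deriv_mult[of "\<lambda>_. c" x "\<lambda>z. higher_deriv f z us" u]
      higher_deriv_differentiable[OF assms(1)] dir_deriv_const[of u c]
    by (simp add: dir_deriv_def fun_eq_iff)
qed simp

lemma higher_deriv_diff:
  assumes "C_k k f" "C_k k g" "length us \<le> k"
  shows "higher_deriv (\<lambda>x. f x - g x) x us = higher_deriv f x us - higher_deriv g x us"
  using higher_deriv_add[OF assms(1) C_k_cmult[OF assms(2), of "-1"] assms(3)]
    higher_deriv_cmult[OF assms(2,3), of "-1"] by simp

text \<open>Homogeneity in each slot. The pairs \<open>(c, w)\<close> list the factor and the direction of each argument.\<close>

lemma higher_deriv_scaleR:
  assumes "C_k k f" "length ps \<le> k"
  shows "higher_deriv f x (map (\<lambda>(c, w). c *\<^sub>R w) ps) = prod_list (map fst ps) * higher_deriv f x (map snd ps)"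
  using assms(2)
proof (induction ps arbitrary: x)
  case (Cons p ps)
  let ?g = "\<lambda>z. higher_deriv f z (map snd ps)"
  have eq: "(\<lambda>z. higher_deriv f z (map (\<lambda>(c, w). c *\<^sub>R w) ps)) = (\<lambda>z. prod_list (map fst ps) * ?g z)"
    using Cons by auto
  have d: "(?g has_derivative (\<lambda>u. dir_deriv u ?g x)) (at x)"
    using Cons.prems by (intro has_derivative_dir_deriv higher_deriv_differentiable[OF assms(1)]) simp
  have "higher_deriv f x (map (\<lambda>(c, w). c *\<^sub>R w) (p # ps))
        = dir_deriv (fst p *\<^sub>R snd p) (\<lambda>z. prod_list (map fst ps) * ?g z) x"
    by (simp add: eq dir_deriv_def case_prod_beta)
  also have "\<dots> = prod_list (map fst ps) * dir_deriv (fst p *\<^sub>R snd p) ?g x"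
    by (rule dir_derivI[OF has_derivative_mult_right[OF d]])
  also have "dir_deriv (fst p *\<^sub>R snd p) ?g x = fst p * dir_deriv (snd p) ?g x"
    using linear_scale[OF has_derivative_linear[OF d]] by simp
  finally show ?case by (simp add: dir_deriv_def)
qed simp

section \<open>Functions with bounded jets\<close>

text \<open>Besides \<open>C_k k f\<close>, this says that at the single point \<open>x\<close> the \<open>j\<close>-th derivative has norm at most
\<open>A s^j\<close>: the function has amplitude \<open>A\<close> and varies on the length scale \<open>1/s\<close>. With these two parameters
the Leibniz rule becomes \<open>jet_bound_mult\<close>, in which amplitudes multiply and frequencies add.\<close>

definition jet_bound :: "nat \<Rightarrow> 'a \<Rightarrow> real \<Rightarrow> real \<Rightarrow> ('a::euclidean_space \<Rightarrow> real) \<Rightarrow> bool" where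
  "jet_bound k x A s f \<longleftrightarrow> C_k k f \<and>
     (\<forall>us. length us \<le> k \<longrightarrow> \<bar>higher_deriv f x us\<bar> \<le> A * s ^ length us * prod_list (map norm us))"

lemma jet_boundD:
  "jet_bound k x A s f \<Longrightarrow> length us \<le> k \<Longrightarrow> \<bar>higher_deriv f x us\<bar> \<le> A * s ^ length us * prod_list (map norm us)"
  by (auto simp: jet_bound_def)

lemma prod_list_norm_nonneg [simp]: "0 \<le> prod_list (map norm us)"
  by (induction us) auto

lemma jet_bound_0: "jet_bound 0 x A s f \<longleftrightarrow> continuous_on UNIV f \<and> \<bar>f x\<bar> \<le> A"
  by (auto simp: jet_bound_def)

text \<open>The form in which a jet bound is proved or used by induction: a derivative in direction \<open>u\<close> has the
same frequency, and amplitude larger by \<open>s * norm u\<close>.\<close>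

lemma jet_bound_Suc:
  "jet_bound (Suc k) x A s f \<longleftrightarrow>
     (\<forall>z. f differentiable (at z)) \<and> \<bar>f x\<bar> \<le> A \<and> (\<forall>u. jet_bound k x (A * s * norm u) s (dir_deriv u f))"
  (is "?l \<longleftrightarrow> ?r")
proof
  assume l: ?l
  have "\<bar>higher_deriv (dir_deriv u f) x us\<bar> \<le> A * s * norm u * s ^ length us * prod_list (map norm us)"
    if "length us \<le> k" for u us
    using jet_boundD[OF l, of "us @ [u]"] that by (simp add: higher_deriv_snoc mult_ac)
  moreover have "\<bar>f x\<bar> \<le> A" using jet_boundD[OF l, of "[]"] by simp
  ultimately show ?r using l by (auto simp: jet_bound_def C_k_Suc_iff)
next
  assume r: ?r
  have "\<bar>higher_deriv f x us\<bar> \<le> A * s ^ length us * prod_list (map norm us)"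
    if "length us \<le> Suc k" for us
  proof (cases us rule: rev_cases)
    case Nil
    then show ?thesis using r by simp
  next
    case (snoc vs u)
    then show ?thesis using r jet_boundD[of k x "A * s * norm u" s "dir_deriv u f" vs] that
      by (auto simp add: higher_deriv_snoc mult_ac)
  qed
  then show ?l using r by (auto simp: jet_bound_def C_k_Suc_iff)
qed

lemma jet_bound_imp_C_k: "jet_bound k x A s f \<Longrightarrow> C_k k f"
  by (simp add: jet_bound_def)

lemma jet_bound_antimono: "jet_bound l x A s f \<Longrightarrow> k \<le> l \<Longrightarrow> jet_bound k x A s f"
  by (auto simp: jet_bound_def intro: C_k_antimono)

lemma jet_bound_mono:
  assumes "jet_bound k x A s f" "A \<le> B" "0 \<le> A" "0 \<le> s" "s \<le> t"
  shows "jet_bound k x B t f"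
  unfolding jet_bound_def
proof (intro conjI allI impI)
  fix us :: "'a list" assume "length us \<le> k"
  then have "\<bar>higher_deriv f x us\<bar> \<le> A * s ^ length us * prod_list (map norm us)"
    by (rule jet_boundD[OF assms(1)])
  also have "\<dots> \<le> B * t ^ length us * prod_list (map norm us)"
    using assms by (intro mult_right_mono mult_mono power_mono) auto
  finally show "\<bar>higher_deriv f x us\<bar> \<le> B * t ^ length us * prod_list (map norm us)" .
qed (use assms(1) in \<open>simp add: jet_bound_def\<close>)

lemma jet_bound_rescale:
  assumes "jet_bound k x A s f" "0 \<le> A" "1 \<le> s"
  shows "jet_bound k x (A * s ^ k) 1 f"
  unfolding jet_bound_def
proof (intro conjI allI impI)
  fix us :: "'a list" assume "length us \<le> k"
  then have "\<bar>higher_deriv f x us\<bar> \<le> A * s ^ length us * prod_list (map norm us)"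
    by (rule jet_boundD[OF assms(1)])
  also have "\<dots> \<le> A * s ^ k * prod_list (map norm us)"
    using assms \<open>length us \<le> k\<close> by (intro mult_right_mono mult_left_mono power_increasing) auto
  finally show "\<bar>higher_deriv f x us\<bar> \<le> A * s ^ k * 1 ^ length us * prod_list (map norm us)" by simp
qed (use assms(1) in \<open>simp add: jet_bound_def\<close>)

lemma jet_bound_add:
  assumes "jet_bound k x A s f" "jet_bound k x B s g"
  shows "jet_bound k x (A + B) s (\<lambda>z. f z + g z)"
  unfolding jet_bound_def
proof (intro conjI allI impI)
  show "C_k k (\<lambda>z. f z + g z)" using assms by (auto simp: jet_bound_def intro: C_k_add)
  fix us :: "'a list" assume "length us \<le> k"
  then show "\<bar>higher_deriv (\<lambda>z. f z + g z) x us\<bar> \<le> (A + B) * s ^ length us * prod_list (map norm us)"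
    using jet_boundD[OF assms(1), of us] jet_boundD[OF assms(2), of us]
      higher_deriv_add[of k f g us x] assms[THEN jet_bound_imp_C_k]
    by (simp add: distrib_right) 
qed

lemma jet_bound_diff:
  assumes "jet_bound k x A s f" "jet_bound k x B s g"
  shows "jet_bound k x (A + B) s (\<lambda>z. f z - g z)"
  unfolding jet_bound_def
proof (intro conjI allI impI)
  show "C_k k (\<lambda>z. f z - g z)" using assms by (auto simp: jet_bound_def intro: C_k_diff)
  fix us :: "'a list" assume "length us \<le> k"
  then show "\<bar>higher_deriv (\<lambda>z. f z - g z) x us\<bar> \<le> (A + B) * s ^ length us * prod_list (map norm us)"
    using jet_boundD[OF assms(1), of us] jet_boundD[OF assms(2), of us]
      higher_deriv_diff[of k f g us x] assms[THEN jet_bound_imp_C_k]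
    by (simp add: distrib_right)
qed

lemma jet_bound_cmult:
  assumes "jet_bound k x A s f"
  shows "jet_bound k x (\<bar>c\<bar> * A) s (\<lambda>z. c * f z)"
  unfolding jet_bound_def
proof (intro conjI allI impI)
  show "C_k k (\<lambda>z. c * f z)" using assms by (auto simp: jet_bound_def intro: C_k_cmult)
  fix us :: "'a list" assume "length us \<le> k"
  then show "\<bar>higher_deriv (\<lambda>z. c * f z) x us\<bar> \<le> \<bar>c\<bar> * A * s ^ length us * prod_list (map norm us)"
    using mult_left_mono[OF jet_boundD[OF assms(1), of us], of "\<bar>c\<bar>"]
      higher_deriv_cmult[of k f us c x] assms[THEN jet_bound_imp_C_k]
    by (simp add: abs_mult mult_ac)
qed

lemma jet_bound_zero: "0 \<le> A \<Longrightarrow> 0 \<le> s \<Longrightarrow> jet_bound k x A s (\<lambda>z. 0)"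
  by (simp add: jet_bound_def)

lemma jet_bound_const: "\<bar>c\<bar> \<le> A \<Longrightarrow> 0 \<le> s \<Longrightarrow> jet_bound k x A s (\<lambda>z. c)"
  by (cases k) (auto simp: jet_bound_Suc jet_bound_0 intro!: jet_bound_zero)

text \<open>The Leibniz sum over subsets is hidden in the binomial formula for \<open>(s + t)^j\<close>: one differentiation
turns \<open>AB\<close> into \<open>A (B t) + (A s) B = AB (s + t)\<close>.\<close>

lemma jet_bound_mult:
  assumes "jet_bound k x A s f" "jet_bound k x B t g" 
  shows "jet_bound k x (A * B) (s + t) (\<lambda>z. f z * g z)"
  using assms
proof (induction k arbitrary: f g A B)
  case 0
  then show ?case by (auto simp: jet_bound_0 abs_mult intro!: mult_mono continuous_intros)
next
  case (Suc k)
  have "0 \<le> A" using Suc.prems(1) by (auto simp: jet_bound_Suc)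
  have d: "\<And>z. f differentiable (at z)" "\<And>z. g differentiable (at z)"
    using Suc.prems by (auto simp: jet_bound_Suc)
  have eq: "dir_deriv u (\<lambda>x. f x * g x) = (\<lambda>x. f x * dir_deriv u g x + dir_deriv u f x * g x)" for u
    using d by (auto simp: dir_deriv_mult)
  have "jet_bound k x (A * (B * t * norm u) + (A * s * norm u) * B) (s + t) (dir_deriv u (\<lambda>x. f x * g x))" for u
    unfolding eq using Suc.prems
    by (intro jet_bound_add Suc.IH)
      (auto simp: jet_bound_Suc[symmetric] intro: jet_bound_antimono, auto simp: jet_bound_Suc)
  moreover have "A * (B * t * norm u) + (A * s * norm u) * B = A * B * (s + t) * norm u" for u :: 'a
    by (simp add: algebra_simps)
  ultimately have "jet_bound k x (A * B * (s + t) * norm u) (s + t) (dir_deriv u (\<lambda>x. f x * g x))" for u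
    by metis
  moreover have "\<bar>f x * g x\<bar> \<le> A * B"
    using Suc.prems \<open>0 \<le> A\<close> by (auto simp: jet_bound_Suc abs_mult intro!: mult_mono)
  ultimately show ?case unfolding jet_bound_Suc using d by (intro conjI allI differentiable_mult)
qed

lemma jet_bound_sum:
  assumes "\<And>i. i \<in> I \<Longrightarrow> jet_bound k x (A i) s (f i)"
  shows "jet_bound k x (\<Sum>i\<in>I. A i) s (\<lambda>z. \<Sum>i\<in>I. f i z)"
  using assms
proof (induction I rule: infinite_finite_induct)
  case (insert i I)
  then show ?case by (simp add: jet_bound_add)
qed (auto simp: jet_bound_def)

lemma jet_bound_prod:
  assumes "finite I" "\<And>i. i \<in> I \<Longrightarrow> jet_bound k x (A i) (s i) (f i)"
  shows "jet_bound k x (\<Prod>i\<in>I. A i) (\<Sum>i\<in>I. s i) (\<lambda>z. \<Prod>i\<in>I. f i z)"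
  using assms
proof (induction I rule: finite_induct)
  case (insert i I)
  then show ?case by (simp add: jet_bound_mult)
qed (auto intro: jet_bound_const)

lemma jet_bound_cong_open:
  assumes "open U" "x \<in> U" "\<And>z. z \<in> U \<Longrightarrow> f z = g z" "jet_bound k x A s g" "C_k k f"
  shows "jet_bound k x A s f"
  using assms(4,5) higher_deriv_cong_open[OF assms(1-3)] by (auto simp: jet_bound_def)

text \<open>Term by term differentiation of a series whose jets are dominated, uniformly in \<open>x\<close>, by a summable
sequence.\<close>

lemma C_k_series:
  fixes T :: "nat \<Rightarrow> 'a::euclidean_space \<Rightarrow> real"
  assumes "\<And>i x. jet_bound k x (B i) 1 (T i)" "summable B"
  shows "C_k k (\<lambda>x. \<Sum>i. T i x) \<and>
    (\<forall>us x. length us \<le> k \<longrightarrow> (\<lambda>i. higher_deriv (T i) x us) sums higher_deriv (\<lambda>x. \<Sum>i. T i x) x us)"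
  using assms
proof (induction k arbitrary: T B)
  case 0
  have b: "\<bar>T i x\<bar> \<le> B i" for i x using "0.prems"(1)[of x i] by (simp add: jet_bound_0)
  have u: "uniform_limit UNIV (\<lambda>n x. \<Sum>i<n. T i x) (\<lambda>x. \<Sum>i. T i x) sequentially"
    by (rule Weierstrass_m_test) (use b "0.prems" in auto)
  have "continuous_on UNIV (\<lambda>x. \<Sum>i. T i x)"
    by (rule uniform_limit_theorem[OF _ u]) (use "0.prems"(1) in \<open>auto simp: jet_bound_0 intro!: always_eventually continuous_on_sum\<close>)
  moreover have "summable (\<lambda>i. T i x)" for x
    by (rule summable_comparison_test'[OF "0.prems"(2)]) (use b in auto)
  ultimately show ?case by (auto simp: summable_sums)
next
  case (Suc k)
  have jb: "jet_bound k x (norm u * B i) 1 (dir_deriv u (T i))" for i x u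
    using Suc.prems(1)[of x i] by (simp add: jet_bound_Suc mult.commute)
  have b: "\<bar>T i x\<bar> \<le> B i" and d: "T i differentiable (at x)" for i x
    using Suc.prems(1)[of x i] by (auto simp: jet_bound_Suc)
  have db: "\<bar>dir_deriv u (T i) x\<bar> \<le> norm u * B i" for i x u
    using jet_boundD[OF jb[of x u i], of "[]"] by simp
  have IH: "C_k k (\<lambda>x. \<Sum>i. dir_deriv u (T i) x)"
    "\<And>us x. length us \<le> k \<Longrightarrow> (\<lambda>i. higher_deriv (dir_deriv u (T i)) x us) sums higher_deriv (\<lambda>x. \<Sum>i. dir_deriv u (T i) x) x us" for u
    using Suc.IH[of "\<lambda>i. norm u * B i" "\<lambda>i. dir_deriv u (T i)"] jb Suc.prems(2) by (auto intro: summable_mult)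
  have s0: "summable (\<lambda>i. T i x)" for x
    by (rule summable_comparison_test'[OF Suc.prems(2)]) (use b in auto)
  have s1: "summable (\<lambda>i. dir_deriv u (T i) x)" for x u
    by (rule summable_comparison_test'[of "\<lambda>i. norm u * B i" 0]) (use db Suc.prems(2) in \<open>auto intro: summable_mult\<close>)
  have "\<exists>g. \<forall>x\<in>UNIV. (\<lambda>n. T n x) sums g x \<and> (g has_derivative (\<lambda>u. \<Sum>i. dir_deriv u (T i) x)) (at x within UNIV)"
  proof (rule has_derivative_series[where f'="\<lambda>i x u. dir_deriv u (T i) x"])
    show "(T i has_derivative (\<lambda>u. dir_deriv u (T i) x)) (at x within UNIV)" for i x
      using has_derivative_dir_deriv[OF d] by auto
    show "\<forall>\<^sub>F n in sequentially. \<forall>x\<in>UNIV. \<forall>h. norm ((\<Sum>i<n. dir_deriv h (T i) x) - (\<Sum>i. dir_deriv h (T i) x)) \<le> e * norm h"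
      if "e > 0" for e
    proof -
      have "(\<lambda>n. \<Sum>i. B (i + n)) \<longlonglongrightarrow> 0" by (rule suminf_exist_split2[OF Suc.prems(2)])
      then have "\<forall>\<^sub>F n in sequentially. (\<Sum>i. B (i + n)) < e" using that by (rule order_tendstoD)
      then show ?thesis
      proof eventually_elim
        case (elim n)
        show ?case
        proof (intro ballI allI)
          fix x h :: 'a
          have sb: "summable (\<lambda>i. norm h * B (i + n))"
            using Suc.prems(2) by (intro summable_mult summable_ignore_initial_segment)
          have "(\<Sum>i. dir_deriv h (T i) x) - (\<Sum>i<n. dir_deriv h (T i) x) = (\<Sum>i. dir_deriv h (T (i + n)) x)"
            using suminf_minus_initial_segment[OF s1[where u=h and x=x], where k=n] by simp
          then have "norm ((\<Sum>i<n. dir_deriv h (T i) x) - (\<Sum>i. dir_deriv h (T i) x)) = norm (\<Sum>i. dir_deriv h (T (i + n)) x)"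
            by (metis norm_minus_commute)
          also have "\<dots> \<le> (\<Sum>i. norm h * B (i + n))"
            by (rule norm_suminf_le[OF _ sb]) (use db in auto)
          also have "\<dots> = norm h * (\<Sum>i. B (i + n))"
            using Suc.prems(2) by (intro suminf_mult summable_ignore_initial_segment)
          also have "\<dots> \<le> e * norm h" using mult_left_mono[OF less_imp_le[OF elim] norm_ge_zero, of h] by (simp add: mult.commute)
          finally show "norm ((\<Sum>i<n. dir_deriv h (T i) x) - (\<Sum>i. dir_deriv h (T i) x)) \<le> e * norm h" .
        qed
      qed
    qed
    show "(\<lambda>n. T n 0) sums (\<Sum>i. T i 0)" using s0 by (rule summable_sums)
  qed auto
  then obtain g where g: "\<And>x. (\<lambda>n. T n x) sums g x" "\<And>x. (g has_derivative (\<lambda>u. \<Sum>i. dir_deriv u (T i) x)) (at x)"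
    by auto
  have geq: "(\<lambda>x. \<Sum>i. T i x) = g" by (intro ext) (simp add: sums_unique[OF g(1), symmetric])
  have dg: "dir_deriv u g = (\<lambda>x. \<Sum>i. dir_deriv u (T i) x)" for u
    by (rule ext) (rule dir_derivI[OF g(2)])
  have "C_k (Suc k) g" using g(2) IH(1) by (auto simp: C_k_Suc_iff dg differentiable_def)
  moreover have "(\<lambda>i. higher_deriv (T i) x us) sums higher_deriv g x us" if "length us \<le> Suc k" for us x
  proof (cases us rule: rev_cases)
    case Nil then show ?thesis using g by simp
  next
    case (snoc vs u)
    then show ?thesis using IH(2)[of vs u x] that by (simp add: higher_deriv_snoc dg)
  qed
  ultimately show ?case by (simp add: geq)
qed

section \<open>Polynomials and exact Taylor expansion\<close>

text \<open>Over the reals these are the polynomials of degree less than \<open>k\<close>, described without coefficients.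
What the proof needs of a polynomial is that its Taylor expansion is exact and that this class is
closed under sums and products.\<close>

definition derivs_vanish_from :: "nat \<Rightarrow> ('a::euclidean_space \<Rightarrow> real) \<Rightarrow> bool" where
  "derivs_vanish_from k f \<longleftrightarrow>
     (\<forall>j. C_k j f) \<and> (\<forall>us x. k \<le> length us \<longrightarrow> higher_deriv f x us = 0)"

lemma derivs_vanish_from_Suc:
  "derivs_vanish_from (Suc k) f \<longleftrightarrow>
     (\<forall>x. f differentiable (at x)) \<and> (\<forall>u. derivs_vanish_from k (dir_deriv u f))"
  (is "?l \<longleftrightarrow> ?r")
proof
  assume l: ?l
  then have "C_k (Suc j) f" for j by (auto simp: derivs_vanish_from_def)
  moreover have "higher_deriv (dir_deriv u f) x us = 0" if "k \<le> length us" for u us x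
    using l that by (simp add: derivs_vanish_from_def higher_deriv_snoc[symmetric])
  ultimately show ?r unfolding derivs_vanish_from_def C_k_Suc_iff by blast
next
  assume r: ?r
  have "higher_deriv f x us = 0" if "Suc k \<le> length us" for us x
    using r that by (cases us rule: rev_cases) (auto simp: derivs_vanish_from_def higher_deriv_snoc)
  moreover have "C_k (Suc j) f" for j
    using r by (auto simp: C_k_Suc_iff derivs_vanish_from_def)
  then have "C_k j f" for j by (rule C_k_Suc_imp)
  ultimately show ?l by (simp add: derivs_vanish_from_def)
qed

lemma derivs_vanish_from_mono: "derivs_vanish_from k f \<Longrightarrow> k \<le> l \<Longrightarrow> derivs_vanish_from l f"
  by (auto simp: derivs_vanish_from_def)

lemma derivs_vanish_from_0_iff: "derivs_vanish_from 0 f \<longleftrightarrow> f = (\<lambda>_. 0)"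
proof
  assume "derivs_vanish_from 0 f"
  then have "higher_deriv f x [] = 0" for x unfolding derivs_vanish_from_def by (metis le0)
  then show "f = (\<lambda>_. 0)" by auto
qed (auto simp: derivs_vanish_from_def)

lemma derivs_vanish_from_zero: "derivs_vanish_from k (\<lambda>_. 0)"
  by (simp add: derivs_vanish_from_def)

lemma derivs_vanish_from_const: "derivs_vanish_from (Suc 0) (\<lambda>_. c)"
  by (simp add: derivs_vanish_from_Suc derivs_vanish_from_zero)

lemma derivs_vanish_from_add:
  "derivs_vanish_from k f \<Longrightarrow> derivs_vanish_from k g \<Longrightarrow> derivs_vanish_from k (\<lambda>x. f x + g x)"
  using higher_deriv_add[of "length us" f g us x for us x]
  by (auto simp: derivs_vanish_from_def C_k_add)

lemma derivs_vanish_from_diff: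
  "derivs_vanish_from k f \<Longrightarrow> derivs_vanish_from k g \<Longrightarrow> derivs_vanish_from k (\<lambda>x. f x - g x)"
  using higher_deriv_diff[of "length us" f g us x for us x]
  by (auto simp: derivs_vanish_from_def C_k_diff)

lemma derivs_vanish_from_sum:
  "(\<And>i. i \<in> I \<Longrightarrow> derivs_vanish_from k (f i)) \<Longrightarrow> derivs_vanish_from k (\<lambda>x. \<Sum>i\<in>I. f i x)"
  by (induction I rule: infinite_finite_induct) (auto intro: derivs_vanish_from_add derivs_vanish_from_zero)

text \<open>Degrees add. The successors keep the factors away from the zero polynomial, whose degree would be
negative; the rule \<open>derivs_vanish_from_Suc\<close> then gives the product rule for degrees by induction.\<close>

lemma derivs_vanish_from_mult:
  assumes "derivs_vanish_from (Suc a) f" "derivs_vanish_from (Suc b) g"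
  shows "derivs_vanish_from (Suc (a + b)) (\<lambda>x. f x * g x)"
  using assms
proof (induction "a + b" arbitrary: a b f g rule: less_induct)
  case less
  have d: "\<And>x. f differentiable (at x)" "\<And>x. g differentiable (at x)"
    using less.prems by (auto simp: derivs_vanish_from_Suc)
  have "derivs_vanish_from (a + b) (\<lambda>x. f x * dir_deriv u g x)" for u
  proof (cases b)
    case 0
    then have "dir_deriv u g = (\<lambda>_. 0)"
      using less.prems(2) by (simp add: derivs_vanish_from_Suc derivs_vanish_from_0_iff)
    then show ?thesis by (simp add: derivs_vanish_from_zero)
  next
    case (Suc b')
    then have "derivs_vanish_from (Suc (a + b')) (\<lambda>x. f x * dir_deriv u g x)"
      using less.prems by (intro less.hyps) (auto simp: derivs_vanish_from_Suc[of "Suc b'"])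
    then show ?thesis using Suc by simp
  qed
  moreover have "derivs_vanish_from (a + b) (\<lambda>x. dir_deriv u f x * g x)" for u
  proof (cases a)
    case 0
    then have "dir_deriv u f = (\<lambda>_. 0)"
      using less.prems(1) by (simp add: derivs_vanish_from_Suc derivs_vanish_from_0_iff)
    then show ?thesis by (simp add: derivs_vanish_from_zero)
  next
    case (Suc a')
    then have "derivs_vanish_from (Suc (a' + b)) (\<lambda>x. dir_deriv u f x * g x)"
      using less.prems by (intro less.hyps) (auto simp: derivs_vanish_from_Suc[of "Suc a'"])
    then show ?thesis using Suc by simp
  qed
  moreover have "dir_deriv u (\<lambda>x. f x * g x) = (\<lambda>x. f x * dir_deriv u g x + dir_deriv u f x * g x)" for u
    using d by (auto simp: dir_deriv_mult)
  ultimately show ?case using d by (auto simp: derivs_vanish_from_Suc intro: derivs_vanish_from_add)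
qed

lemma derivs_vanish_from_power:
  "derivs_vanish_from (Suc a) f \<Longrightarrow> derivs_vanish_from (Suc (a * k)) (\<lambda>x. f x ^ k)"
proof (induction k)
  case (Suc k)
  then show ?case using derivs_vanish_from_mult[of a f "a * k" "\<lambda>x. f x ^ k"] by simp
qed (simp add: derivs_vanish_from_const)

lemma derivs_vanish_from_prod:
  "(\<And>i. i \<in> I \<Longrightarrow> derivs_vanish_from (Suc (a i)) (f i)) \<Longrightarrow>
    derivs_vanish_from (Suc (\<Sum>i\<in>I. a i)) (\<lambda>x. \<Prod>i\<in>I. f i x)"
  by (induction I rule: infinite_finite_induct)
    (auto intro: derivs_vanish_from_const derivs_vanish_from_mult)

lemma dir_deriv_component: "dir_deriv u (\<lambda>x::real^'n. x $ i) = (\<lambda>_. u $ i)"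
  by (rule ext) (rule dir_derivI[OF bounded_linear_imp_has_derivative[OF bounded_linear_vec_nth]])

lemma differentiable_component: "(\<lambda>x::real^'n. x $ i) differentiable (at x)"
  by (rule bounded_linear_imp_differentiable[OF bounded_linear_vec_nth])

lemma derivs_vanish_from_poly:
  assumes "poly_deg_le m p"
  shows "derivs_vanish_from (Suc m) p"
proof -
  obtain c where c: "p = (\<lambda>x. \<Sum>\<alpha> | (\<Sum>i\<in>UNIV. \<alpha> i) \<le> m. c \<alpha> * (\<Prod>i\<in>UNIV. (x $ i) ^ \<alpha> i))"
    using assms by (auto simp: poly_deg_le_def fun_eq_iff)
  have "derivs_vanish_from (Suc (Suc 0)) (\<lambda>x::real^'a. x $ i)" for i
    by (simp add: derivs_vanish_from_Suc[of "Suc 0"] dir_deriv_component differentiable_component derivs_vanish_from_const)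
  then have pw: "derivs_vanish_from (Suc (\<alpha> i)) (\<lambda>x::real^'a. (x $ i) ^ \<alpha> i)" for i \<alpha>
    using derivs_vanish_from_power[of 1 "\<lambda>x::real^'a. x $ i" "\<alpha> i"] by simp
  have "derivs_vanish_from (Suc (0 + (\<Sum>i\<in>UNIV. \<alpha> i))) (\<lambda>x::real^'a. c \<alpha> * (\<Prod>i\<in>UNIV. (x $ i) ^ \<alpha> i))" for \<alpha>
    by (intro derivs_vanish_from_mult derivs_vanish_from_const derivs_vanish_from_prod pw)
  then have "derivs_vanish_from (Suc m) (\<lambda>x::real^'a. c \<alpha> * (\<Prod>i\<in>UNIV. (x $ i) ^ \<alpha> i))"
    if "(\<Sum>i\<in>UNIV. \<alpha> i) \<le> m" for \<alpha>
    using that by (auto intro: derivs_vanish_from_mono)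
  then show ?thesis unfolding c by (intro derivs_vanish_from_sum) auto
qed

lemma DERIV_higher_deriv_line:
  assumes "C_k k f" "length us < k"
  shows "((\<lambda>t. higher_deriv f (y + t *\<^sub>R w) us) has_real_derivative higher_deriv f (y + t *\<^sub>R w) (w # us)) (at t)"
proof -
  have d: "((\<lambda>x. higher_deriv f x us) has_derivative (\<lambda>u. higher_deriv f (y + t *\<^sub>R w) (u # us))) (at (y + t *\<^sub>R w))"
    by (rule has_derivative_higher_deriv[OF assms])
  have "((\<lambda>t. y + t *\<^sub>R w) has_derivative (\<lambda>s. s *\<^sub>R w)) (at t)"
    by (auto intro!: derivative_eq_intros)
  from diff_chain_at[OF this d]
  have "((\<lambda>t. higher_deriv f (y + t *\<^sub>R w) us) has_derivative (\<lambda>s. higher_deriv f (y + t *\<^sub>R w) ((s *\<^sub>R w) # us))) (at t)"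
    by (simp add: o_def)
  moreover have "higher_deriv f x ((s *\<^sub>R w) # us) = higher_deriv f x (w # us) * s" for x s
    using linear_scale[OF has_derivative_linear[OF has_derivative_higher_deriv[OF assms, of x]], of s w] by simp
  ultimately show ?thesis by (simp only: has_field_derivative_def) 
qed

text \<open>Along a line the derivatives of \<open>p\<close> form a sequence of successive derivatives that is eventually zero, so
the remainder term in the Maclaurin formula vanishes.\<close>

lemma taylor_exact:
  assumes "derivs_vanish_from (Suc m) p" "length us \<le> m"
  shows "higher_deriv p (y + t *\<^sub>R w) us =
    (\<Sum>l\<le>m - length us. t ^ l / fact l * higher_deriv p y (replicate l w @ us))"
proof -
  define D where "D = (\<lambda>l t. higher_deriv p (y + t *\<^sub>R w) (replicate l w @ us))"
  have "\<forall>l t. DERIV (D l) t :> D (Suc l) t"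
    unfolding D_def
  proof (intro allI)
    fix l t
    show "DERIV (\<lambda>t. higher_deriv p (y + t *\<^sub>R w) (replicate l w @ us)) t :> higher_deriv p (y + t *\<^sub>R w) (replicate (Suc l) w @ us)"
      using DERIV_higher_deriv_line[of "Suc (l + length us)" p "replicate l w @ us" y w t] assms(1)
      by (simp add: derivs_vanish_from_def)
  qed
  then obtain s where "D 0 t = (\<Sum>l<Suc (m - length us). D l 0 / fact l * t ^ l) +
      D (Suc (m - length us)) s / fact (Suc (m - length us)) * t ^ Suc (m - length us)"
    using Maclaurin_all_le[of D "D 0" t "Suc (m - length us)"] by auto
  moreover have "D (Suc (m - length us)) s = 0"
  proof -
    have "Suc m \<le> length (replicate (Suc (m - length us)) w @ us)" using assms(2) by simp
    then show ?thesis using assms(1) unfolding D_def derivs_vanish_from_def by blast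
  qed
  ultimately show ?thesis
    unfolding D_def lessThan_Suc_atMost by (simp add: mult.commute)
qed

lemma sum_inverse_fact_le: "(\<Sum>l\<le>n. 1 / fact l) \<le> exp (1::real)"
proof -
  have s: "(\<lambda>l. 1 / fact l) sums exp (1::real)"
    using exp_converges[of "1::real"] by (simp add: inverse_eq_divide)
  have "(\<Sum>l<Suc n. 1 / fact l :: real) \<le> (\<Sum>l. 1 / fact l)"
    by (rule sum_le_suminf) (use s in \<open>auto simp: sums_iff\<close>)
  then show ?thesis using s by (simp add: sums_iff lessThan_Suc_atMost)
qed

text \<open>Derivative bounds of Whitney type at \<open>z\<close> propagate to all points at distance at most \<open>\<delta>\<close>: each order
of differentiation that the Taylor expansion spends costs a factor \<open>1/\<delta>\<close> and gains a factor \<open>\<delta>\<close>. The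
sum of the inverse factorials contributes \<open>exp 1\<close>.\<close>

lemma jet_bound_taylor:
  assumes p: "derivs_vanish_from (Suc m) p"
    and bd: "\<And>us. length us \<le> m \<Longrightarrow> \<bar>higher_deriv p z us\<bar> \<le> \<epsilon> * \<delta> ^ (m - length us) * prod_list (map norm us)"
    and x: "norm (x - z) \<le> \<delta>" and pos: "0 < \<delta>" "0 \<le> \<epsilon>" and k: "k \<le> m"
  shows "jet_bound k x (exp 1 * \<epsilon> * \<delta> ^ m) (1 / \<delta>) p"
  unfolding jet_bound_def
proof (intro conjI allI impI)
  show "C_k k p" using p by (simp add: derivs_vanish_from_def)
  fix us :: "'a list" assume us: "length us \<le> k"
  define j where "j = length us"
  define w where "w = (1 / \<delta>) *\<^sub>R (x - z)"
  have w: "norm w \<le> 1" using x pos by (simp add: w_def)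
  have xz: "x = z + \<delta> *\<^sub>R w" using pos by (simp add: w_def)
  have "\<bar>\<delta> ^ l / fact l * higher_deriv p z (replicate l w @ us)\<bar>
      \<le> 1 / fact l * (\<epsilon> * \<delta> ^ (m - j) * prod_list (map norm us))" if "l \<le> m - j" for l
  proof -
    have "norm w ^ l * prod_list (map norm us) \<le> 1 * prod_list (map norm us)"
      using w by (intro mult_right_mono power_le_one) auto
    then have pl: "prod_list (map norm (replicate l w @ us)) \<le> prod_list (map norm us)"
      by (simp add: prod_list_replicate)
    have len: "length (replicate l w @ us) = l + j" by (simp add: j_def)
    have "\<bar>higher_deriv p z (replicate l w @ us)\<bar>
        \<le> \<epsilon> * \<delta> ^ (m - (l + j)) * prod_list (map norm (replicate l w @ us))"
      using bd[of "replicate l w @ us"] that us k unfolding len by (simp add: j_def)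
    also have "\<dots> \<le> \<epsilon> * \<delta> ^ (m - (l + j)) * prod_list (map norm us)"
      using pos by (intro mult_left_mono[OF pl]) auto
    finally have "\<bar>higher_deriv p z (replicate l w @ us)\<bar> \<le> \<epsilon> * \<delta> ^ (m - (l + j)) * prod_list (map norm us)" .
    then have "\<delta> ^ l / fact l * \<bar>higher_deriv p z (replicate l w @ us)\<bar>
       \<le> \<delta> ^ l / fact l * (\<epsilon> * \<delta> ^ (m - (l + j)) * prod_list (map norm us))"
      using pos by (intro mult_left_mono) auto
    also have "\<dots> = 1 / fact l * (\<epsilon> * (\<delta> ^ l * \<delta> ^ (m - (l + j))) * prod_list (map norm us))"
      by simp
    also have "\<delta> ^ l * \<delta> ^ (m - (l + j)) = \<delta> ^ (m - j)"
    proof -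
      have "l + (m - (l + j)) = m - j" using that by arith
      then show ?thesis by (metis power_add)
    qed
    finally show ?thesis using pos by (simp add: abs_mult)
  qed
  then have "\<bar>higher_deriv p x us\<bar> \<le> (\<Sum>l\<le>m - j. 1 / fact l * (\<epsilon> * \<delta> ^ (m - j) * prod_list (map norm us)))"
    unfolding xz using us k
    by (simp only: taylor_exact[OF p] j_def) (intro order_trans[OF sum_abs] sum_mono, simp add: j_def)
  also have "\<dots> = (\<Sum>l\<le>m - j. 1 / fact l) * (\<epsilon> * \<delta> ^ (m - j) * prod_list (map norm us))"
    by (simp only: sum_distrib_right)
  also have "\<dots> \<le> exp 1 * (\<epsilon> * \<delta> ^ (m - j) * prod_list (map norm us))"
    using pos by (intro mult_right_mono sum_inverse_fact_le) auto
  also have "\<delta> ^ (m - j) = \<delta> ^ m * (1 / \<delta>) ^ j"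
    using us k pos by (simp add: power_diff j_def power_one_over divide_simps)
  finally show "\<bar>higher_deriv p x us\<bar> \<le> exp 1 * \<epsilon> * \<delta> ^ m * (1 / \<delta>) ^ length us * prod_list (map norm us)"
    by (simp add: j_def mult_ac)
qed

text \<open>Some bound on the jets, uniform on \<open>S\<close>. Since only its existence matters, the frequency is set to 1.\<close>

definition bounded_jets_on :: "nat \<Rightarrow> 'a set \<Rightarrow> ('a::euclidean_space \<Rightarrow> real) \<Rightarrow> bool" where
  "bounded_jets_on k S f \<longleftrightarrow> (\<exists>A\<ge>0. \<forall>x\<in>S. jet_bound k x A 1 f)"

lemma bounded_jets_on_add:
  assumes "bounded_jets_on k S f" "bounded_jets_on k S g"
  shows "bounded_jets_on k S (\<lambda>x. f x + g x)"
proof -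
  obtain A B where "A \<ge> 0" "\<And>x. x \<in> S \<Longrightarrow> jet_bound k x A 1 f"
    "B \<ge> 0" "\<And>x. x \<in> S \<Longrightarrow> jet_bound k x B 1 g"
    using assms by (auto simp: bounded_jets_on_def)
  then show ?thesis unfolding bounded_jets_on_def
    by (intro exI[of _ "A + B"]) (auto intro: jet_bound_add)
qed

lemma bounded_jets_on_mult:
  assumes "bounded_jets_on k S f" "bounded_jets_on k S g"
  shows "bounded_jets_on k S (\<lambda>x. f x * g x)"
proof -
  obtain A B where A: "A \<ge> 0" "\<And>x. x \<in> S \<Longrightarrow> jet_bound k x A 1 f"
    and B: "B \<ge> 0" "\<And>x. x \<in> S \<Longrightarrow> jet_bound k x B 1 g"
    using assms by (auto simp: bounded_jets_on_def)
  have "jet_bound k x (A * B * (1 + 1) ^ k) 1 (\<lambda>x. f x * g x)" if "x \<in> S" for x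
    using A B that by (intro jet_bound_rescale jet_bound_mult) auto
  then show ?thesis using A B unfolding bounded_jets_on_def
    by (intro exI[of _ "A * B * (1 + 1) ^ k"]) auto
qed

lemma bounded_jets_on_const: "bounded_jets_on k S (\<lambda>_. c)"
  unfolding bounded_jets_on_def by (intro exI[of _ "\<bar>c\<bar>"]) (auto intro: jet_bound_const)

lemma bounded_jets_on_sum:
  "(\<And>i. i \<in> I \<Longrightarrow> bounded_jets_on k S (f i)) \<Longrightarrow> bounded_jets_on k S (\<lambda>x. \<Sum>i\<in>I. f i x)"
  by (induction I rule: infinite_finite_induct) (auto intro: bounded_jets_on_add bounded_jets_on_const)

lemma bounded_jets_on_prod:
  "(\<And>i. i \<in> I \<Longrightarrow> bounded_jets_on k S (f i)) \<Longrightarrow> bounded_jets_on k S (\<lambda>x. \<Prod>i\<in>I. f i x)"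
  by (induction I rule: infinite_finite_induct) (auto intro: bounded_jets_on_mult bounded_jets_on_const)

lemma bounded_jets_on_component:
  fixes S :: "(real^'n) set"
  assumes "bounded S"
  shows "bounded_jets_on k S (\<lambda>x. x $ i)"
proof -
  obtain R where R: "R > 0" "\<And>x. x \<in> S \<Longrightarrow> norm x \<le> R"
    using assms by (auto simp: bounded_pos)
  have "jet_bound k x (max R 1) 1 (\<lambda>x. x $ i)" if "x \<in> S" for x
  proof (cases k)
    case 0
    then show ?thesis
      using R(2)[OF that] component_le_norm_cart[of x i] by (auto simp: jet_bound_0 intro!: continuous_intros)
  next
    case (Suc k)
    have "\<bar>u $ i\<bar> \<le> max R 1 * 1 * norm u" for u :: "real^'n"
      using component_le_norm_cart[of u i] mult_right_mono[of 1 "max R 1" "norm u"] by simp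
    then show ?thesis unfolding Suc jet_bound_Suc
      using R(2)[OF that] component_le_norm_cart[of x i]
      by (auto simp: dir_deriv_component differentiable_component intro!: jet_bound_const)
  qed
  then show ?thesis unfolding bounded_jets_on_def by (intro exI[of _ "max R 1"]) auto
qed

lemma bounded_jets_on_poly:
  assumes "poly_deg_le m p" "bounded S"
  shows "bounded_jets_on k S p"
proof -
  obtain c where c: "p = (\<lambda>x. \<Sum>\<alpha> | (\<Sum>i\<in>UNIV. \<alpha> i) \<le> m. c \<alpha> * (\<Prod>i\<in>UNIV. (x $ i) ^ \<alpha> i))"
    using assms by (auto simp: poly_deg_le_def fun_eq_iff)
  have "bounded_jets_on k S (\<lambda>x. (x $ i) ^ l)" for i l
    using bounded_jets_on_prod[of "{..<l}" k S "\<lambda>_ x. x $ i"] bounded_jets_on_component[OF assms(2), of k i]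
    by simp
  then show ?thesis unfolding c
    by (intro bounded_jets_on_sum bounded_jets_on_mult bounded_jets_on_const bounded_jets_on_prod)
qed

section \<open>Whitney's condition in quantitative form\<close>

text \<open>The supremum in \<open>form_norm\<close> is one of real numbers and is meaningful only for a bounded form, which is
why a bound \<open>B\<close> is assumed.\<close>

lemma form_norm_bound:
  assumes bd: "\<And>us. length us = j \<Longrightarrow> \<bar>A us\<bar> \<le> B * prod_list (map norm us)"
    and us: "length us = j" "set us \<subseteq> sphere 0 1"
  shows "\<bar>A us\<bar> \<le> form_norm j A"
  unfolding form_norm_def
proof (rule cSUP_upper)
  show "us \<in> {us. length us = j \<and> set us \<subseteq> sphere 0 1}" using us by simp
  show "bdd_above ((\<lambda>us. \<bar>A us\<bar>) ` {us. length us = j \<and> set us \<subseteq> sphere 0 1})"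
  proof (rule bdd_aboveI2)
    fix vs :: "'a list" assume vs: "vs \<in> {us. length us = j \<and> set us \<subseteq> sphere 0 1}"
    then have "set vs \<subseteq> sphere 0 1" by simp
    then have "prod_list (map norm vs) = 1" by (induction vs) auto
    then show "\<bar>A vs\<bar> \<le> B" using bd[of vs] vs by simp
  qed
qed

lemma higher_deriv_bound_from_sphere:
  fixes f :: "'a::euclidean_space \<Rightarrow> real"
  assumes f: "C_k k f" "length us \<le> k"
    and bd: "\<And>ws. length ws = length us \<Longrightarrow> set ws \<subseteq> sphere 0 1 \<Longrightarrow> \<bar>higher_deriv f x ws\<bar> \<le> B"
  shows "\<bar>higher_deriv f x us\<bar> \<le> B * prod_list (map norm us)"
proof -
  obtain b :: 'a where b: "norm b = 1" using norm_Basis nonempty_Basis by blast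
  define dir where "dir = (\<lambda>u::'a. if u = 0 then b else sgn u)"
  define ps where "ps = map (\<lambda>u. (norm u, dir u)) us"
  have "norm u *\<^sub>R dir u = u" for u by (auto simp: dir_def sgn_div_norm)
  then have us: "map (\<lambda>(c, w). c *\<^sub>R w) ps = us"
    by (simp add: ps_def o_def)
  have "higher_deriv f x (map (\<lambda>(c, w). c *\<^sub>R w) ps) = prod_list (map fst ps) * higher_deriv f x (map snd ps)"
    by (rule higher_deriv_scaleR[OF f(1)]) (use f(2) in \<open>simp add: ps_def\<close>)
  then have "higher_deriv f x us = prod_list (map norm us) * higher_deriv f x (map dir us)"
    unfolding us by (simp add: ps_def o_def)
  moreover have "\<bar>higher_deriv f x (map dir us)\<bar> \<le> B"
    using b by (intro bd) (auto simp: dir_def norm_sgn)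
  ultimately show ?thesis
    using mult_left_mono[of "\<bar>higher_deriv f x (map dir us)\<bar>" B "prod_list (map norm us)"]
    by (simp add: abs_mult mult.commute)
qed

text \<open>For a compact set Whitney's condition is a single uniform statement about \<open>K = C\<close>. The derivatives are
evaluated on arbitrary vectors, by homogeneity, rather than on the sphere.\<close>

lemma cond_W_uniform:
  assumes C: "compact C" and P: "\<And>y. y \<in> C \<Longrightarrow> poly_deg_le m (P y)" and W: "cond_W m C P"
    and \<epsilon>: "0 < \<epsilon>"
  shows "\<exists>\<delta>>0. \<forall>y\<in>C. \<forall>z\<in>C. norm (y - z) \<le> \<delta> \<longrightarrow> (\<forall>us. length us \<le> m \<longrightarrow>
    \<bar>higher_deriv (\<lambda>x. P y x - P z x) z us\<bar> \<le> \<epsilon> * norm (y - z) ^ (m - length us) * prod_list (map norm us))"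
proof -
  have "((\<lambda>\<delta>. whitney_rho m P C \<delta>) \<longlongrightarrow> 0) (at_right 0)" using W C by (auto simp: cond_W_def)
  then have "\<forall>\<^sub>F \<delta> in at_right 0. whitney_rho m P C \<delta> < ennreal \<epsilon>"
    using \<epsilon> by (intro order_tendstoD) auto
  then obtain d where d: "d > 0" "\<And>\<delta>. 0 < \<delta> \<Longrightarrow> \<delta> < d \<Longrightarrow> whitney_rho m P C \<delta> < ennreal \<epsilon>"
    by (auto simp: eventually_at_right_field)
  have rho: "whitney_rho m P C (d / 2) < ennreal \<epsilon>" using d by simp
  have "\<bar>higher_deriv (\<lambda>x. P y x - P z x) z us\<bar> \<le> \<epsilon> * norm (y - z) ^ (m - length us) * prod_list (map norm us)"
    if y: "y \<in> C" and z: "z \<in> C" and yz: "norm (y - z) \<le> d / 2" and us: "length us \<le> m" for y z us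
  proof (cases "y = z")
    case True
    then show ?thesis using \<epsilon> by simp
  next
    case False
    define j where "j = length us"
    define A where "A = (\<lambda>us. higher_deriv (P y) z us - higher_deriv (P z) z us)"
    have smooth: "C_k m (P y)" "C_k m (P z)"
      using derivs_vanish_from_poly[OF P] y z by (auto simp: derivs_vanish_from_def)
    obtain B1 B2 where B: "jet_bound m z B1 1 (P y)" "jet_bound m z B2 1 (P z)"
      using bounded_jets_on_poly[OF P, of y "{z}" m] bounded_jets_on_poly[OF P, of z "{z}" m] y z
      by (auto simp: bounded_jets_on_def)
    have A: "A vs = higher_deriv (\<lambda>x. P y x - P z x) z vs" if "length vs \<le> m" for vs
      unfolding A_def using higher_deriv_diff[OF smooth that] by simp
    have Abd: "\<bar>A vs\<bar> \<le> (B1 + B2) * prod_list (map norm vs)" if "length vs = j" for vs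
      using jet_boundD[OF jet_bound_diff[OF B], of vs] A[of vs] that us by (simp add: j_def)
    have "ennreal (form_norm j A / norm (y - z) ^ (m - j)) \<le> whitney_rho m P C (d / 2)"
      unfolding whitney_rho_def A_def
      by (rule SUP_upper2[where i="(j, y, z)"]) (use y z yz us False in \<open>auto simp: j_def\<close>)
    then have "ennreal (form_norm j A / norm (y - z) ^ (m - j)) < ennreal \<epsilon>" using rho by simp
    then have "form_norm j A / norm (y - z) ^ (m - j) \<le> \<epsilon>"
      using ennreal_leI[of \<epsilon> "form_norm j A / norm (y - z) ^ (m - j)"] leD linear by blast
    then have fn: "form_norm j A \<le> \<epsilon> * norm (y - z) ^ (m - j)" using False by (simp add: divide_simps)
    have "\<bar>higher_deriv (\<lambda>x. P y x - P z x) z vs\<bar> \<le> \<epsilon> * norm (y - z) ^ (m - j)"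
      if "length vs = j" "set vs \<subseteq> sphere 0 1" for vs
      using form_norm_bound[OF Abd that] fn A[of vs] that us by (simp add: j_def)
    then show ?thesis unfolding j_def
      by (intro higher_deriv_bound_from_sphere[OF C_k_diff[OF smooth] us]) auto
  qed
  then show ?thesis using d by (intro exI[of _ "d / 2"]) auto
qed

section \<open>Smooth steps\<close>

text \<open>A primitive on the whole line, normalised arbitrarily; only its differences are used.\<close>

definition antideriv :: "(real \<Rightarrow> real) \<Rightarrow> real \<Rightarrow> real" where
  "antideriv f = (SOME G. \<forall>t. (G has_real_derivative f t) (at t))"

lemma DERIV_antideriv:
  assumes "continuous_on UNIV f"
  shows "(antideriv f has_real_derivative f t) (at t)"
proof -
  have "\<exists>F. \<forall>x. - \<infinity> < ereal x \<longrightarrow> ereal x < \<infinity> \<longrightarrow> (F has_vector_derivative f x) (at x)"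
    using assms by (intro einterval_antiderivative) (auto simp: continuous_on_eq_continuous_at)
  then have "\<exists>G. \<forall>t. (G has_real_derivative f t) (at t)"
    by (auto simp: has_real_derivative_iff_has_vector_derivative)
  then show ?thesis unfolding antideriv_def by (rule someI2_ex) blast
qed

lemma antideriv_mvt:
  assumes "continuous_on UNIV f" "a < b"
  shows "\<exists>z. a < z \<and> z < b \<and> antideriv f b - antideriv f a = (b - a) * f z"
  using MVT2[of a b "antideriv f" f] assms DERIV_antideriv[OF assms(1)] by blast

text \<open>Starting from a piecewise linear step, each stage averages over an interval of length 1, which gains one
derivative. The \<open>k\<close>-th function is of class \<open>C^k\<close> and rises from 0 at \<open>0\<close> to 1 at \<open>k + 1\<close>.\<close>

primrec smooth_step :: "nat \<Rightarrow> real \<Rightarrow> real" where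
  "smooth_step 0 t = max 0 (min 1 t)"
| "smooth_step (Suc k) t = antideriv (smooth_step k) t - antideriv (smooth_step k) (t - 1)"

lemma continuous_smooth_step: "continuous_on UNIV (smooth_step k)"
proof (induction k)
  case 0
  have "smooth_step 0 = (\<lambda>t. max 0 (min 1 t))" by auto
  then show ?case by (auto intro!: continuous_intros)
next
  case (Suc k)
  have "isCont (antideriv (smooth_step k)) t" for t
    using DERIV_antideriv[OF Suc] by (rule DERIV_isCont)
  then have c: "continuous_on UNIV (antideriv (smooth_step k))"
    by (simp add: continuous_at_imp_continuous_on)
  have "smooth_step (Suc k) = (\<lambda>t. antideriv (smooth_step k) t - antideriv (smooth_step k) (t - 1))"
    by auto
  then show ?case
    by (auto intro!: continuous_intros continuous_on_compose2[OF c])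
qed

lemma smooth_step_mvt: "\<exists>z. t - 1 < z \<and> z < t \<and> smooth_step (Suc k) t = smooth_step k z"
  using antideriv_mvt[OF continuous_smooth_step[of k], of "t - 1" t] by auto

lemma smooth_step_range: "0 \<le> smooth_step k t \<and> smooth_step k t \<le> 1"
proof (induction k arbitrary: t)
  case (Suc k)
  then show ?case using smooth_step_mvt[of t k] by metis
qed auto

lemma smooth_step_eq_0: "t \<le> 0 \<Longrightarrow> smooth_step k t = 0"
proof (induction k arbitrary: t)
  case (Suc k)
  obtain z where "z < t" "smooth_step (Suc k) t = smooth_step k z"
    using smooth_step_mvt[of t k] by blast
  then show ?case using Suc.IH[of z] Suc.prems by simp
qed auto

lemma smooth_step_eq_1: "real k + 1 \<le> t \<Longrightarrow> smooth_step k t = 1"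
proof (induction k arbitrary: t)
  case (Suc k)
  obtain z where "t - 1 < z" "smooth_step (Suc k) t = smooth_step k z"
    using smooth_step_mvt[of t k] by blast
  then show ?case using Suc.IH[of z] Suc.prems by simp
qed auto

lemma DERIV_smooth_step:
  "(smooth_step (Suc k) has_real_derivative smooth_step k t - smooth_step k (t - 1)) (at t)"
proof -
  have "((\<lambda>t. antideriv (smooth_step k) (t - 1)) has_real_derivative smooth_step k (t - 1)) (at t)"
  proof -
    have "((\<lambda>t::real. t - 1) has_real_derivative 1) (at t)" by (auto intro!: derivative_eq_intros)
    from DERIV_chain2[OF DERIV_antideriv[OF continuous_smooth_step] this] show ?thesis by simp
  qed
  then have "((\<lambda>t. antideriv (smooth_step k) t - antideriv (smooth_step k) (t - 1)) has_real_derivative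
      smooth_step k t - smooth_step k (t - 1)) (at t)"
    by (intro DERIV_diff DERIV_antideriv continuous_smooth_step)
  moreover have "smooth_step (Suc k) = (\<lambda>t. antideriv (smooth_step k) t - antideriv (smooth_step k) (t - 1))"
    by auto
  ultimately show ?thesis by simp
qed

text \<open>The derivative of a smooth step is a difference of two translates of the preceding one, hence bounded by
the same constant with one factor 2; the affine substitution contributes the factor \<open>s\<close>.\<close>

lemma jet_bound_smooth_step:
  assumes "0 \<le> s"
  shows "jet_bound k x 1 (2 * s) (\<lambda>x::real^'n. smooth_step k (s * x $ j + c))"
proof (induction k arbitrary: c)
  case 0
  show ?case using smooth_step_range[of 0 "s * x $ j + c"]
    by (auto simp: jet_bound_0 simp del: smooth_step.simps
        intro!: continuous_on_compose2[OF continuous_smooth_step] continuous_intros)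
next
  case (Suc k)
  let ?f = "\<lambda>x::real^'n. smooth_step (Suc k) (s * x $ j + c)"
  let ?d = "\<lambda>x::real^'n. smooth_step k (s * x $ j + c) - smooth_step k (s * x $ j + (c - 1))"
  have der: "(?f has_derivative (\<lambda>u. s * u $ j * ?d x)) (at x)" for x :: "real^'n"
  proof -
    have a: "((\<lambda>x::real^'n. s * x $ j + c) has_derivative (\<lambda>u. s * u $ j)) (at x)"
      by (intro has_derivative_add_const has_derivative_mult_right
          bounded_linear_imp_has_derivative bounded_linear_vec_nth)
    show ?thesis
      using has_derivative_compose[OF a DERIV_smooth_step[of k "s * x $ j + c", unfolded has_field_derivative_def]]
      by (simp add: algebra_simps del: smooth_step.simps)
  qed
  have "jet_bound k x (1 * (2 * s) * norm u) (2 * s) (dir_deriv u ?f)" for u :: "real^'n"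
  proof -
    have "jet_bound k x (\<bar>s * u $ j\<bar> * (1 + 1)) (2 * s) (\<lambda>x. (s * u $ j) * ?d x)"
      by (intro jet_bound_cmult jet_bound_diff Suc.IH)
    moreover have "dir_deriv u ?f = (\<lambda>x. (s * u $ j) * ?d x)"
      by (rule ext) (rule dir_derivI[OF der])
    moreover have "\<bar>s * u $ j\<bar> * (1 + 1) \<le> 1 * (2 * s) * norm u"
      using mult_left_mono[OF component_le_norm_cart[of u j] assms] assms by (simp add: abs_mult)
    ultimately show ?thesis using assms by (auto intro: jet_bound_mono)
  qed
  then show ?case
    using der smooth_step_range[of "Suc k" "s * x $ j + c"]
    by (auto simp: jet_bound_Suc differentiable_def simp del: smooth_step.simps)
qed

section \<open>A smooth partition of unity on a lattice\<close>

text \<open>A product over the coordinates of differences of two smooth steps. Along one coordinate the sum over all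
integers telescopes to 1, so the bumps form a partition of unity, on the lattice of mesh \<open>1/s\<close>.\<close>

definition lattice_bump :: "nat \<Rightarrow> real \<Rightarrow> ('n::finite \<Rightarrow> int) \<Rightarrow> real^'n \<Rightarrow> real" where
  "lattice_bump N s i x =
     (\<Prod>j\<in>UNIV. smooth_step N (s * x $ j - of_int (i j) + 1) - smooth_step N (s * x $ j - of_int (i j)))"

text \<open>A superset of the bumps that do not vanish near \<open>x\<close>.\<close>

definition active_cells :: "nat \<Rightarrow> real \<Rightarrow> real^'n \<Rightarrow> ('n::finite \<Rightarrow> int) set" where
  "active_cells N s x = {i. \<forall>j. \<bar>s * x $ j - of_int (i j)\<bar> \<le> real N + 1}"

lemma active_cells_eq_PiE:
  "active_cells N s x = PiE UNIV (\<lambda>j. {\<lceil>s * x $ j - (real N + 1)\<rceil>..\<lfloor>s * x $ j + (real N + 1)\<rfloor>})"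
proof -
  have "\<bar>t - of_int l\<bar> \<le> real N + 1 \<longleftrightarrow> l \<in> {\<lceil>t - (real N + 1)\<rceil>..\<lfloor>t + (real N + 1)\<rfloor>}" for t l
    unfolding atLeastAtMost_iff ceiling_le_iff le_floor_iff abs_le_iff by auto
  then show ?thesis unfolding active_cells_def by (auto simp only: PiE_def Pi_def extensional_UNIV)
qed

lemma finite_active_cells [simp]: "finite (active_cells N s x)"
  unfolding active_cells_eq_PiE by (rule finite_PiE) auto

lemma card_active_cells: "real (card (active_cells N s (x::real^'n))) \<le> (2 * real N + 3) ^ CARD('n)"
proof -
  have c: "card {\<lceil>t - (real N + 1)\<rceil>..\<lfloor>t + (real N + 1)\<rfloor>} \<le> 2 * N + 3" for t
  proof -
    have "\<lfloor>t + (real N + 1)\<rfloor> + 1 - \<lceil>t - (real N + 1)\<rceil> \<le> 2 * int N + 3" by linarith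
    then show ?thesis by simp
  qed
  have "card (active_cells N s x)
      = (\<Prod>j\<in>UNIV. card {\<lceil>s * x $ j - (real N + 1)\<rceil>..\<lfloor>s * x $ j + (real N + 1)\<rfloor>})"
    unfolding active_cells_eq_PiE by (rule card_PiE) simp
  also have "\<dots> \<le> (\<Prod>j\<in>(UNIV::'n set). 2 * N + 3)"
    by (intro prod_mono conjI c le0)
  finally have "card (active_cells N s x) \<le> (2 * N + 3) ^ CARD('n)" by simp
  then have "real (card (active_cells N s x)) \<le> real ((2 * N + 3) ^ CARD('n))" by (rule of_nat_mono)
  then show ?thesis by (simp add: algebra_simps)
qed

lemma lattice_bump_inactive:
  assumes "i \<notin> active_cells N s x"
  shows "\<exists>U. open U \<and> x \<in> U \<and> (\<forall>z\<in>U. lattice_bump N s i z = 0)"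
proof -
  obtain j where j: "real N + 1 < \<bar>s * x $ j - of_int (i j)\<bar>"
    using assms by (auto simp: active_cells_def not_le)
  let ?U = "{z. real N + 1 < \<bar>s * z $ j - of_int (i j)\<bar>}"
  have "open ?U" by (intro open_Collect_less continuous_intros)
  moreover have "lattice_bump N s i z = 0" if "z \<in> ?U" for z
  proof -
    have "smooth_step N (s * z $ j - of_int (i j) + 1) - smooth_step N (s * z $ j - of_int (i j)) = 0"
    proof (cases "s * z $ j - of_int (i j) > 0")
      case True
      then show ?thesis using that by (simp add: smooth_step_eq_1)
    next
      case False
      then show ?thesis using that by (simp add: smooth_step_eq_0)
    qed
    then show ?thesis unfolding lattice_bump_def by (auto intro!: prod_zero)
  qed
  ultimately show ?thesis using j by (intro exI[of _ ?U]) auto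
qed

lemma sum_int_telescope:
  fixes g :: "int \<Rightarrow> real"
  assumes "a \<le> b + 1"
  shows "(\<Sum>i\<in>{a..b}. g (i - 1) - g i) = g (a - 1) - g b"
proof -
  have "(\<Sum>i\<in>{a..b' - 1}. g (i - 1) - g i) = g (a - 1) - g (b' - 1)" if "a \<le> b'" for b'
    using that
  proof (induction b' rule: int_ge_induct)
    case (step b')
    have "{a..b'} = insert b' {a..b' - 1}" using step by auto
    then show ?case using step by simp
  qed simp
  from this[of "b + 1"] show ?thesis using assms by simp
qed

text \<open>The sum over a box of lattice points is a product of one-dimensional sums, each of which telescopes to
a difference of values 1 and 0 of the smooth step.\<close>

lemma lattice_bump_sum:
  assumes "finite J" "active_cells N s x \<subseteq> J"
  shows "(\<Sum>i\<in>J. lattice_bump N s i x) = 1"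
proof -
  let ?A = "\<lambda>j. {\<lceil>s * x $ j - (real N + 1)\<rceil>..\<lfloor>s * x $ j + (real N + 1)\<rfloor>}"
  have one: "(\<Sum>l\<in>?A j. smooth_step N (s * x $ j - of_int l + 1) - smooth_step N (s * x $ j - of_int l)) = 1" for j
  proof -
    let ?a = "\<lceil>s * x $ j - (real N + 1)\<rceil>" and ?b = "\<lfloor>s * x $ j + (real N + 1)\<rfloor>"
    let ?g = "\<lambda>l. smooth_step N (s * x $ j - of_int l)"
    have "(\<Sum>l\<in>?A j. ?g (l - 1) - ?g l) = ?g (?a - 1) - ?g ?b"
      by (rule sum_int_telescope) linarith
    moreover have "?g (?a - 1) = 1" by (rule smooth_step_eq_1) (simp, linarith)
    moreover have "?g ?b = 0" by (rule smooth_step_eq_0) linarith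
    ultimately show ?thesis by (simp add: algebra_simps)
  qed
  have "(\<Sum>i\<in>J. lattice_bump N s i x) = (\<Sum>i\<in>active_cells N s x. lattice_bump N s i x)"
    using assms lattice_bump_inactive by (intro sum.mono_neutral_right) blast+
  also have "\<dots> = (\<Prod>j\<in>UNIV. \<Sum>l\<in>?A j. smooth_step N (s * x $ j - of_int l + 1) - smooth_step N (s * x $ j - of_int l))"
    unfolding active_cells_eq_PiE lattice_bump_def by (rule prod_sum_PiE[symmetric]) auto
  also have "\<dots> = 1" by (simp only: one prod.neutral_const)
  finally show ?thesis .
qed

lemma jet_bound_lattice_bump:
  assumes "0 \<le> s"
  shows "jet_bound N x (2 ^ CARD('n)) (2 * real CARD('n) * s) (lattice_bump N s i :: real^'n \<Rightarrow> real)"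
proof -
  have "jet_bound N x (1 + 1) (2 * s)
      (\<lambda>x::real^'n. smooth_step N (s * x $ j + (1 - of_int (i j))) - smooth_step N (s * x $ j + (- of_int (i j))))" for j
    by (intro jet_bound_diff jet_bound_smooth_step assms)
  then have "jet_bound N x (\<Prod>j\<in>(UNIV::'n set). 1 + 1) (\<Sum>j\<in>(UNIV::'n set). 2 * s)
     (\<lambda>x::real^'n. \<Prod>j\<in>UNIV. smooth_step N (s * x $ j + (1 - of_int (i j))) - smooth_step N (s * x $ j + (- of_int (i j))))"
    by (intro jet_bound_prod) auto
  moreover have "(\<lambda>x::real^'n. \<Prod>j\<in>UNIV. smooth_step N (s * x $ j + (1 - of_int (i j))) - smooth_step N (s * x $ j + (- of_int (i j)))) = lattice_bump N s i"
    by (rule ext) (simp add: lattice_bump_def algebra_simps)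
  ultimately show ?thesis by (simp add: mult_ac)
qed

text \<open>Only the active summands count at \<open>x\<close>, and their number is bounded in terms of the dimension and
the order of smoothness; this is where the jets of a sum stay comparable with those of one summand.\<close>

lemma jet_bound_lattice_sum:
  fixes h :: "('n::finite \<Rightarrow> int) \<Rightarrow> real^'n \<Rightarrow> real"
  assumes J: "finite J" and s: "0 \<le> s" and t: "0 \<le> t" and B: "0 \<le> B"
    and smooth: "\<And>i. C_k N (h i)"
    and h: "\<And>i. i \<in> J \<Longrightarrow> i \<in> active_cells N s x \<Longrightarrow> jet_bound N x B t (h i)"
  shows "jet_bound N x ((2 * real N + 3) ^ CARD('n) * 2 ^ CARD('n) * B) (2 * real CARD('n) * s + t)
     (\<lambda>z. \<Sum>i\<in>J. lattice_bump N s i z * h i z)"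
proof -
  let ?A = "\<lambda>i. if i \<in> active_cells N s x then 2 ^ CARD('n) * B else 0"
  let ?\<sigma> = "2 * real CARD('n) * s + t"
  have "jet_bound N x (?A i) ?\<sigma> (\<lambda>z. lattice_bump N s i z * h i z)" if "i \<in> J" for i
  proof (cases "i \<in> active_cells N s x")
    case True
    then show ?thesis
      using jet_bound_mult[OF jet_bound_lattice_bump[OF s, of N x i] h[OF that True]] by (simp only: if_True)
  next
    case False
    then obtain U where U: "open U" "x \<in> U" "\<And>z. z \<in> U \<Longrightarrow> lattice_bump N s i z = 0"
      using lattice_bump_inactive[OF False] by metis
    have "jet_bound N x 0 ?\<sigma> (\<lambda>z. lattice_bump N s i z * h i z)"
    proof (rule jet_bound_cong_open[OF U(1,2)])
      show "lattice_bump N s i z * h i z = 0" if "z \<in> U" for z using U(3)[OF that] by simp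
      show "jet_bound N x 0 ?\<sigma> (\<lambda>z. 0)" using s t by (intro jet_bound_zero) auto
      show "C_k N (\<lambda>z. lattice_bump N s i z * h i z)"
        by (intro C_k_mult smooth jet_bound_imp_C_k[OF jet_bound_lattice_bump[OF s, of N x i]])
    qed
    then show ?thesis using False by simp
  qed
  then have jb: "jet_bound N x (\<Sum>i\<in>J. ?A i) ?\<sigma> (\<lambda>z. \<Sum>i\<in>J. lattice_bump N s i z * h i z)"
    by (rule jet_bound_sum)
  have le: "(\<Sum>i\<in>J. ?A i) \<le> (2 * real N + 3) ^ CARD('n) * 2 ^ CARD('n) * B"
  proof -
    have "(\<Sum>i\<in>J. ?A i) = (\<Sum>i\<in>J \<inter> active_cells N s x. 2 ^ CARD('n) * B)"
      by (rule sum.inter_restrict[OF J, symmetric])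
    also have "\<dots> = real (card (J \<inter> active_cells N s x)) * (2 ^ CARD('n) * B)" by simp
    also have "\<dots> \<le> real (card (active_cells N s x)) * (2 ^ CARD('n) * B)"
      using B by (intro mult_right_mono) (auto intro: card_mono)
    also have "\<dots> \<le> (2 * real N + 3) ^ CARD('n) * (2 ^ CARD('n) * B)"
      using B by (intro mult_right_mono card_active_cells) auto
    finally show ?thesis by (simp add: mult_ac)
  qed
  have "0 \<le> (\<Sum>i\<in>J. ?A i)" using B by (intro sum_nonneg) simp
  moreover have "0 \<le> ?\<sigma>" using s t by simp
  ultimately show ?thesis by (rule jet_bound_mono[OF jb le _ _ order_refl])
qed

section \<open>The Whitney extension\<close>

text \<open>The order \<open>q\<close> of smoothness is strictly less than \<open>m\<close>, so the \<open>k\<close>-th term of a differentiated series is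
at most a constant times \<open>2^-k\<close>, whatever the rate at which the oscillations tend to 0.\<close>

locale whitney_family =
  fixes C :: "(real^'n) set" and P :: "real^'n \<Rightarrow> real^'n \<Rightarrow> real" and m q :: nat
  assumes compact: "compact C" and nonempty: "C \<noteq> {}"
    and poly: "\<And>y. y \<in> C \<Longrightarrow> poly_deg_le m (P y)"
    and whitney: "cond_W m C P"
    and q_less: "q < m"
begin

text \<open>In units of \<open>2^-k\<close>, an upper bound for the distance between a point and a node whose bump is active there.\<close>

definition radius :: real where "radius = real CARD('n) * (real q + 1)"

definition node :: "nat \<Rightarrow> ('n \<Rightarrow> int) \<Rightarrow> real^'n" where
  "node k i = (\<chi> j. of_int (i j) / 2 ^ k)"

text \<open>With the factor 4, the bumps at these nodes sum to 1 at distance less than \<open>3 * radius / 2^k\<close> from \<open>C\<close>, and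
all of them vanish at distance more than \<open>5 * radius / 2^k\<close>.\<close>

definition nodes :: "nat \<Rightarrow> ('n \<Rightarrow> int) set" where
  "nodes k = {i. infdist (node k i) C \<le> 4 * radius / 2 ^ k}"

definition near :: "real^'n \<Rightarrow> real^'n" where
  "near x = closest_point C x"

definition approx :: "nat \<Rightarrow> real^'n \<Rightarrow> real" where
  "approx k x = (\<Sum>i\<in>nodes k. lattice_bump q (2 ^ k) i x * P (near (node k i)) x)"

definition cutoff :: "nat \<Rightarrow> real^'n \<Rightarrow> real" where
  "cutoff k x = (\<Sum>i\<in>nodes k. lattice_bump q (2 ^ k) i x * 1)"

text \<open>The cutoff is two scales finer than \<open>approx k\<close>: its support, within distance \<open>5 * radius / 2^(k+2)\<close> of \<open>C\<close>, lies
where both \<open>approx k\<close> and \<open>approx (k + 1)\<close> are full averages of the polynomials.\<close>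

definition increment :: "nat \<Rightarrow> real^'n \<Rightarrow> real" where
  "increment k x = cutoff (k + 2) x * (approx (k + 1) x - approx k x)"

text \<open>Whitney's condition with constant \<open>\<epsilon>\<close> at the scale \<open>2^-k\<close>. The distance \<open>10 * radius / 2^k\<close> covers any two
of the points of \<open>C\<close> that enter the estimates near one point of space at that scale.\<close>

definition osc_le :: "real \<Rightarrow> nat \<Rightarrow> bool" where
  "osc_le \<epsilon> k \<longleftrightarrow> 0 \<le> \<epsilon> \<and> (\<forall>y\<in>C. \<forall>z\<in>C. norm (y - z) \<le> 10 * radius / 2 ^ k \<longrightarrow> (\<forall>us. length us \<le> m \<longrightarrow>
    \<bar>higher_deriv (\<lambda>x. P y x - P z x) z us\<bar> \<le> \<epsilon> * norm (y - z) ^ (m - length us) * prod_list (map norm us)))"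

lemma radius_ge_1: "1 \<le> radius"
proof -
  have "1 * 1 \<le> real CARD('n) * (real q + 1)" by (intro mult_mono) auto
  then show ?thesis by (simp add: radius_def)
qed

lemma near_in: "near x \<in> C"
  unfolding near_def using compact nonempty by (intro closest_point_in_set compact_imp_closed)

lemma infdist_near: "infdist x C = dist x (near x)"
proof (rule antisym)
  show "infdist x C \<le> dist x (near x)" by (rule infdist_le[OF near_in])
  obtain y where "y \<in> C" "infdist x C = dist x y"
    using infdist_attains_inf[OF compact_imp_closed[OF compact] nonempty] by blast
  then show "dist x (near x) \<le> infdist x C"
    unfolding near_def using closest_point_le[OF compact_imp_closed[OF compact]] by simp
qed

lemma smooth_P: "y \<in> C \<Longrightarrow> C_k k (P y)"
  using derivs_vanish_from_poly[OF poly] by (auto simp: derivs_vanish_from_def)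

lemma dist_node:
  assumes "i \<in> active_cells q (2 ^ k) x"
  shows "dist x (node k i) \<le> radius / 2 ^ k"
proof -
  have "\<bar>(x - node k i) $ j\<bar> \<le> (real q + 1) / 2 ^ k" for j
  proof -
    have "\<bar>2 ^ k * x $ j - of_int (i j)\<bar> \<le> real q + 1" using assms by (simp add: active_cells_def)
    moreover have eq: "2 ^ k * x $ j - of_int (i j) = 2 ^ k * (x - node k i) $ j"
      by (simp add: node_def algebra_simps)
    have "\<bar>2 ^ k * x $ j - of_int (i j)\<bar> = 2 ^ k * \<bar>(x - node k i) $ j\<bar>"
      unfolding eq by (simp add: abs_mult)
    ultimately show ?thesis by (simp add: pos_le_divide_eq mult.commute)
  qed
  then have "(\<Sum>j\<in>UNIV. \<bar>(x - node k i) $ j\<bar>) \<le> (\<Sum>j\<in>(UNIV::'n set). (real q + 1) / 2 ^ k)"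
    by (rule sum_mono)
  then show ?thesis using norm_le_l1_cart[of "x - node k i"] by (simp add: dist_norm radius_def)
qed

lemma finite_nodes: "finite (nodes k)"
proof -
  obtain R where R: "\<And>y. y \<in> C \<Longrightarrow> norm y \<le> R"
    using compact_imp_bounded[OF compact] by (auto simp: bounded_iff)
  obtain N :: nat where N: "2 ^ k * (R + 4 * radius / 2 ^ k) \<le> real N" using real_arch_simple by blast
  have "nodes k \<subseteq> active_cells N (2 ^ k) 0"
  proof
    fix i assume "i \<in> nodes k"
    then have "dist (node k i) (near (node k i)) \<le> 4 * radius / 2 ^ k" by (simp add: nodes_def infdist_near)
    then have b: "norm (node k i) \<le> R + 4 * radius / 2 ^ k"
      using R[OF near_in[of "node k i"]] norm_triangle_sub[of "node k i" "near (node k i)"] by (simp add: dist_norm)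
    have "\<bar>of_int (i j)\<bar> \<le> real N + 1" for j
    proof -
      have "\<bar>of_int (i j)\<bar> = 2 ^ k * \<bar>node k i $ j\<bar>" by (simp add: node_def)
      also have "\<dots> \<le> 2 ^ k * (R + 4 * radius / 2 ^ k)"
        using b component_le_norm_cart[of "node k i" j] by (intro mult_left_mono) auto
      finally show ?thesis using N by simp
    qed
    then show "i \<in> active_cells N (2 ^ k) 0" by (simp add: active_cells_def)
  qed
  then show ?thesis by (rule finite_subset) simp
qed

lemma active_subset_nodes:
  assumes "infdist x C < 3 * radius / 2 ^ k"
  shows "active_cells q (2 ^ k) x \<subseteq> nodes k"
proof
  fix i assume "i \<in> active_cells q (2 ^ k) x"
  then have "dist x (node k i) \<le> radius / 2 ^ k" by (rule dist_node)
  then show "i \<in> nodes k"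
    using infdist_triangle[of "node k i" C x] assms
    by (simp add: nodes_def dist_commute add_divide_distrib[symmetric])
qed

lemma active_inter_nodes_near:
  assumes "i \<in> active_cells q (2 ^ k) x" "i \<in> nodes k"
  shows "infdist x C \<le> 5 * radius / 2 ^ k" "norm (x - near (node k i)) \<le> 5 * radius / 2 ^ k"
proof -
  have a: "dist x (node k i) \<le> radius / 2 ^ k" using assms(1) by (rule dist_node)
  have b: "dist (node k i) (near (node k i)) \<le> 4 * radius / 2 ^ k"
    using assms(2) by (simp add: nodes_def infdist_near)
  have "dist x (near (node k i)) \<le> radius / 2 ^ k + 4 * radius / 2 ^ k"
    using dist_triangle[of x "near (node k i)" "node k i"] a b by simp
  also have "\<dots> = 5 * radius / 2 ^ k" by (simp add: field_simps)
  finally have c: "dist x (near (node k i)) \<le> 5 * radius / 2 ^ k" .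
  then show "norm (x - near (node k i)) \<le> 5 * radius / 2 ^ k" by (simp add: dist_norm)
  show "infdist x C \<le> 5 * radius / 2 ^ k" using infdist_le[OF near_in, of x "node k i"] c by simp
qed

lemma cutoff_eq_1: "infdist x C < 3 * radius / 2 ^ k \<Longrightarrow> cutoff k x = 1"
  unfolding cutoff_def using lattice_bump_sum[OF finite_nodes active_subset_nodes] by simp

lemma far_bump_0:
  assumes "infdist x C > 5 * radius / 2 ^ k" "i \<in> nodes k"
  shows "lattice_bump q (2 ^ k) i x = 0"
  using active_inter_nodes_near(1)[of i k x] assms lattice_bump_inactive[of i q "2 ^ k" x] by force

lemma cutoff_eq_0: "infdist x C > 5 * radius / 2 ^ k \<Longrightarrow> cutoff k x = 0"
  unfolding cutoff_def using far_bump_0 by (intro sum.neutral) auto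

lemma approx_eq_0: "infdist x C > 5 * radius / 2 ^ k \<Longrightarrow> approx k x = 0"
  unfolding approx_def using far_bump_0 by (intro sum.neutral) auto

lemma C_k_lattice_bump: "C_k q (lattice_bump q (2 ^ k) i)"
  by (rule jet_bound_imp_C_k[OF jet_bound_lattice_bump]) simp

lemma C_k_approx: "C_k q (approx k)"
  unfolding approx_def by (intro C_k_sum C_k_mult C_k_lattice_bump smooth_P near_in)

lemma C_k_cutoff: "C_k q (cutoff k)"
  unfolding cutoff_def by (intro C_k_sum C_k_mult C_k_lattice_bump C_k_const)

lemma C_k_increment: "C_k q (increment k)"
  unfolding increment_def by (intro C_k_mult C_k_cutoff C_k_diff C_k_approx)

text \<open>The number of bumps that can be active at one point times the amplitude of a bump.\<close>

definition overlap_const :: real where "overlap_const = (2 * real q + 3) ^ CARD('n) * 2 ^ CARD('n)"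

text \<open>Amplitude and frequency, up to powers of the scale, of the difference between \<open>approx k\<close> and a
nearby polynomial.\<close>

definition approx_amp :: real where "approx_amp = overlap_const * (exp 1 * (10 * radius) ^ m)"
definition approx_freq :: real where "approx_freq = 2 * real CARD('n) + 1"

lemma constants: "1 \<le> overlap_const" "0 \<le> approx_amp" "1 \<le> approx_freq"
proof -
  have "1 * 1 \<le> (2 * real q + 3) ^ CARD('n) * 2 ^ CARD('n)"
    by (intro mult_mono one_le_power) auto
  then show "1 \<le> overlap_const" by (simp add: overlap_const_def)
  then show "0 \<le> approx_amp" using radius_ge_1 by (simp add: approx_amp_def)
qed (simp add: approx_freq_def)

text \<open>Near \<open>C\<close> the bumps sum to 1, so \<open>approx k - P y\<close> is an average of the differences \<open>P y' - P y\<close> over nearby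
points \<open>y'\<close> of \<open>C\<close>, and those are small with all their derivatives.\<close>

lemma jet_bound_approx_diff:
  assumes osc: "osc_le \<epsilon> k" and x: "infdist x C < 3 * radius / 2 ^ k"
    and y: "y \<in> C" "norm (x - y) \<le> 5 * radius / 2 ^ k"
  shows "jet_bound q x (approx_amp * \<epsilon> * (1 / 2 ^ k) ^ m) (approx_freq * 2 ^ k) (\<lambda>z. approx k z - P y z)"
proof -
  define \<delta> where "\<delta> = 10 * radius / 2 ^ k"
  have \<delta>: "0 < \<delta>" using radius_ge_1 by (simp add: \<delta>_def)
  have \<epsilon>: "0 \<le> \<epsilon>" using osc by (simp add: osc_le_def)
  let ?h = "\<lambda>i z. P (near (node k i)) z - P y z"
  have "jet_bound q x (exp 1 * \<epsilon> * \<delta> ^ m) (1 / \<delta>) (?h i)"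
    if i: "i \<in> nodes k" "i \<in> active_cells q (2 ^ k) x" for i
  proof -
    have "norm (near (node k i) - y) \<le> norm (x - near (node k i)) + norm (x - y)"
      using norm_triangle_ineq4[of "x - y" "x - near (node k i)"] by (simp add: algebra_simps)
    also have "\<dots> \<le> 5 * radius / 2 ^ k + 5 * radius / 2 ^ k" using active_inter_nodes_near(2)[OF i(2,1)] y by simp
    also have "\<dots> = \<delta>" by (simp add: \<delta>_def field_simps)
    finally have d: "norm (near (node k i) - y) \<le> \<delta>" .
    show ?thesis
    proof (rule jet_bound_taylor[where z=y and m=m])
      show "derivs_vanish_from (Suc m) (?h i)"
        by (intro derivs_vanish_from_diff derivs_vanish_from_poly poly near_in y)
      show "\<bar>higher_deriv (?h i) y us\<bar> \<le> \<epsilon> * \<delta> ^ (m - length us) * prod_list (map norm us)"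
        if "length us \<le> m" for us
      proof -
        have "\<bar>higher_deriv (?h i) y us\<bar> \<le> \<epsilon> * norm (near (node k i) - y) ^ (m - length us) * prod_list (map norm us)"
          using osc d near_in y that by (simp add: osc_le_def \<delta>_def)
        also have "\<dots> \<le> \<epsilon> * \<delta> ^ (m - length us) * prod_list (map norm us)"
          using d \<epsilon> by (intro mult_right_mono mult_left_mono power_mono) auto
        finally show ?thesis .
      qed
      show "norm (x - y) \<le> \<delta>" using y(2) radius_ge_1 by (rule_tac order_trans[OF y(2)]) (simp add: \<delta>_def divide_right_mono)
    qed (use \<delta> \<epsilon> q_less in auto)
  qed
  then have "jet_bound q x (overlap_const * (exp 1 * \<epsilon> * \<delta> ^ m))
      (2 * real CARD('n) * 2 ^ k + 1 / \<delta>) (\<lambda>z. \<Sum>i\<in>nodes k. lattice_bump q (2 ^ k) i z * ?h i z)"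
    using \<delta> \<epsilon> unfolding overlap_const_def
    by (intro jet_bound_lattice_sum finite_nodes C_k_diff smooth_P near_in y) auto
  moreover have "overlap_const * (exp 1 * \<epsilon> * \<delta> ^ m) = approx_amp * \<epsilon> * (1 / 2 ^ k) ^ m"
    by (simp add: approx_amp_def \<delta>_def power_mult_distrib power_divide)
  ultimately have jb: "jet_bound q x (approx_amp * \<epsilon> * (1 / 2 ^ k) ^ m)
      (2 * real CARD('n) * 2 ^ k + 1 / \<delta>) (\<lambda>z. \<Sum>i\<in>nodes k. lattice_bump q (2 ^ k) i z * ?h i z)"
    by (simp only:)
  have "1 / \<delta> \<le> 2 ^ k" using radius_ge_1 by (simp add: \<delta>_def divide_simps)
  then have le: "2 * real CARD('n) * 2 ^ k + 1 / \<delta> \<le> approx_freq * 2 ^ k" by (simp add: approx_freq_def algebra_simps)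
  have jb: "jet_bound q x (approx_amp * \<epsilon> * (1 / 2 ^ k) ^ m) (approx_freq * 2 ^ k)
      (\<lambda>z. \<Sum>i\<in>nodes k. lattice_bump q (2 ^ k) i z * ?h i z)"
    using constants \<epsilon> \<delta> by (intro jet_bound_mono[OF jb order_refl _ _ le]) auto
  let ?U = "{z. infdist z C < 3 * radius / 2 ^ k}"
  show ?thesis
  proof (rule jet_bound_cong_open[of ?U])
    show "open ?U" by (intro open_Collect_less continuous_intros)
    show "approx k z - P y z = (\<Sum>i\<in>nodes k. lattice_bump q (2 ^ k) i z * ?h i z)" if "z \<in> ?U" for z
    proof -
      have "(\<Sum>i\<in>nodes k. lattice_bump q (2 ^ k) i z) = 1"
        using that by (intro lattice_bump_sum finite_nodes active_subset_nodes) simp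
      then have "P y z = (\<Sum>i\<in>nodes k. lattice_bump q (2 ^ k) i z * P y z)"
        by (simp add: sum_distrib_right[symmetric])
      then show ?thesis by (simp add: approx_def right_diff_distrib sum_subtractf)
    qed
  qed (use x jb C_k_diff[OF C_k_approx smooth_P[OF y(1)]] in auto)
qed

text \<open>The same two constants for the increments.\<close>

definition increment_amp :: real where "increment_amp = overlap_const * (2 * approx_amp)"
definition increment_freq :: real where "increment_freq = 8 * real CARD('n) + 2 * approx_freq"

lemma constants1: "0 \<le> increment_amp" "1 \<le> increment_freq"
  using constants by (auto simp: increment_amp_def increment_freq_def)

lemma jet_bound_cutoff: "jet_bound q x overlap_const (2 * real CARD('n) * 2 ^ k) (cutoff k)"
  using jet_bound_lattice_sum[of "nodes k" "2 ^ k" 0 1 q "\<lambda>_ _. 1" x] finite_nodes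
  by (simp add: cutoff_def[abs_def] overlap_const_def jet_bound_const)

text \<open>Where the cutoff lives, subtract the same polynomial from both approximations; elsewhere the increment
vanishes identically.\<close>

lemma jet_bound_increment:
  assumes osc: "osc_le \<epsilon> k" "osc_le \<epsilon> (k + 1)"
  shows "jet_bound q x (increment_amp * \<epsilon> * (1 / 2 ^ k) ^ m) (increment_freq * 2 ^ k) (increment k)"
proof (cases "infdist x C < 3 * radius / 2 ^ (k + 1)")
  case True
  have \<epsilon>: "0 \<le> \<epsilon>" using osc by (simp add: osc_le_def)
  have xk: "infdist x C < 3 * radius / 2 ^ k"
    using True by (rule order.strict_trans2) (use radius_ge_1 in \<open>simp add: divide_simps\<close>)
  let ?y = "near x"
  have d1: "norm (x - ?y) \<le> 5 * radius / 2 ^ (k + 1)"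
    using True radius_ge_1 by (simp add: infdist_near dist_norm divide_simps)
  have d0: "norm (x - ?y) \<le> 5 * radius / 2 ^ k"
    using xk radius_ge_1 by (simp add: infdist_near dist_norm divide_simps)
  have le: "approx_amp * \<epsilon> * (1 / 2 ^ (k + 1)) ^ m \<le> approx_amp * \<epsilon> * (1 / 2 ^ k) ^ m"
    using constants \<epsilon> by (intro mult_left_mono power_mono) (auto simp: divide_simps)
  have g1: "jet_bound q x (approx_amp * \<epsilon> * (1 / 2 ^ k) ^ m) (2 * approx_freq * 2 ^ k) (\<lambda>z. approx (k + 1) z - P ?y z)"
    using constants \<epsilon> by (intro jet_bound_mono[OF jet_bound_approx_diff[OF osc(2) True near_in d1] le]) auto
  have g0: "jet_bound q x (approx_amp * \<epsilon> * (1 / 2 ^ k) ^ m) (2 * approx_freq * 2 ^ k) (\<lambda>z. approx k z - P ?y z)"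
    using constants \<epsilon> by (intro jet_bound_mono[OF jet_bound_approx_diff[OF osc(1) xk near_in d0] order_refl]) auto
  have "jet_bound q x (overlap_const * (approx_amp * \<epsilon> * (1 / 2 ^ k) ^ m + approx_amp * \<epsilon> * (1 / 2 ^ k) ^ m))
      (2 * real CARD('n) * 2 ^ (k + 2) + 2 * approx_freq * 2 ^ k)
      (\<lambda>z. cutoff (k + 2) z * ((approx (k + 1) z - P ?y z) - (approx k z - P ?y z)))" (is "jet_bound _ _ _ _ ?T")
    by (intro jet_bound_mult jet_bound_cutoff jet_bound_diff g0 g1)
  moreover have "overlap_const * (approx_amp * \<epsilon> * (1 / 2 ^ k) ^ m + approx_amp * \<epsilon> * (1 / 2 ^ k) ^ m) = increment_amp * \<epsilon> * (1 / 2 ^ k) ^ m"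
    by (simp add: increment_amp_def)
  moreover have "2 * real CARD('n) * 2 ^ (k + 2) + 2 * approx_freq * 2 ^ k = increment_freq * 2 ^ k"
    by (simp add: increment_freq_def algebra_simps)
  moreover have "?T = increment k" by (rule ext) (simp add: increment_def)
  ultimately show ?thesis by (simp only:)
next
  case False
  have \<epsilon>: "0 \<le> \<epsilon>" using osc by (simp add: osc_le_def)
  let ?U = "{z. infdist z C > 5 * radius / 2 ^ (k + 2)}"
  have "5 * radius / 2 ^ (k + 2) < 3 * radius / 2 ^ (k + 1)" using radius_ge_1 by (simp add: divide_simps)
  then have x: "x \<in> ?U" using False by simp
  show ?thesis
  proof (rule jet_bound_cong_open[OF _ x])
    show "open ?U" by (intro open_Collect_less continuous_intros)
    show "increment k z = 0" if "z \<in> ?U" for z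
      using cutoff_eq_0[of "k + 2" z] that by (simp add: increment_def)
    show "jet_bound q x (increment_amp * \<epsilon> * (1 / 2 ^ k) ^ m) (increment_freq * 2 ^ k) (\<lambda>z. 0)"
      using constants1 \<epsilon> by (intro jet_bound_zero) auto
  qed (rule C_k_increment)
qed

lemma osc_le_eventually:
  assumes "0 < \<epsilon>"
  shows "\<exists>k0. \<forall>k\<ge>k0. osc_le \<epsilon> k"
proof -
  obtain \<delta> where \<delta>: "\<delta> > 0" "\<forall>y\<in>C. \<forall>z\<in>C. norm (y - z) \<le> \<delta> \<longrightarrow> (\<forall>us. length us \<le> m \<longrightarrow>
    \<bar>higher_deriv (\<lambda>x. P y x - P z x) z us\<bar> \<le> \<epsilon> * norm (y - z) ^ (m - length us) * prod_list (map norm us))"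
    using cond_W_uniform[OF compact poly whitney assms] by blast
  obtain k0 where k0: "10 * radius / \<delta> < 2 ^ k0" using real_arch_pow[of 2] by auto
  have "10 * radius / 2 ^ k \<le> \<delta>" if "k \<ge> k0" for k
  proof -
    have "10 * radius / \<delta> < 2 ^ k" using k0 by (rule less_le_trans) (use that in simp)
    then show ?thesis using \<delta>(1) by (simp add: field_simps)
  qed
  then show ?thesis using \<delta> assms unfolding osc_le_def by (meson less_imp_le order_trans)
qed

text \<open>A first scale from which the oscillation is at most 1, so that all increments are bounded by a
convergent geometric series.\<close>

definition k0 :: nat where "k0 = (SOME k0. \<forall>k\<ge>k0. osc_le 1 k)"

lemma osc_le_k0: "k \<ge> k0 \<Longrightarrow> osc_le 1 k"
  unfolding k0_def using someI_ex[OF osc_le_eventually[of 1]] by simp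

definition extension :: "real^'n \<Rightarrow> real" where
  "extension x = approx k0 x + (\<Sum>k. increment (k0 + k) x)"

lemma jet_bound_increment_summable:
  "jet_bound q x (increment_amp * increment_freq ^ q * (1 / 2) ^ k) 1 (increment (k0 + k))"
proof -
  let ?K = "k0 + k"
  have jb: "jet_bound q x (increment_amp * 1 * (1 / 2 ^ ?K) ^ m * (increment_freq * 2 ^ ?K) ^ q) 1 (increment ?K)"
  proof (rule jet_bound_rescale[OF jet_bound_increment])
    have "1 * 1 \<le> increment_freq * 2 ^ ?K" using constants1 by (intro mult_mono) auto
    then show "1 \<le> increment_freq * 2 ^ ?K" by simp
  qed (use constants1 in \<open>auto intro: osc_le_k0\<close>)
  have le: "increment_amp * 1 * (1 / 2 ^ ?K) ^ m * (increment_freq * 2 ^ ?K) ^ q \<le> increment_amp * increment_freq ^ q * (1 / 2) ^ k"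
  proof -
    have "(1 / 2 ^ ?K :: real) ^ m = (1 / 2 ^ ?K) ^ (m - q) * (1 / 2 ^ ?K) ^ q"
      using q_less by (subst power_add[symmetric]) simp
    then have "(1 / 2 ^ ?K) ^ m * (2 ^ ?K) ^ q = (1 / 2 ^ ?K) ^ (m - q) * ((1 / 2 ^ ?K) ^ q * (2 ^ ?K) ^ q :: real)"
      by (simp only: mult.assoc)
    also have "(1 / 2 ^ ?K) ^ q * (2 ^ ?K) ^ q = (1::real)" by (simp add: power_one_over)
    also have "(1 / 2 ^ ?K) ^ (m - q) * 1 \<le> (1 / 2 ^ ?K :: real) ^ 1"
      using q_less by (subst mult_1_right) (intro power_decreasing, auto)
    also have "\<dots> \<le> (1 / 2) ^ k" by (simp add: power_one_over divide_simps)
    finally have "increment_amp * increment_freq ^ q * ((1 / 2 ^ ?K) ^ m * (2 ^ ?K) ^ q) \<le> increment_amp * increment_freq ^ q * (1 / 2) ^ k"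
      using constants1 by (intro mult_left_mono) auto
    then show ?thesis by (simp add: power_mult_distrib mult_ac)
  qed
  show ?thesis by (rule jet_bound_mono[OF jb le]) (use constants1 in auto)
qed

lemma series_increment: "C_k q (\<lambda>x. \<Sum>k. increment (k0 + k) x)"
  "length us \<le> q \<Longrightarrow> (\<lambda>k. higher_deriv (increment (k0 + k)) x us) sums higher_deriv (\<lambda>x. \<Sum>k. increment (k0 + k) x) x us"
  using C_k_series[of q "\<lambda>k. increment_amp * increment_freq ^ q * (1 / 2) ^ k" "\<lambda>k. increment (k0 + k)"] jet_bound_increment_summable
  by (auto intro: summable_mult)

lemma C_k_extension: "C_k q extension"
  unfolding extension_def[abs_def] by (intro C_k_add C_k_approx series_increment)

lemma higher_deriv_extension:
  assumes "length us \<le> q"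
  shows "(\<lambda>k. higher_deriv (increment (k0 + k)) x us) sums (higher_deriv extension x us - higher_deriv (approx k0) x us)"
  using series_increment(2)[OF assms, of x] higher_deriv_add[OF C_k_approx series_increment(1) assms, of k0 x]
  by (simp add: extension_def[abs_def])

text \<open>Where the cutoff is 1, the increments telescope.\<close>

lemma higher_deriv_increment_near:
  assumes "infdist x C < 3 * radius / 2 ^ (k + 2)" "length us \<le> q"
  shows "higher_deriv (increment k) x us = higher_deriv (approx (k + 1)) x us - higher_deriv (approx k) x us"
proof -
  let ?U = "{z. infdist z C < 3 * radius / 2 ^ (k + 2)}"
  have "higher_deriv (increment k) x us = higher_deriv (\<lambda>z. approx (k + 1) z - approx k z) x us"
  proof (rule higher_deriv_cong_open[of ?U])
    show "open ?U" by (intro open_Collect_less continuous_intros)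
    show "increment k z = approx (k + 1) z - approx k z" if "z \<in> ?U" for z
      using cutoff_eq_1[of z "k + 2"] that by (simp add: increment_def)
  qed (use assms in simp)
  then show ?thesis using higher_deriv_diff[OF C_k_approx C_k_approx assms(2)] by simp
qed

definition extension_const :: real where "extension_const = approx_amp * approx_freq ^ q + 2 * increment_amp * increment_freq ^ q"

lemma extension_const_nonneg: "0 \<le> extension_const"
  using constants constants1 by (simp add: extension_const_def)

text \<open>The main estimate. At a point whose distance from \<open>C\<close> is below the scale \<open>2^-K\<close> the increments before \<open>K\<close>
telescope, so the extension is \<open>approx K\<close> plus the increments from \<open>K\<close> on. The former is close to
the nearest polynomial and the latter form a geometric tail.\<close>

lemma extension_close:
  assumes K: "k0 \<le> K" "\<And>k. K \<le> k \<Longrightarrow> osc_le \<epsilon> k" and x: "infdist x C < 3 * radius / 2 ^ (K + 1)"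
    and us: "length us \<le> q"
  shows "\<bar>higher_deriv extension x us - higher_deriv (P (near x)) x us\<bar>
    \<le> extension_const * \<epsilon> * (1 / 2 ^ K) ^ (m - length us) * prod_list (map norm us)"
proof -
  define j where "j = length us"
  define Q where "Q = prod_list (map norm us)"
  have Q: "0 \<le> Q" by (simp add: Q_def)
  have \<epsilon>: "0 \<le> \<epsilon>" using K(2)[of K] by (simp add: osc_le_def)
  let ?t = "\<lambda>k. higher_deriv (increment (k0 + k)) x us" and ?g = "\<lambda>k. higher_deriv (approx k) x us"
  have scale: "(1 / 2 ^ k) ^ m * (2 ^ k) ^ j = (1 / 2 ^ k :: real) ^ (m - j)" for k
    using us q_less by (simp add: j_def power_diff power_one_over divide_simps)
  have part: "(\<Sum>k<K - k0. ?t k) = ?g K - ?g k0"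
  proof -
    have "?t k = ?g (k0 + Suc k) - ?g (k0 + k)" if "k < K - k0" for k
    proof -
      have "k0 + k + 2 \<le> K + 1" using that by simp
      then have "2 ^ (k0 + k + 2) \<le> (2 :: real) ^ (K + 1)" by (intro power_increasing) auto
      then have "3 * radius / 2 ^ (K + 1) \<le> 3 * radius / 2 ^ (k0 + k + 2)"
        using radius_ge_1 by (intro divide_left_mono) auto
      then show ?thesis using higher_deriv_increment_near[of x "k0 + k" us] x us by simp
    qed
    then have "(\<Sum>k<K - k0. ?t k) = (\<Sum>k<K - k0. ?g (k0 + Suc k) - ?g (k0 + k))" by simp
    also have "\<dots> = ?g (k0 + (K - k0)) - ?g (k0 + 0)" by (rule sum_lessThan_telescope)
    finally show ?thesis using K(1) by simp
  qed
  have sums: "?t sums (higher_deriv extension x us - ?g k0)" by (rule higher_deriv_extension[OF us])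
  have "(\<lambda>k. ?t (k + (K - k0))) sums (higher_deriv extension x us - ?g k0 - (\<Sum>k<K - k0. ?t k))"
    by (rule sums_split_initial_segment[OF sums])
  then have tail: "(\<lambda>k. higher_deriv (increment (K + k)) x us) sums (higher_deriv extension x us - ?g K)"
    using K(1) part by (simp add: add.commute)
  have tb: "\<bar>higher_deriv (increment (K + k)) x us\<bar> \<le> (increment_amp * \<epsilon> * increment_freq ^ q * (1 / 2 ^ K) ^ (m - j) * Q) * (1 / 2) ^ k" for k
  proof -
    have "\<bar>higher_deriv (increment (K + k)) x us\<bar> \<le> increment_amp * \<epsilon> * (1 / 2 ^ (K + k)) ^ m * (increment_freq * 2 ^ (K + k)) ^ j * Q"
      using jet_boundD[OF jet_bound_increment us, of \<epsilon> "K + k" x] K(2) by (simp add: j_def Q_def)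
    also have "\<dots> = increment_amp * \<epsilon> * increment_freq ^ j * ((1 / 2 ^ (K + k)) ^ m * (2 ^ (K + k)) ^ j) * Q"
      by (simp add: power_mult_distrib)
    also have "\<dots> = increment_amp * \<epsilon> * increment_freq ^ j * ((1 / 2 ^ K) ^ (m - j) * ((1 / 2) ^ k) ^ (m - j)) * Q"
      by (simp only: scale) (simp add: power_add power_mult_distrib power_one_over)
    also have "\<dots> \<le> increment_amp * \<epsilon> * increment_freq ^ q * ((1 / 2 ^ K) ^ (m - j) * (1 / 2) ^ k) * Q"
    proof (intro mult_right_mono mult_mono mult_left_mono Q)
      show "increment_freq ^ j \<le> increment_freq ^ q" using us constants1 by (intro power_increasing) (auto simp: j_def)
      have "((1 / 2 :: real) ^ k) ^ (m - j) \<le> ((1 / 2) ^ k) ^ 1"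
        using us q_less by (intro power_decreasing) (auto simp: j_def power_le_one)
      then show "((1 / 2 :: real) ^ k) ^ (m - j) \<le> (1 / 2) ^ k" by simp
    qed (use constants1 \<epsilon> in auto)
    finally show ?thesis by (simp add: mult_ac)
  qed
  have gs: "summable (\<lambda>k. (increment_amp * \<epsilon> * increment_freq ^ q * (1 / 2 ^ K) ^ (m - j) * Q) * (1 / 2) ^ k)"
    by (intro summable_mult summable_geometric) simp
  have "\<bar>higher_deriv extension x us - ?g K\<bar> \<le> (\<Sum>k. (increment_amp * \<epsilon> * increment_freq ^ q * (1 / 2 ^ K) ^ (m - j) * Q) * (1 / 2) ^ k)"
    using norm_suminf_le[OF _ gs, of "\<lambda>k. higher_deriv (increment (K + k)) x us"] tb tail by (simp add: sums_iff)
  also have "\<dots> = 2 * increment_amp * increment_freq ^ q * \<epsilon> * (1 / 2 ^ K) ^ (m - j) * Q"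
    by (subst suminf_mult) (auto simp: suminf_geometric mult_ac)
  finally have part1: "\<bar>higher_deriv extension x us - ?g K\<bar> \<le> 2 * increment_amp * increment_freq ^ q * \<epsilon> * (1 / 2 ^ K) ^ (m - j) * Q" .
  have xK: "infdist x C < 3 * radius / 2 ^ K"
    using x by (rule order.strict_trans2) (use radius_ge_1 in \<open>simp add: divide_simps\<close>)
  then have xy: "norm (x - near x) \<le> 5 * radius / 2 ^ K"
    using radius_ge_1 by (simp add: infdist_near dist_norm divide_simps)
  have "\<bar>?g K - higher_deriv (P (near x)) x us\<bar> \<le> approx_amp * \<epsilon> * (1 / 2 ^ K) ^ m * (approx_freq * 2 ^ K) ^ j * Q"
    using jet_boundD[OF jet_bound_approx_diff[OF K(2)[OF order_refl] xK near_in xy] us]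
      higher_deriv_diff[OF C_k_approx smooth_P[OF near_in] us] by (simp add: j_def Q_def)
  also have "\<dots> = approx_amp * \<epsilon> * approx_freq ^ j * ((1 / 2 ^ K) ^ m * (2 ^ K) ^ j) * Q"
    by (simp add: power_mult_distrib)
  also have "\<dots> \<le> approx_amp * \<epsilon> * approx_freq ^ q * ((1 / 2 ^ K) ^ m * (2 ^ K) ^ j) * Q"
    using us constants \<epsilon> Q by (intro mult_right_mono mult_left_mono power_increasing) (auto simp: j_def)
  also have "\<dots> = approx_amp * approx_freq ^ q * \<epsilon> * (1 / 2 ^ K) ^ (m - j) * Q"
    by (simp only: scale) (simp only: mult_ac)
  finally have part2: "\<bar>?g K - higher_deriv (P (near x)) x us\<bar> \<le> approx_amp * approx_freq ^ q * \<epsilon> * (1 / 2 ^ K) ^ (m - j) * Q" .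
  have "\<bar>higher_deriv extension x us - higher_deriv (P (near x)) x us\<bar>
      \<le> approx_amp * approx_freq ^ q * \<epsilon> * (1 / 2 ^ K) ^ (m - j) * Q + 2 * increment_amp * increment_freq ^ q * \<epsilon> * (1 / 2 ^ K) ^ (m - j) * Q"
    using part1 part2 by linarith
  also have "\<dots> = extension_const * \<epsilon> * (1 / 2 ^ K) ^ (m - j) * Q" by (simp add: extension_const_def algebra_simps)
  finally show ?thesis by (simp add: j_def Q_def)
qed

text \<open>A point of \<open>C\<close> is below every scale, so the estimate holds with every \<open>\<epsilon>\<close>.\<close>

lemma extension_jet:
  assumes x: "x \<in> C" and us: "length us \<le> q"
  shows "higher_deriv extension x us = higher_deriv (P x) x us"
proof -
  have inf0: "infdist x C = 0" using x by simp
  then have nx: "near x = x" by (simp add: infdist_near)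
  let ?c = "extension_const * prod_list (map norm us)"
  have c: "0 \<le> ?c" using extension_const_nonneg by simp
  have "\<bar>higher_deriv extension x us - higher_deriv (P x) x us\<bar> \<le> 0"
  proof (rule field_le_epsilon)
    fix e :: real assume e: "0 < e"
    \<comment> \<open>The summand 1 only guards against a vanishing constant.\<close>
    define \<epsilon> where "\<epsilon> = e / (?c + 1)"
    have \<epsilon>: "0 < \<epsilon>" using e c by (simp add: \<epsilon>_def)
    obtain k1 where k1: "\<forall>k\<ge>k1. osc_le \<epsilon> k" using osc_le_eventually[OF \<epsilon>] by blast
    let ?K = "max k0 k1"
    have "\<bar>higher_deriv extension x us - higher_deriv (P x) x us\<bar>
        \<le> extension_const * \<epsilon> * (1 / 2 ^ ?K) ^ (m - length us) * prod_list (map norm us)"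
      using extension_close[of ?K \<epsilon> x us] k1 inf0 nx us radius_ge_1 by simp
    also have "\<dots> \<le> extension_const * \<epsilon> * 1 * prod_list (map norm us)"
      using \<epsilon> extension_const_nonneg by (intro mult_right_mono mult_left_mono power_le_one) auto
    also have "\<dots> = \<epsilon> * ?c" by simp
    also have "\<dots> \<le> e" using e c by (simp add: \<epsilon>_def divide_simps)
    finally show "\<bar>higher_deriv extension x us - higher_deriv (P x) x us\<bar> \<le> 0 + e" by simp
  qed
  then show ?thesis by simp
qed

text \<open>The scale \<open>K\<close> is chosen to be the finest for which \<open>extension_close\<close> applies; then \<open>2^-K\<close> is comparable with
the distance from \<open>C\<close>.\<close>

lemma extension_near:
  assumes "0 < \<epsilon>"
  shows "\<exists>r>0. \<forall>x. 0 < infdist x C \<and> infdist x C < r \<longrightarrow> (\<forall>us. length us \<le> q \<longrightarrow>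
    \<bar>higher_deriv extension x us - higher_deriv (P (near x)) x us\<bar>
      \<le> \<epsilon> * infdist x C ^ (m - length us) * prod_list (map norm us))"
proof -
  define e where "e = \<epsilon> / (extension_const * 2 ^ m + 1)"
  have e: "0 < e" using assms extension_const_nonneg by (simp add: e_def add_nonneg_pos)
  have e2: "extension_const * e * 2 ^ m \<le> \<epsilon>" using assms extension_const_nonneg by (simp add: e_def divide_simps add_nonneg_pos)
  obtain k1 where k1: "\<forall>k\<ge>k1. osc_le e k" using osc_le_eventually[OF e] by blast
  define K0 where "K0 = max k0 k1"
  have "\<bar>higher_deriv extension x us - higher_deriv (P (near x)) x us\<bar>
      \<le> \<epsilon> * infdist x C ^ (m - length us) * prod_list (map norm us)"
    if x: "0 < infdist x C" "infdist x C < 3 * radius / 2 ^ (K0 + 1)" and us: "length us \<le> q" for x us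
  proof -
    let ?d = "infdist x C"
    let ?Pr = "\<lambda>j. 3 * radius / 2 ^ j \<le> ?d"
    \<comment> \<open>Let \<open>j\<close> be the first dyadic scale that does not exceed the distance; then \<open>K = j - 2\<close> works.\<close>
    define j where "j = (LEAST j. ?Pr j)"
    have ex: "\<exists>j. ?Pr j"
    proof -
      obtain j where "3 * radius / ?d < 2 ^ j" using real_arch_pow[of 2] by auto
      then show ?thesis using x(1) by (intro exI[of _ j]) (simp add: field_simps)
    qed
    have j: "?Pr j" unfolding j_def by (rule LeastI_ex[OF ex])
    have jK: "K0 + 1 < j"
    proof (rule ccontr)
      assume "\<not> K0 + 1 < j"
      then have "2 ^ j \<le> (2::real) ^ (K0 + 1)" by (intro power_increasing) auto
      then have "3 * radius / 2 ^ (K0 + 1) \<le> 3 * radius / 2 ^ j" using radius_ge_1 by (intro divide_left_mono) auto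
      then show False using j x(2) by simp
    qed
    define K where "K = j - 2"
    have K: "K0 \<le> K" "j = K + 2" using jK by (auto simp: K_def)
    have "\<not> ?Pr (K + 1)" using not_less_Least[of "K + 1" ?Pr] K by (simp add: j_def[symmetric])
    then have "?d < 3 * radius / 2 ^ (K + 1)" by simp
    then have "\<bar>higher_deriv extension x us - higher_deriv (P (near x)) x us\<bar>
      \<le> extension_const * e * (1 / 2 ^ K) ^ (m - length us) * prod_list (map norm us)"
      using K k1 us by (intro extension_close) (auto simp: K0_def)
    also have "\<dots> \<le> extension_const * e * (2 ^ m * ?d ^ (m - length us)) * prod_list (map norm us)"
    proof (intro mult_right_mono mult_left_mono)
      have "3 * radius / 2 ^ (K + 2) \<le> ?d" using j K by simp
      then have "3 * radius * (1 / 2 ^ K) \<le> 4 * ?d" by (simp add: field_simps)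
      moreover have "3 * 1 * (1 / 2 ^ K) \<le> 3 * radius * (1 / 2 ^ K)"
        using radius_ge_1 by (intro mult_right_mono mult_left_mono) auto
      ultimately have "1 / 2 ^ K \<le> 2 * ?d" using x(1) by simp
      then have "(1 / 2 ^ K) ^ (m - length us) \<le> (2 * ?d) ^ (m - length us)" by (intro power_mono) auto
      also have "\<dots> = 2 ^ (m - length us) * ?d ^ (m - length us)" by (rule power_mult_distrib)
      also have "\<dots> \<le> 2 ^ m * ?d ^ (m - length us)"
        using x(1) by (intro mult_right_mono power_increasing) auto
      finally show "(1 / 2 ^ K) ^ (m - length us) \<le> 2 ^ m * ?d ^ (m - length us)" .
    qed (use extension_const_nonneg e in auto)
    also have "\<dots> = (extension_const * e * 2 ^ m) * (?d ^ (m - length us) * prod_list (map norm us))" by (simp add: mult_ac)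
    also have "\<dots> \<le> \<epsilon> * (?d ^ (m - length us) * prod_list (map norm us))"
      using x(1) by (intro mult_right_mono e2) auto
    finally show ?thesis by (simp add: mult_ac)
  qed
  then show ?thesis using radius_ge_1 by (intro exI[of _ "3 * radius / 2 ^ (K0 + 1)"]) auto
qed

text \<open>The extension vanishes far from \<open>C\<close>, and its base function \<open>approx k0\<close> is a finite sum of bumps times
polynomials. The bound makes the Hessian defect finite at points that are not close to \<open>C\<close>.\<close>

lemma extension_bounded_jets:
  "\<exists>B\<ge>0. \<forall>x us. length us \<le> q \<longrightarrow> \<bar>higher_deriv extension x us\<bar> \<le> B * prod_list (map norm us)"
proof -
  let ?S = "{x. infdist x C \<le> 5 * radius / 2 ^ k0}"
  have "bounded ?S"
  proof -
    obtain R where R: "\<And>y. y \<in> C \<Longrightarrow> norm y \<le> R"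
      using compact_imp_bounded[OF compact] by (auto simp: bounded_iff)
    have "norm x \<le> R + 5 * radius / 2 ^ k0" if "x \<in> ?S" for x
      using that R[OF near_in[of x]] norm_triangle_sub[of x "near x"] by (simp add: infdist_near dist_norm)
    then show ?thesis by (auto simp: bounded_iff)
  qed
  then have "bounded_jets_on q ?S (approx k0)"
  proof -
    have bump: "bounded_jets_on q ?S (lattice_bump q (2 ^ k0) i)" for i
    proof -
      have "jet_bound q x (2 ^ CARD('n) * (max 1 (2 * real CARD('n) * 2 ^ k0)) ^ q) 1 (lattice_bump q (2 ^ k0) i)" for x
        by (intro jet_bound_rescale jet_bound_mono[OF jet_bound_lattice_bump]) auto
      then show ?thesis unfolding bounded_jets_on_def
        by (intro exI[of _ "2 ^ CARD('n) * (max 1 (2 * real CARD('n) * 2 ^ k0)) ^ q"]) auto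
    qed
    show ?thesis unfolding approx_def[abs_def]
      using \<open>bounded ?S\<close>
      by (intro bounded_jets_on_sum bounded_jets_on_mult bump bounded_jets_on_poly[OF poly[OF near_in]])
  qed
  then obtain A where A: "0 \<le> A" "\<And>x. x \<in> ?S \<Longrightarrow> jet_bound q x A 1 (approx k0)"
    by (auto simp: bounded_jets_on_def)
  have approx: "jet_bound q x A 1 (approx k0)" for x
  proof (cases "x \<in> ?S")
    case False
    let ?U = "{z. infdist z C > 5 * radius / 2 ^ k0}"
    show ?thesis
    proof (rule jet_bound_cong_open[of ?U])
      show "open ?U" by (intro open_Collect_less continuous_intros)
      show "approx k0 z = 0" if "z \<in> ?U" for z using approx_eq_0[of k0 z] that by simp
      show "jet_bound q x A 1 (\<lambda>z. 0)" using A by (intro jet_bound_zero) auto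
    qed (use False C_k_approx in auto)
  qed (rule A)
  let ?c = "increment_amp * increment_freq ^ q"
  have c: "0 \<le> ?c" using constants1 by simp
  have "\<bar>higher_deriv extension x us\<bar> \<le> (A + 2 * ?c) * prod_list (map norm us)" if us: "length us \<le> q" for x us
  proof -
    have gs: "summable (\<lambda>k. (?c * prod_list (map norm us)) * (1 / 2) ^ k)"
      by (intro summable_mult summable_geometric) simp
    have "\<bar>higher_deriv (increment (k0 + k)) x us\<bar> \<le> (?c * prod_list (map norm us)) * (1 / 2) ^ k" for k
      using jet_boundD[OF jet_bound_increment_summable[of x k] us] by (simp add: mult_ac)
    then have "\<bar>higher_deriv extension x us - higher_deriv (approx k0) x us\<bar> \<le> (\<Sum>k. (?c * prod_list (map norm us)) * (1 / 2) ^ k)"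
      using norm_suminf_le[OF _ gs, of "\<lambda>k. higher_deriv (increment (k0 + k)) x us"] higher_deriv_extension[OF us, of x]
      by (simp add: sums_iff)
    also have "\<dots> = 2 * ?c * prod_list (map norm us)"
      by (subst suminf_mult) (auto simp: suminf_geometric mult_ac)
    finally show ?thesis
      using jet_boundD[OF approx us, of x] by (simp add: algebra_simps)
  qed
  then show ?thesis using A(1) c by (intro exI[of _ "A + 2 * ?c"]) auto
qed

end

section \<open>Moduli and their iterated integrals\<close>

text \<open>A quantity \<open>h\<close> that is bounded and tends to 0 as \<open>d\<close> does is dominated by a continuous increasing function
of \<open>d\<close>. If \<open>h \<le> 2^-j\<close> as soon as \<open>d < r j\<close>, take a weighted sum of ramps that reach their full height at
\<open>r j\<close>: when \<open>h\<close> exceeds \<open>2^-j\<close>, the \<open>j\<close>-th ramp is already at its full height.\<close>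

lemma dominating_modulus:
  fixes d h :: "'x \<Rightarrow> real"
  assumes pos: "\<And>x. x \<in> S \<Longrightarrow> 0 < d x" and B: "\<And>x. x \<in> S \<Longrightarrow> h x \<le> B"
    and small: "\<And>\<epsilon>. 0 < \<epsilon> \<Longrightarrow> \<exists>r>0. \<forall>x\<in>S. d x < r \<longrightarrow> h x \<le> \<epsilon>"
  obtains \<Omega> :: "real \<Rightarrow> real" where "continuous_on UNIV \<Omega>" "mono \<Omega>" "\<And>t. t \<le> 0 \<Longrightarrow> \<Omega> t = 0"
    "\<And>x. x \<in> S \<Longrightarrow> h x \<le> \<Omega> (d x)"
proof -
  have "\<forall>j::nat. \<exists>r>0. \<forall>x\<in>S. d x < r \<longrightarrow> h x \<le> (1 / 2) ^ j" using small by simp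
  then obtain r where r: "\<And>j::nat. 0 < r j" "\<And>j x. x \<in> S \<Longrightarrow> d x < r j \<Longrightarrow> h x \<le> (1 / 2) ^ j"
    by metis
  define c where "c = max 2 B"
  define g where "g = (\<lambda>j t. c * (1 / 2) ^ j * min 1 (max 0 (t / r j)))"
  define \<Omega> where "\<Omega> = (\<lambda>t. \<Sum>j. g j t)"
  have c: "2 \<le> c" "B \<le> c" by (auto simp: c_def)
  have g0: "0 \<le> g j t" for j t using c by (simp add: g_def)
  have gb: "norm (g j t) \<le> c * (1 / 2) ^ j" for j t
  proof -
    have "c * (1 / 2) ^ j * min 1 (max 0 (t / r j)) \<le> c * (1 / 2) ^ j * 1"
      using c by (intro mult_left_mono) auto
    then show ?thesis using g0[of j t] by (simp add: g_def)
  qed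
  have sc: "summable (\<lambda>j. c * (1 / 2) ^ j)" by (intro summable_mult summable_geometric) simp
  have sg: "summable (\<lambda>j. g j t)" for t by (rule summable_comparison_test'[OF sc gb])
  show ?thesis
  proof
    have "uniform_limit UNIV (\<lambda>n t. \<Sum>j<n. g j t) \<Omega> sequentially"
      unfolding \<Omega>_def by (rule Weierstrass_m_test[OF gb sc])
    then show "continuous_on UNIV \<Omega>"
    proof (rule uniform_limit_theorem[rotated])
      have "continuous_on UNIV (\<lambda>t. \<Sum>j<n. g j t)" for n
        unfolding g_def using r(1) by (intro continuous_intros) (auto simp: less_imp_neq[symmetric])
      then show "\<forall>\<^sub>F n in sequentially. continuous_on UNIV (\<lambda>t. \<Sum>j<n. g j t)" by simp
    qed simp
    show "mono \<Omega>"
    proof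
      fix s t :: real assume "s \<le> t"
      have "g j s \<le> g j t" for j
      proof -
        have "s / r j \<le> t / r j" using \<open>s \<le> t\<close> r(1)[of j] by (intro divide_right_mono) auto
        then show ?thesis unfolding g_def using c by (intro mult_left_mono) auto
      qed
      then show "\<Omega> s \<le> \<Omega> t" unfolding \<Omega>_def by (intro suminf_le sg)
    qed
    show "\<Omega> t = 0" if "t \<le> 0" for t
    proof -
      have "g j t = 0" for j
        using divide_nonpos_pos[OF that r(1)[of j]] by (simp add: g_def max_absorb1)
      then show ?thesis by (simp add: \<Omega>_def)
    qed
    fix x assume x: "x \<in> S"
    show "h x \<le> \<Omega> (d x)"
    proof (cases "h x \<le> 0")
      case True
      have "0 \<le> \<Omega> (d x)" unfolding \<Omega>_def by (intro suminf_nonneg sg g0)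
      then show ?thesis using True by simp
    next
      case False
      then obtain j' where "(1 / 2) ^ j' < h x" using real_arch_pow_inv[of "h x" "1/2"] by auto
      define j where "j = (LEAST j. (1 / 2) ^ j < h x)"
      have j: "(1 / 2) ^ j < h x" unfolding j_def by (rule LeastI[of _ j']) fact
      have hj: "h x \<le> c * (1 / 2) ^ j"
      proof (cases j)
        case 0
        then show ?thesis using B[OF x] c by simp
      next
        case (Suc i)
        then have "\<not> (1 / 2) ^ i < h x" using not_less_Least[of i "\<lambda>j. (1 / 2) ^ j < h x"] by (simp add: j_def[symmetric])
        then have "h x \<le> 2 * (1 / 2) ^ j" using Suc by simp
        also have "\<dots> \<le> c * (1 / 2) ^ j" using c by (intro mult_right_mono) auto
        finally show ?thesis .
      qed
      have "r j \<le> d x" using r(2)[OF x, of j] j by force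
      then have "1 \<le> d x / r j" using r(1)[of j] by simp
      then have "g j (d x) = c * (1 / 2) ^ j" by (simp add: g_def)
      then have "c * (1 / 2) ^ j = (\<Sum>i\<in>{j}. g i (d x))" by simp
      also have "\<dots> \<le> \<Omega> (d x)" unfolding \<Omega>_def by (intro sum_le_suminf sg) (auto intro: g0)
      finally show ?thesis using hj by simp
    qed
  qed
qed

primrec iter_integral :: "(real \<Rightarrow> real) \<Rightarrow> nat \<Rightarrow> real \<Rightarrow> real" where
  "iter_integral \<Omega> 0 = \<Omega>"
| "iter_integral \<Omega> (Suc k) = (\<lambda>t. antideriv (iter_integral \<Omega> k) t - antideriv (iter_integral \<Omega> k) 0)"

text \<open>Continuity at 0 makes the \<open>k\<close>-th iterated integral a function of class \<open>C^k\<close> on the whole line, although it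
vanishes on the negative half.\<close>

locale modulus =
  fixes \<Omega> :: "real \<Rightarrow> real"
  assumes cont: "continuous_on UNIV \<Omega>" and mono: "mono \<Omega>" and zero: "\<And>t. t \<le> 0 \<Longrightarrow> \<Omega> t = 0"
begin

abbreviation I :: "nat \<Rightarrow> real \<Rightarrow> real" where "I \<equiv> iter_integral \<Omega>"

lemma continuous_I: "continuous_on UNIV (I k)"
  and DERIV_I: "(I (Suc k) has_real_derivative I k t) (at t)"
proof -
  have step: "(I (Suc k) has_real_derivative I k t) (at t)" if "continuous_on UNIV (I k)" for k t
    using DERIV_diff[OF DERIV_antideriv[OF that, of t] DERIV_const, of "antideriv (I k) 0"] by simp
  show c: "continuous_on UNIV (I k)" for k
  proof (induction k)
    case (Suc k)
    then show ?case
      using step DERIV_isCont by (metis continuous_at_imp_continuous_on)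
  qed (use cont in simp)
  show "(I (Suc k) has_real_derivative I k t) (at t)" by (rule step[OF c])
qed

lemma I_mvt: "a < b \<Longrightarrow> \<exists>z. a < z \<and> z < b \<and> I (Suc k) b - I (Suc k) a = (b - a) * I k z"
  using antideriv_mvt[OF continuous_I[of k], of a b] by simp

lemma I_0 [simp]: "I (Suc k) 0 = 0" by simp

lemma I_eq_0: "t \<le> 0 \<Longrightarrow> I k t = 0"
proof (induction k arbitrary: t)
  case (Suc k)
  show ?case
  proof (cases "t < 0")
    case True
    obtain z where "z < 0" "I (Suc k) 0 - I (Suc k) t = (0 - t) * I k z"
      using I_mvt[OF True] by blast
    then show ?thesis using Suc.IH[of z] I_0[of k] by simp
  qed (use Suc.prems I_0 in simp)
qed (use zero in simp)

lemma mono_I: "mono (I k)"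
proof (induction k)
  case (Suc k)
  have "0 \<le> I k z" for z
    using monoD[OF Suc, of "min 0 z" z] I_eq_0[of "min 0 z" k] by simp
  show ?case
  proof
    fix s t :: real assume "s \<le> t"
    show "I (Suc k) s \<le> I (Suc k) t"
    proof (cases "s < t")
      case True
      obtain z where "I (Suc k) t - I (Suc k) s = (t - s) * I k z" using I_mvt[OF True] by blast
      moreover have "0 \<le> (t - s) * I k z" using True \<open>0 \<le> I k z\<close> by simp
      ultimately show ?thesis by linarith
    qed (use \<open>s \<le> t\<close> in simp)
  qed
qed (use mono in simp)

lemma I_nonneg: "0 \<le> I k t"
  using monoD[OF mono_I, of "min 0 t" t k] I_eq_0[of "min 0 t" k] by simp

text \<open>Integrating over the right half of \<open>[0, t]\<close> only, where the integrand is at least its value at \<open>t/2\<close>, loses a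
constant factor and a dilation of \<open>\<Omega>\<close>.\<close>

lemma I_lower:
  assumes "0 \<le> t"
  shows "(\<Prod>j<k. 1 / 2 ^ Suc j) * t ^ k * \<Omega> (t / 2 ^ k) \<le> I k t"
  using assms
proof (induction k arbitrary: t)
  case (Suc k)
  show ?case
  proof (cases "t = 0")
    case True
    then show ?thesis using I_0 by simp
  next
    case False
    then have "t / 2 < t" using Suc.prems by simp
    then obtain z where z: "t / 2 < z" "I (Suc k) t - I (Suc k) (t / 2) = (t - t / 2) * I k z"
      using I_mvt by blast
    have "(\<Prod>j<Suc k. 1 / 2 ^ Suc j) * t ^ Suc k * \<Omega> (t / 2 ^ Suc k)
        = t / 2 * ((\<Prod>j<k. 1 / 2 ^ Suc j) * (t / 2) ^ k * \<Omega> (t / 2 / 2 ^ k))"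
      by (simp add: power_divide)
    also have "\<dots> \<le> t / 2 * I k (t / 2)"
      using Suc.IH[of "t / 2"] Suc.prems by (intro mult_left_mono) auto
    also have "\<dots> \<le> t / 2 * I k z" using z(1) Suc.prems by (intro mult_left_mono monoD[OF mono_I]) auto
    also have "\<dots> = I (Suc k) t - I (Suc k) (t / 2)" using z(2) by simp
    also have "\<dots> \<le> I (Suc k) t" using I_nonneg[of "Suc k" "t / 2"] by linarith
    finally show ?thesis .
  qed
qed simp

end

section \<open>A convex function with prescribed convexity outside a convex set\<close>

definition support_fun :: "'a::euclidean_space set \<Rightarrow> 'a \<Rightarrow> real" where
  "support_fun C w = (SUP c\<in>C. c \<bullet> w)"

lemma support_fun_upper:
  assumes "bounded C" "c \<in> C"
  shows "c \<bullet> w \<le> support_fun C w"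
proof -
  obtain R where R: "\<And>c. c \<in> C \<Longrightarrow> norm c \<le> R" using assms(1) by (auto simp: bounded_iff)
  have "bdd_above ((\<lambda>c. c \<bullet> w) ` C)"
  proof (rule bdd_aboveI2)
    fix c assume "c \<in> C"
    then show "c \<bullet> w \<le> R * norm w"
      using norm_cauchy_schwarz[of c w] mult_right_mono[OF R, of c "norm w"] by simp
  qed
  then show ?thesis unfolding support_fun_def using assms(2) by (intro cSUP_upper)
qed

lemma support_fun_least:
  assumes "C \<noteq> {}" "\<And>c. c \<in> C \<Longrightarrow> c \<bullet> w \<le> b"
  shows "support_fun C w \<le> b"
  unfolding support_fun_def using assms by (rule cSUP_least)

lemma continuous_support_fun:
  assumes "bounded C" "C \<noteq> {}"
  shows "continuous_on UNIV (support_fun C)"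
proof -
  obtain R where R: "\<And>c. c \<in> C \<Longrightarrow> norm c \<le> R" "R > 0"
    using assms(1) by (auto simp: bounded_pos)
  have le: "support_fun C w \<le> support_fun C w' + R * norm (w - w')" for w w'
  proof (rule support_fun_least[OF assms(2)])
    fix c assume c: "c \<in> C"
    have "c \<bullet> w = c \<bullet> w' + c \<bullet> (w - w')" by (simp add: inner_diff_right)
    also have "c \<bullet> (w - w') \<le> R * norm (w - w')"
      using norm_cauchy_schwarz[of c "w - w'"] mult_right_mono[OF R(1)[OF c], of "norm (w - w')"] by simp
    finally show "c \<bullet> w \<le> support_fun C w' + R * norm (w - w')"
      using support_fun_upper[OF assms(1) c, of w'] by simp
  qed
  have "R-lipschitz_on UNIV (support_fun C)"
  proof (rule lipschitz_onI)
    fix w w'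
    show "dist (support_fun C w) (support_fun C w') \<le> R * dist w w'"
      using le[of w w'] le[of w' w] by (simp add: dist_real_def dist_norm norm_minus_commute abs_le_iff)
  qed (use R in simp)
  then show ?thesis by (rule lipschitz_on_continuous_on)
qed

locale convex_correction = modulus +
  fixes C :: "'a::euclidean_space set"
  assumes compact: "compact C" and convex: "convex C" and nonempty: "C \<noteq> {}"
begin

text \<open>With \<open>a = 1\<close> this is the superposition of the ridge functions \<open>x \<mapsto> I k (x \<bullet> w - h w)\<close>, each of which is
convex for \<open>k \<ge> 2\<close> and vanishes on \<open>C\<close>. The weight \<open>a\<close> collects the factors \<open>u \<bullet> w\<close> that differentiation in
direction \<open>u\<close> produces, so that the family is closed under differentiation.\<close>

definition Phi :: "nat \<Rightarrow> ('a \<Rightarrow> real) \<Rightarrow> 'a \<Rightarrow> real" where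
  "Phi k a x = integral (cbox (- One) One) (\<lambda>w. I k (x \<bullet> w - support_fun C w) * a w)"

lemma continuous_h: "continuous_on S (support_fun C)"
  using continuous_support_fun[OF compact_imp_bounded[OF compact] nonempty] continuous_on_subset by blast

lemma continuous_integrand:
  assumes "continuous_on UNIV a"
  shows "continuous_on S (\<lambda>(x, w). I k (x \<bullet> w - support_fun C w) * a w)"
  unfolding case_prod_beta
  by (intro continuous_intros continuous_on_compose2[OF continuous_I, of S "\<lambda>z. fst z \<bullet> snd z - support_fun C (snd z)" for S]
      continuous_on_compose2[OF continuous_h[of UNIV]] continuous_on_compose2[OF assms]) auto

lemma continuous_integrand1:
  assumes "continuous_on UNIV a"
  shows "continuous_on S (\<lambda>w. I k (x \<bullet> w - support_fun C w) * a w)"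
  by (intro continuous_intros continuous_on_compose2[OF continuous_I] continuous_h
      continuous_on_subset[OF assms]) auto

lemma has_derivative_Phi:
  assumes a: "continuous_on UNIV a"
  shows "(Phi (Suc k) a has_derivative (\<lambda>u. Phi k (\<lambda>w. a w * (u \<bullet> w)) x)) (at x)"
proof -
  let ?Q = "cbox (- One) One :: 'a set"
  define fx where "fx = (\<lambda>x w. (I k (x \<bullet> w - support_fun C w) * a w) *\<^sub>R blinfun_inner_right w)"
  have "((\<lambda>x. integral ?Q (\<lambda>w. I (Suc k) (x \<bullet> w - support_fun C w) * a w)) has_derivative
      blinfun_apply (integral ?Q (fx x))) (at x within UNIV)"
  proof (rule leibniz_rule)
    show "((\<lambda>x. I (Suc k) (x \<bullet> w - support_fun C w) * a w) has_derivative blinfun_apply (fx x w)) (at x within UNIV)"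
      for x w
    proof -
      have "((\<lambda>x. x \<bullet> w - support_fun C w) has_derivative (\<lambda>u. u \<bullet> w)) (at x)"
        by (auto intro!: derivative_eq_intros)
      from has_derivative_compose[OF this DERIV_I[of k "x \<bullet> w - support_fun C w", unfolded has_field_derivative_def]]
      have "((\<lambda>x. I (Suc k) (x \<bullet> w - support_fun C w) * a w) has_derivative
          (\<lambda>u. I k (x \<bullet> w - support_fun C w) * (u \<bullet> w) * a w)) (at x)"
        by (rule has_derivative_mult_left)
      moreover have "blinfun_apply (fx x w) = (\<lambda>u. I k (x \<bullet> w - support_fun C w) * (u \<bullet> w) * a w)"
        by (auto simp: fx_def blinfun.scaleR_left inner_commute)
      ultimately show ?thesis by simp
    qed
    show "(\<lambda>w. I (Suc k) (x \<bullet> w - support_fun C w) * a w) integrable_on ?Q" for x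
      by (intro integrable_continuous continuous_integrand1 a)
    show "continuous_on (UNIV \<times> ?Q) (\<lambda>(x, w). fx x w)"
    proof -
      have "continuous_on (UNIV \<times> ?Q) (\<lambda>z. (\<lambda>(x, w). I k (x \<bullet> w - support_fun C w) * a w) z *\<^sub>R blinfun_inner_right (snd z))"
        by (intro continuous_on_scaleR continuous_integrand a
            bounded_linear.continuous_on[OF bounded_linear_blinfun_inner_right] continuous_intros)
      then show ?thesis by (simp add: fx_def case_prod_beta)
    qed
  qed auto
  moreover have "blinfun_apply (integral ?Q (fx x)) = (\<lambda>u. Phi k (\<lambda>w. a w * (u \<bullet> w)) x)"
  proof (rule ext)
    fix u
    have "continuous_on ?Q (fx x)" unfolding fx_def
      by (intro continuous_on_scaleR continuous_integrand1 a
            bounded_linear.continuous_on[OF bounded_linear_blinfun_inner_right] continuous_intros)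
    then have "integral ?Q ((\<lambda>B. blinfun_apply B u) \<circ> fx x) = blinfun_apply (integral ?Q (fx x)) u"
      by (intro integral_linear integrable_continuous blinfun.bounded_linear_left)
    then show "blinfun_apply (integral ?Q (fx x)) u = Phi k (\<lambda>w. a w * (u \<bullet> w)) x"
      by (simp add: Phi_def fx_def o_def blinfun.scaleR_left inner_commute mult.assoc)
  qed
  ultimately show ?thesis by (simp add: Phi_def[abs_def] del: iter_integral.simps)
qed

lemma dir_deriv_Phi:
  "continuous_on UNIV a \<Longrightarrow> dir_deriv u (Phi (Suc k) a) = Phi k (\<lambda>w. a w * (u \<bullet> w))"
  by (rule ext) (rule dir_derivI[OF has_derivative_Phi])

lemma C_k_Phi: "continuous_on UNIV a \<Longrightarrow> C_k k (Phi k a)"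
proof (induction k arbitrary: a)
  case 0
  have "continuous_on UNIV (\<lambda>x. integral (cbox (- One) One) (\<lambda>w. I 0 (x \<bullet> w - support_fun C w) * a w))"
    by (rule integral_continuous_on_param[OF continuous_integrand[OF 0]])
  then show ?case by (simp add: Phi_def[abs_def])
next
  case (Suc k)
  have "continuous_on UNIV (\<lambda>w. a w * (u \<bullet> w))" for u :: 'a
    using Suc.prems by (intro continuous_intros)
  then show ?case unfolding C_k_Suc_iff
    using has_derivative_Phi[OF Suc.prems] Suc.IH by (auto simp: dir_deriv_Phi[OF Suc.prems] differentiable_def)
qed

lemma higher_deriv_Phi:
  assumes "continuous_on UNIV a" "length us \<le> k"
  shows "higher_deriv (Phi k a) x us = Phi (k - length us) (\<lambda>w. a w * prod_list (map (\<lambda>u. u \<bullet> w) us)) x"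
  using assms
proof (induction us arbitrary: k a rule: rev_induct)
  case (snoc u us)
  then obtain k' where k: "k = Suc k'" by (cases k) auto
  have "continuous_on UNIV (\<lambda>w. a w * (u \<bullet> w))" using snoc.prems by (intro continuous_intros)
  then have "higher_deriv (Phi k' (\<lambda>w. a w * (u \<bullet> w))) x us
      = Phi (k' - length us) (\<lambda>w. a w * (u \<bullet> w) * prod_list (map (\<lambda>u. u \<bullet> w) us)) x"
    using snoc.prems k by (intro snoc.IH) auto
  then show ?case unfolding k higher_deriv_snoc dir_deriv_Phi[OF snoc.prems(1)]
    by (simp add: mult_ac)
qed simp

lemma Phi_eq_0:
  assumes "x \<in> C"
  shows "Phi k a x = 0"
proof -
  have "I k (x \<bullet> w - support_fun C w) = 0" for w
    using support_fun_upper[OF compact_imp_bounded[OF compact] assms, of w] by (intro I_eq_0) simp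
  then show ?thesis by (simp add: Phi_def)
qed

lemma higher_deriv_Phi_eq_0:
  "continuous_on UNIV a \<Longrightarrow> length us \<le> k \<Longrightarrow> x \<in> C \<Longrightarrow> higher_deriv (Phi k a) x us = 0"
  by (simp add: higher_deriv_Phi Phi_eq_0)

text \<open>The point \<open>y\<close> nearest to \<open>x\<close> maximises the linear form \<open>e\<close> on \<open>C\<close>, so for \<open>w = s e\<close> the hyperplane separates \<open>x\<close>
from \<open>C\<close> with gap \<open>s d \<ge> d/2\<close>. A perturbation of \<open>w\<close> by \<open>\<rho>\<close> changes the gap by at most
\<open>(D + d) \<rho>\<close>.\<close>

lemma support_gap:
  assumes D: "\<And>c c'. c \<in> C \<Longrightarrow> c' \<in> C \<Longrightarrow> norm (c - c') \<le> D"
    and y: "y = closest_point C x" and e: "x - y = d *\<^sub>R e" "norm e = 1" "0 < d"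
    and w: "norm (w - s *\<^sub>R e) \<le> \<rho>" "1 / 2 \<le> s" "(D + d) * \<rho> \<le> d / 4"
  shows "d / 4 \<le> x \<bullet> w - support_fun C w"
proof -
  define z where "z = w - s *\<^sub>R e"
  have yC: "y \<in> C" unfolding y by (rule closest_point_in_set[OF compact_imp_closed[OF compact] nonempty])
  have "support_fun C w \<le> x \<bullet> w - d / 4"
  proof (rule support_fun_least[OF nonempty])
    fix c assume c: "c \<in> C"
    have "(x - y) \<bullet> (c - y) \<le> 0"
      unfolding y by (rule closest_point_dot[OF convex compact_imp_closed[OF compact] c])
    then have "d * (e \<bullet> (c - y)) \<le> 0" by (simp add: e)
    then have ey: "e \<bullet> (c - y) \<le> 0" using e(3) by (simp add: mult_le_0_iff)
    have "c \<bullet> w - x \<bullet> w = (c - y) \<bullet> w - (x - y) \<bullet> w" by (simp add: inner_diff_left)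
    also have "\<dots> = s * (e \<bullet> (c - y)) + (c - y) \<bullet> z - d * s - d * (e \<bullet> z)"
      using e(2) by (simp add: e(1) z_def inner_diff_left inner_diff_right inner_commute algebra_simps
          power2_norm_eq_inner[symmetric])
    also have "\<dots> \<le> 0 + D * \<rho> - d / 2 + d * \<rho>"
    proof -
      have "s * (e \<bullet> (c - y)) \<le> 0" using ey w(2) by (intro mult_nonneg_nonpos) auto
      moreover have "(c - y) \<bullet> z \<le> D * \<rho>"
        using norm_cauchy_schwarz[of "c - y" z] mult_mono[OF D[OF c yC] w(1)] D[OF c yC] order_trans[OF norm_ge_zero D[OF c yC]]
        by (simp add: z_def)
      moreover have "d * (1 / 2) \<le> d * s" using w(2) e(3) by (intro mult_left_mono) auto
      moreover have "- (e \<bullet> z) \<le> \<rho>"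
        using norm_cauchy_schwarz[of "- e" z] w(1) e(2) by (simp add: z_def)
      then have "d * (- (e \<bullet> z)) \<le> d * \<rho>" using e(3) by (intro mult_left_mono) auto
      ultimately show ?thesis by simp
    qed
    also have "\<dots> \<le> - (d / 4)" using w(3) by (simp add: algebra_simps)
    finally show "c \<bullet> w \<le> x \<bullet> w - d / 4" by simp
  qed
  then show ?thesis by simp
qed

text \<open>Instead of the tube itself the proof uses a chain of about \<open>1/\<rho>\<close> disjoint balls of radius \<open>\<rho>/4\<close> inside it.
Shifting their centres from the axis by \<open>\<rho>/2\<close> in direction \<open>v\<close>, or \<open>- v\<close> if \<open>v\<close> points to the other
side of \<open>e\<close>, guarantees \<open>\<bar>v \<bullet> w\<bar> \<ge> \<rho>/4\<close> on all of them. The total volume is of order \<open>\<rho>^(n-1)\<close>, and the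
factor \<open>(v \<bullet> w)^2\<close> contributes \<open>\<rho>^2\<close>.\<close>

lemma Phi_hessian_lower:
  assumes D: "\<And>c c'. c \<in> C \<Longrightarrow> c' \<in> C \<Longrightarrow> norm (c - c') \<le> D" "0 < D"
    and d: "d = infdist x C" "0 < d" and v: "norm v = 1" and \<rho>: "\<rho> = d / (4 * (D + d))"
  shows "I k (d / 4) * (unit_ball_vol (real DIM('a)) / 16) * (\<rho> / 4) ^ (DIM('a) + 1)
    \<le> Phi k (\<lambda>w. (v \<bullet> w)\<^sup>2) x"
proof -
  let ?Q = "cbox (- One) One :: 'a set"
  have \<rho>0: "0 < \<rho>" using D d by (simp add: \<rho>)
  have \<rho>4: "\<rho> \<le> 1 / 4" using D d by (simp add: \<rho> divide_simps)
  have Dd: "(D + d) * \<rho> \<le> d / 4"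
  proof -
    have "D + d \<noteq> 0" using D(2) d(2) by simp
    then show ?thesis
      by (simp only: \<rho> times_divide_eq_right mult.commute[of 4] nonzero_mult_divide_mult_cancel_left order_refl not_False_eq_True)
  qed
  define y where "y = closest_point C x"
  define e where "e = (1 / d) *\<^sub>R (x - y)"
  have dy: "d = norm (x - y)"
  proof -
    have "infdist x C = dist x y"
    proof (rule antisym)
      show "infdist x C \<le> dist x y" unfolding y_def
        by (rule infdist_le[OF closest_point_in_set[OF compact_imp_closed[OF compact] nonempty]])
      obtain y' where "y' \<in> C" "infdist x C = dist x y'"
        using infdist_attains_inf[OF compact_imp_closed[OF compact] nonempty] by blast
      then show "dist x y \<le> infdist x C"
        unfolding y_def using closest_point_le[OF compact_imp_closed[OF compact]] by simp
    qed
    then show ?thesis by (simp add: d dist_norm)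
  qed
  have e: "x - y = d *\<^sub>R e" "norm e = 1" using d(2) by (simp_all add: e_def dy)
  define v' where "v' = (if 0 \<le> v \<bullet> e then v else - v)"
  have v': "norm v' = 1" "0 \<le> v' \<bullet> e" "\<And>w. (v' \<bullet> w)\<^sup>2 = (v \<bullet> w)\<^sup>2"
    using v by (auto simp: v'_def)
  define N where "N = nat \<lfloor>1 / (2 * \<rho>)\<rfloor>"
  \<comment> \<open>Spacing \<open>\<rho>/2\<close> makes the balls of radius \<open>\<rho>/4\<close> disjoint; \<open>N\<close> of them fit between \<open>1/2\<close> and \<open>3/4\<close>.\<close>
  define s where "s = (\<lambda>i::nat. 1 / 2 + real i * (\<rho> / 2))"
  define B where "B = (\<lambda>i. ball (s i *\<^sub>R e + (\<rho> / 2) *\<^sub>R v') (\<rho> / 4))"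
  define S where "S = (\<Union>i<N. B i)"
  have N: "real N \<le> 1 / (2 * \<rho>)" "1 / (4 * \<rho>) \<le> real N"
  proof -
    have "1 \<le> 1 / (4 * \<rho>)" using \<rho>0 \<rho>4 by (simp add: divide_simps)
    moreover have "1 / (2 * \<rho>) = 2 * (1 / (4 * \<rho>))" by simp
    moreover have "0 \<le> \<lfloor>1 / (2 * \<rho>)\<rfloor>" using \<rho>0 by simp
    ultimately show "real N \<le> 1 / (2 * \<rho>)" "1 / (4 * \<rho>) \<le> real N" unfolding N_def by linarith+
  qed
  have s: "1 / 2 \<le> s i" "i < N \<Longrightarrow> s i \<le> 3 / 4" for i
  proof -
    show "1 / 2 \<le> s i" using \<rho>0 by (simp add: s_def)
    assume "i < N"
    then have "real i * (\<rho> / 2) \<le> 1 / (2 * \<rho>) * (\<rho> / 2)" using N(1) \<rho>0 by (intro mult_right_mono) auto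
    also have "\<dots> = 1 / 4" using \<rho>0 by simp
    finally show "s i \<le> 3 / 4" by (simp add: s_def)
  qed
  have inB: "norm (w - s i *\<^sub>R e) \<le> \<rho>" "\<rho> / 4 \<le> v' \<bullet> w" if "w \<in> B i" for w i
  proof -
    define b where "b = w - (s i *\<^sub>R e + (\<rho> / 2) *\<^sub>R v')"
    have b: "norm b \<le> \<rho> / 4" using that by (simp add: B_def b_def dist_norm norm_minus_commute)
    have w: "w - s i *\<^sub>R e = (\<rho> / 2) *\<^sub>R v' + b" by (simp add: b_def)
    show "norm (w - s i *\<^sub>R e) \<le> \<rho>"
      unfolding w using norm_triangle_ineq[of "(\<rho> / 2) *\<^sub>R v'" b] b v' \<rho>0 by simp
    have "v' \<bullet> w = s i * (v' \<bullet> e) + \<rho> / 2 + v' \<bullet> b"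
      using v'(1) by (simp add: b_def inner_diff_right inner_add_right power2_norm_eq_inner[symmetric])
    moreover have "0 \<le> s i * (v' \<bullet> e)" using s(1)[of i] v' by simp
    moreover have "- (v' \<bullet> b) \<le> \<rho> / 4" using norm_cauchy_schwarz[of v' "- b"] b v' by simp
    ultimately show "\<rho> / 4 \<le> v' \<bullet> w" by linarith
  qed
  have SQ: "S \<subseteq> ?Q"
  proof
    fix w assume "w \<in> S"
    then obtain i where i: "i < N" "w \<in> B i" by (auto simp: S_def)
    have "norm w \<le> norm (w - s i *\<^sub>R e) + norm (s i *\<^sub>R e)"
      using norm_triangle_ineq[of "w - s i *\<^sub>R e" "s i *\<^sub>R e"] by simp
    also have "\<dots> \<le> 1 / 4 + 3 / 4" using inB(1)[OF i(2)] s[of i] i(1) e \<rho>4 by simp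
    finally have "norm w \<le> 1" by simp
    then have "\<bar>w \<bullet> b\<bar> \<le> 1" if "b \<in> Basis" for b using Basis_le_norm[OF that, of w] by linarith
    then show "w \<in> ?Q" by (simp add: mem_box abs_le_iff minus_le_iff)
  qed
  have disj: "pairwise (\<lambda>i j. disjnt (B i) (B j)) {..<N}"
  proof (rule pairwiseI)
    fix i j :: nat assume "i \<noteq> j"
    show "disjnt (B i) (B j)" unfolding B_def disjnt_def
    proof (rule disjoint_ballI)
      have "1 * (\<rho> / 2) \<le> \<bar>real i - real j\<bar> * (\<rho> / 2)"
        using \<open>i \<noteq> j\<close> \<rho>0 by (intro mult_right_mono) auto
      also have "\<dots> = norm ((s i - s j) *\<^sub>R e)"
      proof -
        have sd: "s i - s j = (real i - real j) * (\<rho> / 2)" by (simp add: s_def algebra_simps)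
        show ?thesis unfolding norm_scaleR e(2) sd using \<rho>0 by (simp add: abs_mult)
      qed
      finally show "\<rho> / 4 + \<rho> / 4 \<le> dist (s i *\<^sub>R e + (\<rho> / 2) *\<^sub>R v') (s j *\<^sub>R e + (\<rho> / 2) *\<^sub>R v')"
        by (simp add: dist_norm algebra_simps)
    qed
  qed
  have meas: "measure lebesgue (B i) = unit_ball_vol (real DIM('a)) * (\<rho> / 4) ^ DIM('a)" for i
    unfolding B_def using \<rho>0 by (simp add: content_ball)
  have SL: "S \<in> lmeasurable" unfolding S_def B_def by (intro fmeasurable.finite_UN) auto
  have "measure lebesgue S = (\<Sum>i<N. measure lebesgue (B i))"
    unfolding S_def by (rule measure_UNION'[OF _ _ disj]) (auto simp: B_def)
  then have mS: "measure lebesgue S = real N * (unit_ball_vol (real DIM('a)) * (\<rho> / 4) ^ DIM('a))"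
    by (simp add: meas)
  define c where "c = I k (d / 4) * (\<rho> / 4)\<^sup>2"
  have c: "0 \<le> c" using I_nonneg by (simp add: c_def)
  let ?F = "\<lambda>w. I k (x \<bullet> w - support_fun C w) * (v \<bullet> w)\<^sup>2"
  have ge: "(if w \<in> S then c else 0) \<le> ?F w" for w
  proof (cases "w \<in> S")
    case True
    then obtain i where i: "w \<in> B i" by (auto simp: S_def)
    have "d / 4 \<le> x \<bullet> w - support_fun C w"
      by (rule support_gap[OF D(1) y_def e d(2) inB(1)[OF i] s(1) Dd])
    then have "I k (d / 4) \<le> I k (x \<bullet> w - support_fun C w)" by (rule monoD[OF mono_I])
    moreover have "(\<rho> / 4)\<^sup>2 \<le> (v' \<bullet> w)\<^sup>2" using inB(2)[OF i] \<rho>0 by (intro power_mono) auto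
    ultimately have "c \<le> ?F w" unfolding c_def v'(3) using I_nonneg by (intro mult_mono) auto
    then show ?thesis using True by simp
  next
    case False
    then show ?thesis using I_nonneg by simp
  qed
  have iS: "(\<lambda>w. if w \<in> S then c else 0) integrable_on ?Q"
    unfolding integrable_restrict_Int using SQ integrable_on_const[OF SL, of c] by (simp add: Int_absorb2)
  have iF: "?F integrable_on ?Q"
    by (intro integrable_continuous continuous_integrand1 continuous_intros)
  have "c * measure lebesgue S = integral ?Q (\<lambda>w. if w \<in> S then c else 0)"
  proof -
    have "integral ?Q (\<lambda>w. if w \<in> S then c else 0) = integral (S \<inter> ?Q) (\<lambda>w. c)"
      by (rule integral_restrict_Int)
    also have "\<dots> = integral S (\<lambda>w. c * 1)" using SQ by (simp add: Int_absorb2)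
    also have "\<dots> = c * measure lebesgue S" by (simp only: integral_mult_right lmeasure_integral[OF SL])
    finally show ?thesis by simp
  qed
  also have "\<dots> \<le> integral ?Q ?F" by (rule integral_le[OF iS iF]) (rule ge)
  finally have main: "c * measure lebesgue S \<le> Phi k (\<lambda>w. (v \<bullet> w)\<^sup>2) x" by (simp add: Phi_def)
  have "I k (d / 4) * (unit_ball_vol (real DIM('a)) / 16) * (\<rho> / 4) ^ (DIM('a) + 1)
      = c * (1 / (4 * \<rho>) * (unit_ball_vol (real DIM('a)) * (\<rho> / 4) ^ DIM('a)))"
    using \<rho>0 by (simp add: c_def power2_eq_square)
  also have "\<dots> \<le> c * measure lebesgue S"
    unfolding mS using N(2) c \<rho>0 by (intro mult_left_mono mult_right_mono) auto
  finally show ?thesis using main by simp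
qed

end

section \<open>The Hessian of the Whitney extension\<close>

lemma convex_on_of_hessian_nonneg:
  fixes F :: "'a::euclidean_space \<Rightarrow> real"
  assumes F: "C_k 2 F" and hess: "\<And>x v. norm v = 1 \<Longrightarrow> 0 \<le> higher_deriv F x [v, v]"
  shows "convex_on UNIV F"
proof (rule convex_onI)
  fix \<tau> :: real and x y :: 'a
  assume \<tau>: "0 < \<tau>" "\<tau> < 1"
  show "F ((1 - \<tau>) *\<^sub>R x + \<tau> *\<^sub>R y) \<le> (1 - \<tau>) * F x + \<tau> * F y"
  proof (cases "x = y")
    case True
    then show ?thesis by (simp add: algebra_simps)
  next
    case False
    define l where "l = norm (y - x)"
    define w where "w = (1 / l) *\<^sub>R (y - x)"
    have l: "0 < l" using False by (simp add: l_def)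
    then have w: "norm w = 1" "y = x + l *\<^sub>R w" by (simp_all add: w_def l_def)
    have "convex_on UNIV (\<lambda>t. higher_deriv F (x + t *\<^sub>R w) [])"
    proof (rule f''_ge0_imp_convex)
      show "((\<lambda>t. higher_deriv F (x + t *\<^sub>R w) []) has_real_derivative higher_deriv F (x + t *\<^sub>R w) [w]) (at t)" for t
        by (rule DERIV_higher_deriv_line[OF F]) simp
      show "((\<lambda>t. higher_deriv F (x + t *\<^sub>R w) [w]) has_real_derivative higher_deriv F (x + t *\<^sub>R w) [w, w]) (at t)" for t
        by (rule DERIV_higher_deriv_line[OF F]) simp
      show "0 \<le> higher_deriv F (x + t *\<^sub>R w) [w, w]" for t by (rule hess[OF w(1)])
    qed simp
    from convex_onD[OF this, of \<tau> 0 l]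
    have "F (x + (\<tau> * l) *\<^sub>R w) \<le> (1 - \<tau>) * F x + \<tau> * F (x + l *\<^sub>R w)"
      using \<tau> by simp
    moreover have "(1 - \<tau>) *\<^sub>R x + \<tau> *\<^sub>R y = x + (\<tau> * l) *\<^sub>R w"
      unfolding w(2) by (simp add: algebra_simps)
    ultimately show ?thesis using w(2) by simp
  qed
qed simp

context whitney_family
begin

text \<open>The left-hand side of \<open>(CW^m)\<close> is the Hessian of \<open>P y\<close> at the point \<open>y + t w\<close>.\<close>

lemma hessian_P_taylor:
  assumes "y \<in> C" "2 \<le> m"
  shows "higher_deriv (P y) (y + t *\<^sub>R w) [v, v] =
    (\<Sum>k = 2..m. t ^ (k - 2) / fact (k - 2) * higher_deriv (P y) y (replicate (k - 2) w @ [v, v]))"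
proof -
  have "higher_deriv (P y) (y + t *\<^sub>R w) [v, v] =
      (\<Sum>l\<le>m - 2. t ^ l / fact l * higher_deriv (P y) y (replicate l w @ [v, v]))"
    using taylor_exact[OF derivs_vanish_from_poly[OF poly[OF assms(1)]], of "[v, v]" y t w] assms(2)
    by (simp del: higher_deriv.simps add: numeral_2_eq_2)
  also have "\<dots> = (\<Sum>k = 2..m. t ^ (k - 2) / fact (k - 2) * higher_deriv (P y) y (replicate (k - 2) w @ [v, v]))"
    by (rule sum.reindex_bij_witness[of _ "\<lambda>k. k - 2" "\<lambda>l. l + 2"]) (use assms(2) in auto)
  finally show ?thesis .
qed

lemma hessian_P_lower:
  assumes CW: "cond_CW m C P" and "2 \<le> m" "0 < \<epsilon>"
  shows "\<exists>r>0. \<forall>y\<in>C. \<forall>v w t. norm v = 1 \<longrightarrow> norm w = 1 \<longrightarrow> 0 < t \<longrightarrow> t \<le> r \<longrightarrow>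
    - \<epsilon> * t ^ (m - 2) \<le> higher_deriv (P y) (y + t *\<^sub>R w) [v, v]"
proof -
  obtain r where "r > 0" "\<forall>y\<in>C. \<forall>v\<in>sphere 0 1. \<forall>w\<in>sphere 0 1. \<forall>t. 0 < t \<and> t \<le> r \<longrightarrow>
        (\<Sum>k = 2..m. t ^ (k - 2) / fact (k - 2) * higher_deriv (P y) y (replicate (k - 2) w @ [v, v]))
          \<ge> - \<epsilon> * t ^ (m - 2)"
    using CW assms(3) unfolding cond_CW_def by blast
  then show ?thesis by (intro exI[of _ r]) (simp del: higher_deriv.simps add: hessian_P_taylor assms(2))
qed

text \<open>Let \<open>t\<close> tend to 0 in \<open>(CW^m)\<close>; since \<open>m > 2\<close> the right-hand side tends to 0.\<close>

lemma hessian_P_nonneg: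
  assumes CW: "cond_CW m C P" and m: "2 < m" and y: "y \<in> C" and v: "norm v = 1"
  shows "0 \<le> higher_deriv (P y) y [v, v]"
proof -
  obtain r where r: "r > 0" "\<And>t. 0 < t \<Longrightarrow> t \<le> r \<Longrightarrow>
      - 1 * t ^ (m - 2) \<le> higher_deriv (P y) (y + t *\<^sub>R v) [v, v]"
    using hessian_P_lower[OF CW _ zero_less_one] m y v by (metis less_imp_le)
  let ?f = "\<lambda>t. higher_deriv (P y) (y + t *\<^sub>R v) [v, v] + t ^ (m - 2)"
  have "isCont (\<lambda>t. higher_deriv (P y) (y + t *\<^sub>R v) [v, v]) 0"
    by (rule DERIV_isCont[OF DERIV_higher_deriv_line[OF smooth_P[OF y, of 3]]]) simp
  then have "isCont ?f 0" by (intro continuous_intros)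
  then have "(?f \<longlongrightarrow> ?f 0) (at_right 0)"
    by (simp add: isCont_def filterlim_at_split)
  moreover have "\<forall>\<^sub>F t in at_right 0. 0 \<le> ?f t"
    unfolding eventually_at_right_field using r by (intro exI[of _ r]) (force simp del: higher_deriv.simps)
  ultimately have "0 \<le> ?f 0" by (rule tendsto_lowerbound) simp
  moreover have "(0::real) ^ (m - 2) = 0" using m by (intro zero_power) simp
  ultimately show ?thesis by (simp del: higher_deriv.simps)
qed

lemma hessian_extension_lower:
  assumes CW: "cond_CW m C P" and q: "2 \<le> q" and \<epsilon>: "0 < \<epsilon>"
  shows "\<exists>r>0. \<forall>x v. 0 < infdist x C \<longrightarrow> infdist x C < r \<longrightarrow> norm v = 1 \<longrightarrow>
    - \<epsilon> * infdist x C ^ (m - 2) \<le> higher_deriv extension x [v, v]"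
proof -
  have m: "2 \<le> m" using q q_less by simp
  obtain r1 where r1: "r1 > 0" "\<And>y v w t. y \<in> C \<Longrightarrow> norm v = 1 \<Longrightarrow> norm w = 1 \<Longrightarrow> 0 < t \<Longrightarrow> t \<le> r1 \<Longrightarrow>
    - (\<epsilon> / 2) * t ^ (m - 2) \<le> higher_deriv (P y) (y + t *\<^sub>R w) [v, v]"
    using hessian_P_lower[OF CW m, of "\<epsilon> / 2"] \<epsilon> by (metis half_gt_zero)
  obtain r2 where r2: "r2 > 0" "\<And>x us. 0 < infdist x C \<Longrightarrow> infdist x C < r2 \<Longrightarrow> length us \<le> q \<Longrightarrow>
    \<bar>higher_deriv extension x us - higher_deriv (P (near x)) x us\<bar>
      \<le> \<epsilon> / 2 * infdist x C ^ (m - length us) * prod_list (map norm us)"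
    using extension_near[of "\<epsilon> / 2"] \<epsilon> by (metis half_gt_zero)
  have "- \<epsilon> * infdist x C ^ (m - 2) \<le> higher_deriv extension x [v, v]"
    if x: "0 < infdist x C" "infdist x C < min r1 r2" and v: "norm v = 1" for x v
  proof -
    define t where "t = infdist x C"
    define w where "w = (1 / t) *\<^sub>R (x - near x)"
    have t: "0 < t" "t = norm (x - near x)" using x by (simp_all add: t_def infdist_near dist_norm)
    then have w: "norm w = 1" "near x + t *\<^sub>R w = x" by (simp_all add: w_def)
    have "- (\<epsilon> / 2) * t ^ (m - 2) \<le> higher_deriv (P (near x)) x [v, v]"
      using r1(2)[OF near_in v w(1) t(1), of x] x w(2) by (simp add: t_def)
    moreover have "\<bar>higher_deriv extension x [v, v] - higher_deriv (P (near x)) x [v, v]\<bar> \<le> \<epsilon> / 2 * t ^ (m - 2)"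
      using r2(2)[of x "[v, v]"] x v q by (simp add: t_def numeral_2_eq_2)
    ultimately show ?thesis unfolding t_def[symmetric] abs_le_iff by linarith
  qed
  then show ?thesis using r1(1) r2(1) by (intro exI[of _ "min r1 r2"]) (auto simp del: higher_deriv.simps)
qed

lemma hessian_defect_modulus:
  assumes CW: "cond_CW m C P" and q: "2 \<le> q"
  obtains \<Omega> :: "real \<Rightarrow> real" where "continuous_on UNIV \<Omega>" "mono \<Omega>" "\<And>t. t \<le> 0 \<Longrightarrow> \<Omega> t = 0"
    "\<And>x v. 0 < infdist x C \<Longrightarrow> norm v = 1 \<Longrightarrow>
      - (\<Omega> (infdist x C) * infdist x C ^ (m - 2)) \<le> higher_deriv extension x [v, v]"
proof -
  define S where "S = {(x, v::real^'n). 0 < infdist x C \<and> norm v = 1}"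
  define d where "d = (\<lambda>(x, v::real^'n). infdist x C)"
  define h where "h = (\<lambda>(x, v). - higher_deriv extension x [v, v] / infdist x C ^ (m - 2))"
  have h_le: "h (x, v) \<le> \<epsilon>" if "0 < infdist x C" "- \<epsilon> * infdist x C ^ (m - 2) \<le> higher_deriv extension x [v, v]" for x v \<epsilon>
    unfolding h_def prod.case pos_divide_le_eq[OF zero_less_power[OF that(1)]] using that(2) by linarith
  have small: "\<exists>r>0. \<forall>p\<in>S. d p < r \<longrightarrow> h p \<le> \<epsilon>" if \<epsilon>: "0 < \<epsilon>" for \<epsilon>
  proof -
    obtain r where r: "r > 0" "\<And>x v. 0 < infdist x C \<Longrightarrow> infdist x C < r \<Longrightarrow> norm v = 1 \<Longrightarrow>
        - \<epsilon> * infdist x C ^ (m - 2) \<le> higher_deriv extension x [v, v]"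
      using hessian_extension_lower[OF CW q \<epsilon>] by blast
    have "h (x, v) \<le> \<epsilon>" if "(x, v) \<in> S" "d (x, v) < r" for x v
      using that by (intro h_le r) (auto simp: S_def d_def)
    then show ?thesis using r(1) by (intro exI[of _ r]) auto
  qed
  obtain r where r: "r > 0" "\<forall>p\<in>S. d p < r \<longrightarrow> h p \<le> 1" using small[of 1] by auto
  obtain B where B: "0 \<le> B" "\<And>x us. length us \<le> q \<Longrightarrow> \<bar>higher_deriv extension x us\<bar> \<le> B * prod_list (map norm us)"
    using extension_bounded_jets by blast
  have bd: "h p \<le> max 1 (B / r ^ (m - 2))" if "p \<in> S" for p
  proof (cases "d p < r")
    case True
    then show ?thesis using r that by auto
  next
    case False
    obtain x v where pv: "p = (x, v)" by (cases p)
    with that have p: "p = (x, v)" "0 < infdist x C" "norm v = 1" by (auto simp: S_def)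
    have rx: "r \<le> infdist x C" using False p by (simp add: d_def)
    have "- higher_deriv extension x [v, v] \<le> B" using B(2)[of "[v, v]" x] q p(3) by (simp add: abs_le_iff)
    then have "h p \<le> B / infdist x C ^ (m - 2)"
      unfolding h_def p(1) prod.case by (intro divide_right_mono zero_le_power infdist_nonneg)
    also have "\<dots> \<le> B / r ^ (m - 2)"
      using rx r(1) B(1) by (intro divide_left_mono power_mono mult_pos_pos zero_less_power) auto
    finally show ?thesis by simp
  qed
  have pos: "0 < d p" if "p \<in> S" for p using that by (auto simp: S_def d_def)
  obtain \<Omega> :: "real \<Rightarrow> real" where \<Omega>: "continuous_on UNIV \<Omega>" "mono \<Omega>" "\<And>t. t \<le> 0 \<Longrightarrow> \<Omega> t = 0"
    "\<And>p. p \<in> S \<Longrightarrow> h p \<le> \<Omega> (d p)"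
    using dominating_modulus[of S d h, OF pos bd small] by blast
  show ?thesis
  proof (rule that[OF \<Omega>(1-3)])
    fix x v :: "real^'n" assume xv: "0 < infdist x C" "norm v = 1"
    then have "- higher_deriv extension x [v, v] / infdist x C ^ (m - 2) \<le> \<Omega> (infdist x C)"
      using \<Omega>(4)[of "(x, v)"] unfolding S_def h_def d_def prod.case by blast
    then have "- higher_deriv extension x [v, v] \<le> \<Omega> (infdist x C) * infdist x C ^ (m - 2)"
      unfolding pos_divide_le_eq[OF zero_less_power[OF xv(1)]] .
    then show "- (\<Omega> (infdist x C) * infdist x C ^ (m - 2)) \<le> higher_deriv extension x [v, v]" by linarith
  qed
qed

end

section \<open>The convex extension\<close>

text \<open>The modulus that is integrated is \<open>\<Omega>\<close> rescaled, to undo the dilation in \<open>I_lower\<close>, and multiplied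
by \<open>(D + d)^(n+1)\<close>, to undo the denominator of the tube radius \<open>\<rho> = d / (4 (D + d))\<close>. The exponent is
\<open>(q - 2) + (n + 1)\<close>.\<close>

lemma convex_correction_exists:
  fixes C :: "'a::euclidean_space set" and \<Omega> :: "real \<Rightarrow> real"
  assumes C: "compact C" "convex C" "C \<noteq> {}"
    and \<Omega>: "continuous_on UNIV \<Omega>" "mono \<Omega>" "\<And>t. t \<le> 0 \<Longrightarrow> \<Omega> t = 0"
    and q: "2 \<le> q"
  obtains \<phi> where "C_k q \<phi>" "\<And>x us. x \<in> C \<Longrightarrow> length us \<le> q \<Longrightarrow> higher_deriv \<phi> x us = 0"
    "\<And>x v. 0 < infdist x C \<Longrightarrow> norm v = 1 \<Longrightarrow>
      \<Omega> (infdist x C) * infdist x C ^ (q - 1 + DIM('a)) \<le> higher_deriv \<phi> x [v, v]"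
proof -
  define n where "n = DIM('a)"
  define V where "V = unit_ball_vol (real n)"
  have V: "0 < V" unfolding V_def by simp
  obtain R where R: "R > 0" "\<And>c. c \<in> C \<Longrightarrow> norm c \<le> R"
    using compact_imp_bounded[OF C(1)] by (auto simp: bounded_pos)
  define D where "D = 2 * R"
  have D: "0 < D" "\<And>c c'. c \<in> C \<Longrightarrow> c' \<in> C \<Longrightarrow> norm (c - c') \<le> D"
  proof -
    show "0 < D" using R(1) by (simp add: D_def)
    fix c c' assume "c \<in> C" "c' \<in> C"
    then show "norm (c - c') \<le> D"
      using norm_triangle_ineq4[of c c'] R(2)[of c] R(2)[of c'] by (simp add: D_def)
  qed
  define c :: real where "c = (\<Prod>j<q - 2. 1 / 2 ^ Suc j)"
  have c: "0 < c" unfolding c_def by (intro prod_pos) auto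
  define \<kappa> where "\<kappa> = 1 / (c * (1 / 4) ^ (q - 2) * (V / 16) * (1 / 16) ^ (n + 1))"
  have \<kappa>: "0 < \<kappa>" using c V by (simp add: \<kappa>_def)
  define \<mu> :: real where "\<mu> = 4 * 2 ^ (q - 2)"
  have \<mu>: "0 < \<mu>" by (simp add: \<mu>_def)
  have \<Omega>0: "0 \<le> \<Omega> t" for t using monoD[OF \<Omega>(2), of "min 0 t" t] \<Omega>(3)[of "min 0 t"] by simp
  \<comment> \<open>\<open>\<kappa>\<close> cancels the constants of the final estimate; \<open>\<mu>\<close> undoes the dilations by \<open>4\<close> and \<open>2^(q-2)\<close>.\<close>
  define \<Omega>1 where "\<Omega>1 = (\<lambda>s. \<kappa> * (\<Omega> (\<mu> * s) * (D + \<mu> * max 0 s) ^ (n + 1)))"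
  interpret convex_correction \<Omega>1 C
  proof
    show "continuous_on UNIV \<Omega>1" unfolding \<Omega>1_def
      by (intro continuous_intros continuous_on_compose2[OF \<Omega>(1)]) auto
    show "mono \<Omega>1"
    proof
      fix s t :: real assume st: "s \<le> t"
      then have "\<mu> * s \<le> \<mu> * t" "\<mu> * max 0 s \<le> \<mu> * max 0 t" using \<mu> by auto
      then show "\<Omega>1 s \<le> \<Omega>1 t" unfolding \<Omega>1_def
        using \<kappa> D(1) \<mu> \<Omega>0 monoD[OF \<Omega>(2)]
        by (intro mult_left_mono mult_mono power_mono) auto
    qed
    show "\<Omega>1 t = 0" if "t \<le> 0" for t
      using \<Omega>(3)[of "\<mu> * t"] that \<mu> by (simp add: \<Omega>1_def mult_nonneg_nonpos)
  qed (use C in auto)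
  define \<phi> where "\<phi> = Phi q (\<lambda>_. 1)"
  have one: "continuous_on UNIV (\<lambda>_::'a. 1::real)" by (rule continuous_on_const)
  show ?thesis
  proof
    show "C_k q \<phi>" unfolding \<phi>_def by (rule C_k_Phi[OF one])
    show "higher_deriv \<phi> x us = 0" if "x \<in> C" "length us \<le> q" for x us
      unfolding \<phi>_def by (rule higher_deriv_Phi_eq_0[OF one that(2,1)])
    fix x v :: 'a assume x: "0 < infdist x C" and v: "norm v = 1"
    define d where "d = infdist x C"
    define \<rho> where "\<rho> = d / (4 * (D + d))"
    have d: "0 < d" using x by (simp add: d_def)
    have Dd: "0 < D + d" using D(1) d by simp
    have "higher_deriv \<phi> x [v, v] = Phi (q - 2) (\<lambda>w. (v \<bullet> w)\<^sup>2) x"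
      unfolding \<phi>_def using higher_deriv_Phi[OF one, of "[v, v]" q x] q
      by (simp del: higher_deriv.simps add: power2_eq_square numeral_2_eq_2)
    moreover have "I (q - 2) (d / 4) * (V / 16) * (\<rho> / 4) ^ (n + 1) \<le> Phi (q - 2) (\<lambda>w. (v \<bullet> w)\<^sup>2) x"
      unfolding V_def n_def by (rule Phi_hessian_lower[OF D(2,1) d_def d v \<rho>_def])
    moreover have "c * (d / 4) ^ (q - 2) * \<Omega>1 (d / 4 / 2 ^ (q - 2)) * (V / 16) * (\<rho> / 4) ^ (n + 1)
        \<le> I (q - 2) (d / 4) * (V / 16) * (\<rho> / 4) ^ (n + 1)"
      using I_lower[of "d / 4" "q - 2"] d Dd V
      by (intro mult_right_mono) (auto simp: c_def \<rho>_def)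
    moreover have "c * (d / 4) ^ (q - 2) * \<Omega>1 (d / 4 / 2 ^ (q - 2)) * (V / 16) * (\<rho> / 4) ^ (n + 1)
        = \<Omega> d * d ^ (q - 1 + n)"
    proof -
      have "\<mu> * (d / 4 / 2 ^ (q - 2)) = d" by (simp add: \<mu>_def)
      moreover have "\<mu> * max 0 (d / 4 / 2 ^ (q - 2)) = d" using d by (simp add: \<mu>_def)
      ultimately have o1: "\<Omega>1 (d / 4 / 2 ^ (q - 2)) = \<kappa> * (\<Omega> d * (D + d) ^ (n + 1))"
        by (simp only: \<Omega>1_def)
      have "\<rho> / 4 = d * (1 / 16) * (1 / (D + d))" using Dd by (simp add: \<rho>_def)
      then have o2: "(\<rho> / 4) ^ (n + 1) = d ^ (n + 1) * (1 / 16) ^ (n + 1) * (1 / (D + d)) ^ (n + 1)"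
        by (simp only: power_mult_distrib)
      have o3: "(d / 4) ^ (q - 2) = d ^ (q - 2) * (1 / 4) ^ (q - 2)"
        by (simp add: power_divide)
      have o4: "(D + d) ^ (n + 1) * (1 / (D + d)) ^ (n + 1) = 1"
        using Dd by (simp only: power_mult_distrib[symmetric]) simp
      have o5: "(c * (1 / 4) ^ (q - 2) * (V / 16) * (1 / 16) ^ (n + 1)) * \<kappa> = 1"
      proof -
        have "c * (1 / 4) ^ (q - 2) * (V / 16) * (1 / 16) ^ (n + 1) \<noteq> 0" using c V by simp
        then show ?thesis
          unfolding \<kappa>_def by (simp only: times_divide_eq_right mult_1_right divide_self not_False_eq_True)
      qed
      have "c * (d / 4) ^ (q - 2) * \<Omega>1 (d / 4 / 2 ^ (q - 2)) * (V / 16) * (\<rho> / 4) ^ (n + 1)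
        = ((c * (1 / 4) ^ (q - 2) * (V / 16) * (1 / 16) ^ (n + 1)) * \<kappa>)
          * ((D + d) ^ (n + 1) * (1 / (D + d)) ^ (n + 1)) * (\<Omega> d * (d ^ (q - 2) * d ^ (n + 1)))"
        unfolding o1 o2 o3 by (simp only: mult_ac)
      also have "\<dots> = \<Omega> d * d ^ (q - 2 + (n + 1))" unfolding o4 o5 by (simp only: power_add mult_1)
      also have "q - 2 + (n + 1) = q - 1 + n" using q by simp
      finally show ?thesis .
    qed
    ultimately show "\<Omega> (infdist x C) * infdist x C ^ (q - 1 + DIM('a)) \<le> higher_deriv \<phi> x [v, v]"
      unfolding d_def[symmetric] n_def[symmetric] by linarith
  qed
qed

theorem theorem1p8:
  fixes C :: "(real^'n) set" and f :: "real^'n \<Rightarrow> real"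
    and m :: nat and P :: "real^'n \<Rightarrow> real^'n \<Rightarrow> real"
  assumes "compact C" and "convex C"
    and "m \<ge> CARD('n) + 3"
    and "\<And>y. y \<in> C \<Longrightarrow> poly_deg_le m (P y)"
    and "\<And>y. y \<in> C \<Longrightarrow> P y y = f y"
    and "cond_W m C P"
    and "cond_CW m C P"
  shows "\<exists>F :: real^'n \<Rightarrow> real.
           (\<forall>y\<in>C. F y = f y) \<and> convex_on UNIV F \<and> C_k (m - CARD('n) - 1) F \<and>
           (\<forall>y\<in>C. taylor_poly (m - CARD('n) - 1) y F
                 = taylor_poly (m - CARD('n) - 1) y (P y))"
proof (cases "C = {}")
  case True
  then show ?thesis by (intro exI[of _ "\<lambda>_. 0"]) (simp add: convex_on_const)
next
  case False
  define q where "q = m - CARD('n) - 1"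
  have q: "2 \<le> q" "q < m" "q - 1 + CARD('n) = m - 2" "2 < m" using assms(3) by (auto simp: q_def)
  interpret whitney_family C P m q
    by standard (use assms False q in auto)
  obtain \<Omega> :: "real \<Rightarrow> real" where \<Omega>: "continuous_on UNIV \<Omega>" "mono \<Omega>" "\<And>t. t \<le> 0 \<Longrightarrow> \<Omega> t = 0"
    "\<And>x v. 0 < infdist x C \<Longrightarrow> norm v = 1 \<Longrightarrow>
      - (\<Omega> (infdist x C) * infdist x C ^ (m - 2)) \<le> higher_deriv extension x [v, v]"
    using hessian_defect_modulus[OF assms(7) q(1)] by blast
  obtain \<phi> where \<phi>: "C_k q \<phi>" "\<And>x us. x \<in> C \<Longrightarrow> length us \<le> q \<Longrightarrow> higher_deriv \<phi> x us = 0"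
    "\<And>x v. 0 < infdist x C \<Longrightarrow> norm v = 1 \<Longrightarrow>
      \<Omega> (infdist x C) * infdist x C ^ (q - 1 + DIM(real^'n)) \<le> higher_deriv \<phi> x [v, v]"
    using convex_correction_exists[OF assms(1,2) False \<Omega>(1-3) q(1)] by blast
  define F where "F = (\<lambda>x. extension x + \<phi> x)"
  have F: "C_k q F" unfolding F_def by (intro C_k_add C_k_extension \<phi>(1))
  have DF: "higher_deriv F x us = higher_deriv extension x us + higher_deriv \<phi> x us" if "length us \<le> q" for x us
    unfolding F_def by (rule higher_deriv_add[OF C_k_extension \<phi>(1) that])
  have jet: "higher_deriv F y us = higher_deriv (P y) y us" if "y \<in> C" "length us \<le> q" for y us
    using that by (simp add: DF extension_jet \<phi>(2))
  have "convex_on UNIV F"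
  proof (rule convex_on_of_hessian_nonneg)
    show "C_k 2 F" using F q(1) by (rule C_k_antimono)
    fix x v :: "real^'n" assume v: "norm v = 1"
    show "0 \<le> higher_deriv F x [v, v]"
    proof (cases "x \<in> C")
      case True
      then show ?thesis
        using hessian_P_nonneg[OF assms(7) q(4) True v] jet[OF True, of "[v, v]"] q(1)
        by (simp del: higher_deriv.simps)
    next
      case outside: False
      have d: "0 < infdist x C"
        by (rule infdist_pos_not_in_closed[OF compact_imp_closed[OF assms(1)] False outside])
      show ?thesis
        using \<Omega>(4)[OF d v] \<phi>(3)[OF d v] q DF[of "[v, v]" x] by (simp del: higher_deriv.simps)
    qed
  qed
  moreover have "F y = f y" if "y \<in> C" for y
    using jet[OF that, of "[]"] assms(5)[OF that] by simp
  moreover have "taylor_poly q y F = taylor_poly q y (P y)" if "y \<in> C" for y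
    unfolding taylor_poly_def using jet[OF that] by simp
  ultimately show ?thesis using F unfolding q_def by blast
qed

end
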